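(* Let $\Phi$ be any fixed sentence of the two-variable fragment of first-order logic with counting quantifiers, i.e. a function-free first-order sentence using only the variables $x,y$ (possibly reused), built from atoms, Boolean connectives, the quantifiers $\forall,\exists$ and the counting quantifiers $\exists_{=k},\exists_{\le k},\exists_{\ge k}$ (for finitely many fixed natural numbers $k$). Then computing the weighted first-order model count of $\Phi$ is domain-liftable: there is an algorithm which, given a finite domain $\Delta$ and weight functions $w,\overline{w}$ assigning rational numbers to the predicates of the language, computes $\mathrm{WFOMC}(\Phi,w,\overline{w},\Delta)$ in time polynomial in $|\Delta|$ and in the number of bits needed to encode the weights.
   Context: Fix a function-free first-order language with a finite set $\mathcal{R}$ of predicates. A domain $\Delta$ is a finite set of constants. A possible world $\omega$ on $\Delta$ is a set of ground atoms $R(t_1,\dots,t_{\mathrm{arity}(R)})$ with $R\in\mathcal{R}$, $t_i\in\Delta$ (namely those atoms true in $\omega$); $\Omega_\Delta$ denotes the set of all possible worlds on $\Delta$. For a predicate $R$, $N(R,\omega)$ is the number of ground atoms of $R$ in $\omega$. Given weight functions $w,\overline{w}:\mathcal{R}\to\mathbb{Q}$, a sentence $\Gamma$ and a set $\Omega$ of possible worlds on $\Delta$, $$\mathrm{WFOMC}(\Gamma,w,\overline{w},\Omega)=\sum_{\omega\in\Omega,\ \omega\models\Gamma}\ \prod_{R\in\mathcal{R}} w(R)^{N(R,\omega)}\,\overline{w}(R)^{|\Delta|^{\mathrm{arity}(R)}-N(R,\omega)},$$ and $\mathrm{WFOMC}(\Gamma,w,\overline{w},\Delta):=\mathrm{WFOMC}(\Gamma,w,\overline{w},\Omega_\Delta)$.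 Counting quantifiers: $\omega\models\exists_{\ge k}x\,\psi(x)$ iff there are at least $k$ distinct $t\in\Delta$ with $\omega\models\psi(t)$; $\exists_{\le k}x\,\psi(x)$ means $\neg\exists_{\ge k+1}x\,\psi(x)$; $\exists_{=k}x\,\psi(x)$ means $\exists_{\le k}x\,\psi(x)\wedge\exists_{\ge k}x\,\psi(x)$. *)

theory Defs
  imports Main "HOL.Rat"
begin

datatype var = VX | VY

text \<open>Predicates are natural numbers; a signature is a list of arities,
  predicate R (R < length sig) having arity sig ! R.\<close>

datatype fm =
    TT | FF
  | Atom nat "var list"
  | Eq var var
  | Not fm
  | And fm fm
  | Or fm fm
  | Imp fm fm
  | Iff fm fm
  | All var fm
  | Ex var fm
  | ExGe nat var fm
  | ExLe nat var fm
  | ExEq nat var fm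

fun wf_fm :: "nat list \<Rightarrow> fm \<Rightarrow> bool" where
  "wf_fm sig (Atom R vs) = (R < length sig \<and> length vs = sig ! R)"
| "wf_fm sig (Not f) = wf_fm sig f"
| "wf_fm sig (And f g) = (wf_fm sig f \<and> wf_fm sig g)"
| "wf_fm sig (Or f g) = (wf_fm sig f \<and> wf_fm sig g)"
| "wf_fm sig (Imp f g) = (wf_fm sig f \<and> wf_fm sig g)"
| "wf_fm sig (Iff f g) = (wf_fm sig f \<and> wf_fm sig g)"
| "wf_fm sig (All v f) = wf_fm sig f"
| "wf_fm sig (Ex v f) = wf_fm sig f"
| "wf_fm sig (ExGe k v f) = wf_fm sig f"
| "wf_fm sig (ExLe k v f) = wf_fm sig f"
| "wf_fm sig (ExEq k v f) = wf_fm sig f"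
| "wf_fm sig _ = True"

fun free_vars :: "fm \<Rightarrow> var set" where
  "free_vars (Atom R vs) = set vs"
| "free_vars (Eq u v) = {u, v}"
| "free_vars (Not f) = free_vars f"
| "free_vars (And f g) = free_vars f \<union> free_vars g"
| "free_vars (Or f g) = free_vars f \<union> free_vars g"
| "free_vars (Imp f g) = free_vars f \<union> free_vars g"
| "free_vars (Iff f g) = free_vars f \<union> free_vars g"
| "free_vars (All v f) = free_vars f - {v}"
| "free_vars (Ex v f) = free_vars f - {v}"
| "free_vars (ExGe k v f) = free_vars f - {v}"
| "free_vars (ExLe k v f) = free_vars f - {v}"
| "free_vars (ExEq k v f) = free_vars f - {v}"
| "free_vars _ = {}"

definition sentence :: "fm \<Rightarrow> bool" where
  "sentence f \<longleftrightarrow> free_vars f = {}"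

text \<open>A possible world is a set of ground atoms (R, [t1,...,tm]).\<close>
type_synonym 'a world = "(nat \<times> 'a list) set"

fun sat :: "'a set \<Rightarrow> 'a world \<Rightarrow> (var \<Rightarrow> 'a) \<Rightarrow> fm \<Rightarrow> bool" where
  "sat D \<omega> \<sigma> TT = True"
| "sat D \<omega> \<sigma> FF = False"
| "sat D \<omega> \<sigma> (Atom R vs) = ((R, map \<sigma> vs) \<in> \<omega>)"
| "sat D \<omega> \<sigma> (Eq u v) = (\<sigma> u = \<sigma> v)"
| "sat D \<omega> \<sigma> (Not f) = (\<not> sat D \<omega> \<sigma> f)"
| "sat D \<omega> \<sigma> (And f g) = (sat D \<omega> \<sigma> f \<and> sat D \<omega> \<sigma> g)"
| "sat D \<omega> \<sigma> (Or f g) = (sat D \<omega> \<sigma> f \<or> sat D \<omega> \<sigma> g)"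
| "sat D \<omega> \<sigma> (Imp f g) = (sat D \<omega> \<sigma> f \<longrightarrow> sat D \<omega> \<sigma> g)"
| "sat D \<omega> \<sigma> (Iff f g) = (sat D \<omega> \<sigma> f \<longleftrightarrow> sat D \<omega> \<sigma> g)"
| "sat D \<omega> \<sigma> (All v f) = (\<forall>t\<in>D. sat D \<omega> (\<sigma>(v := t)) f)"
| "sat D \<omega> \<sigma> (Ex v f) = (\<exists>t\<in>D. sat D \<omega> (\<sigma>(v := t)) f)"
| "sat D \<omega> \<sigma> (ExGe k v f) = (card {t\<in>D. sat D \<omega> (\<sigma>(v := t)) f} \<ge> k)"
| "sat D \<omega> \<sigma> (ExLe k v f) = (card {t\<in>D. sat D \<omega> (\<sigma>(v := t)) f} \<le> k)"
| "sat D \<omega> \<sigma> (ExEq k v f) = (card {t\<in>D. sat D \<omega> (\<sigma>(v := t)) f} = k)"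

text \<open>Truth of a sentence (the assignment is irrelevant for sentences).\<close>
definition models :: "'a set \<Rightarrow> 'a world \<Rightarrow> fm \<Rightarrow> bool" where
  "models D \<omega> f \<longleftrightarrow> (\<forall>\<sigma>. sat D \<omega> \<sigma> f)"

definition ground_atoms :: "nat list \<Rightarrow> 'a set \<Rightarrow> (nat \<times> 'a list) set" where
  "ground_atoms sig D = {(R, ts). R < length sig \<and> length ts = sig ! R \<and> set ts \<subseteq> D}"

definition worlds :: "nat list \<Rightarrow> 'a set \<Rightarrow> 'a world set" where
  "worlds sig D = Pow (ground_atoms sig D)"

definition Ncount :: "nat \<Rightarrow> 'a world \<Rightarrow> nat" where
  "Ncount R \<omega> = card {ts. (R, ts) \<in> \<omega>}"

definition WFOMC :: "nat list \<Rightarrow> fm \<Rightarrow> (nat \<Rightarrow> rat) \<Rightarrow> (nat \<Rightarrow> rat) \<Rightarrow> 'a set \<Rightarrow> rat" where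
  "WFOMC sig f w wb D =
     (\<Sum>\<omega>\<in>{\<omega>\<in>worlds sig D. models D \<omega> f}.
        \<Prod>R<length sig. w R ^ Ncount R \<omega> * wb R ^ (card D ^ (sig ! R) - Ncount R \<omega>))"

fun nbits :: "nat \<Rightarrow> nat" where
  "nbits n = (if n = 0 then 0 else Suc (nbits (n div 2)))"

definition bitlen :: "int \<Rightarrow> nat" where
  "bitlen x = Suc (nbits (nat \<bar>x\<bar>))"

datatype instr =
    Const nat int
  | Add nat nat nat
  | Sub nat nat nat
  | Mul nat nat nat
  | Div nat nat nat        (* r_i := r_j div r_k  (floor; x div 0 = 0) *)
  | Load nat nat
  | Store nat nat
  | Jz nat nat
  | Halt

type_synonym prog = "instr list"
type_synonym config = "nat \<times> (nat \<Rightarrow> int)"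

definition halted :: "prog \<Rightarrow> config \<Rightarrow> bool" where
  "halted P c \<longleftrightarrow> fst c \<ge> length P \<or> P ! fst c = Halt"

fun step_instr :: "instr \<Rightarrow> config \<Rightarrow> config \<times> nat" where
  "step_instr (Const i x) (pc, r) = ((Suc pc, r(i := x)), 1 + bitlen x)"
| "step_instr (Add i j k) (pc, r) = ((Suc pc, r(i := r j + r k)), 1 + bitlen (r j) + bitlen (r k))"
| "step_instr (Sub i j k) (pc, r) = ((Suc pc, r(i := r j - r k)), 1 + bitlen (r j) + bitlen (r k))"
| "step_instr (Mul i j k) (pc, r) = ((Suc pc, r(i := r j * r k)), 1 + bitlen (r j) + bitlen (r k))"
| "step_instr (Div i j k) (pc, r) = ((Suc pc, r(i := r j div r k)), 1 + bitlen (r j) + bitlen (r k))"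
| "step_instr (Load i j) (pc, r) =
     ((Suc pc, r(i := r (nat (r j)))), 1 + bitlen (r j) + bitlen (r (nat (r j))))"
| "step_instr (Store i j) (pc, r) =
     ((Suc pc, r(nat (r i) := r j)), 1 + bitlen (r i) + bitlen (r j))"
| "step_instr (Jz i l) (pc, r) = ((if r i = 0 then l else Suc pc, r), 1 + bitlen (r i))"
| "step_instr Halt c = (c, 1)"

fun run :: "prog \<Rightarrow> nat \<Rightarrow> config \<Rightarrow> config \<times> nat" where
  "run P 0 c = (c, 0)"
| "run P (Suc n) c =
     (if halted P c then (c, 0)
      else (let (c', k) = step_instr (P ! fst c) c; (c'', k') = run P n c' in (c'', k + k')))"

definition init_config :: "int list \<Rightarrow> config" where
  "init_config xs = (0, \<lambda>i. if i < length xs then xs ! i else 0)"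

definition computes_within :: "prog \<Rightarrow> int list \<Rightarrow> nat \<Rightarrow> rat \<Rightarrow> bool" where
  "computes_within P xs T q \<longleftrightarrow>
     (\<exists>n. let (c, k) = run P n (init_config xs)
          in halted P c \<and> k \<le> T \<and> snd c 1 \<noteq> 0 \<and> q = of_int (snd c 0) / of_int (snd c 1))"

text \<open>The domain is given by its size; each weight is given by its reduced
  numerator and denominator.\<close>
definition enc :: "nat list \<Rightarrow> nat \<Rightarrow> (nat \<Rightarrow> rat) \<Rightarrow> (nat \<Rightarrow> rat) \<Rightarrow> int list" where
  "enc sig n w wb = int n #
     concat (map (\<lambda>R. [fst (quotient_of (w R)), snd (quotient_of (w R)),
                       fst (quotient_of (wb R)), snd (quotient_of (wb R))]) [0..<length sig])"

definition enc_size :: "nat list \<Rightarrow> nat \<Rightarrow> (nat \<Rightarrow> rat) \<Rightarrow> (nat \<Rightarrow> rat) \<Rightarrow> nat" where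
  "enc_size sig n w wb = n + sum_list (map bitlen (tl (enc sig n w wb)))"

end

theory Submission
  imports Defs "HOL-Library.FuncSet"
begin

text \<open>
  Every world determines, for each element, the set of counting subformulas true of it. Summing over
  all guesses of these colours, the colours are correct iff every element has the prescribed degrees,
  and these conditions are thresholds \<open>\<delta> \<ge> k\<close> or \<open>\<delta> < k\<close> on numbers \<open>\<delta>\<close> of neighbours.

  The thresholds are made multiplicative over pairs of elements at the price of working modulo a
  large number \<open>B\<close>: the polynomial \<open>\<Prod>j<k. (B ^ j - X)\<close> vanishes at \<open>X = B ^ \<delta>\<close> for \<open>\<delta> < k\<close>, and is
  \<open>B ^ (k choose 2)\<close> times a number congruent to 1 modulo \<open>B\<close> for \<open>\<delta> \<ge> k\<close>. Expanding it into powers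
  \<open>(B ^ s) ^ \<delta>\<close> turns the count into a sum, over labellings of the elements by finitely many labels, of
  products of vertex weights and pair weights, which by symmetry is a sum of fixed depth of binomial
  coefficients and powers. The true count is recovered from its residue modulo \<open>B\<close>, with \<open>B\<close> more
  than twice an a priori bound.

  After clearing denominators everything is given by one arithmetic expression with sums and products
  over ranges of length polynomial in the domain size, and such expressions are evaluated by the
  machine in polynomial time.
\<close>

section \<open>Polynomially bounded arithmetic expressions\<close>

text \<open>The labelling sum tolerates only weights that multiply over pairs, whereas a threshold
  concerns all neighbours at once. For \<open>k \<ge> 2\<close> no fixed combination of exponentials
  \<open>x ^ \<delta>\<close> equals the indicator of \<open>\<delta> \<ge> k\<close> exactly;
  asking for it only modulo \<open>B\<close>, up to a known power of \<open>B\<close>, is what makes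
  \<open>k + 1\<close> exponentials enough. Their number must not grow with the domain, because the
  number of labels is the nesting depth of the loops and thus enters the exponent of the running
  time. The base \<open>B\<close> is exponential in value but has polynomially many bits.

  Guessing colours does not overcount: the degree conditions, read by induction on the formula, have
  exactly one solution, even for nested counting. Arbitrary arities are harmless: two variables
  never reach an atom with three or more distinct arguments, so such an atom contributes a free
  factor, the sum of its two weights. Propositional atoms belong to no element and are summed
  outside the labellings. The empty domain has no element at which the sentence could be tested and
  is treated by a separate sum of constant size.\<close>

datatype bop = Plus | Minus | Times | Quot

fun bop_fun :: "bop \<Rightarrow> int \<Rightarrow> int \<Rightarrow> int" where
  "bop_fun Plus x y = x + y"
| "bop_fun Minus x y = x - y"
| "bop_fun Times x y = x * y"
| "bop_fun Quot x y = x div y"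

fun bop_unit :: "bop \<Rightarrow> int" where
  "bop_unit Times = 1"
| "bop_unit _ = 0"

primrec accum :: "bop \<Rightarrow> (nat \<Rightarrow> int) \<Rightarrow> nat \<Rightarrow> int" where
  "accum op g 0 = bop_unit op"
| "accum op g (Suc i) = bop_fun op (accum op g i) (g i)"

lemma accum_Plus [simp]: "accum Plus g n = (\<Sum>i<n. g i)"
  by (induction n) auto

lemma accum_Times [simp]: "accum Times g n = (\<Prod>i<n. g i)"
  by (induction n) auto

text \<open>\<open>Big op x e\<close> accumulates \<open>e\<close> over the values \<open>x = 0, \<dots>, N - 1\<close>; one bound \<open>N\<close> serves all
  loops of an expression, which is what keeps running times polynomial.\<close>

datatype expr = Lit int | Vr nat | Op bop expr expr | Big bop nat expr

primrec eval :: "nat \<Rightarrow> expr \<Rightarrow> (nat \<Rightarrow> int) \<Rightarrow> int" where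
  "eval N (Lit k) \<rho> = k"
| "eval N (Vr x) \<rho> = \<rho> x"
| "eval N (Op op a b) \<rho> = bop_fun op (eval N a \<rho>) (eval N b \<rho>)"
| "eval N (Big op x a) \<rho> = accum op (\<lambda>i. eval N a (\<rho>(x := int i))) N"

primrec vars :: "expr \<Rightarrow> nat set" where
  "vars (Lit k) = {}"
| "vars (Vr x) = {x}"
| "vars (Op op a b) = vars a \<union> vars b"
| "vars (Big op x a) = insert x (vars a)"

lemma finite_vars [simp]: "finite (vars e)"
  by (induction e) auto

section \<open>Bit lengths\<close>

declare nbits.simps [simp del]

lemma nbits_le_iff: "nbits n \<le> k \<longleftrightarrow> n < 2 ^ k"
proof (induction k arbitrary: n)
  case 0
  then show ?case by (subst nbits.simps) auto
next
  case (Suc k)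
  show ?case
  proof (cases "n = 0")
    case False
    then have "nbits n \<le> Suc k \<longleftrightarrow> n div 2 < 2 ^ k"
      by (subst nbits.simps) (simp add: Suc)
    also have "\<dots> \<longleftrightarrow> n < 2 ^ Suc k" by (simp add: div_less_iff_less_mult mult.commute)
    finally show ?thesis .
  qed (simp add: nbits.simps)
qed

lemma bitlen_le_iff: "bitlen x \<le> Suc k \<longleftrightarrow> \<bar>x\<bar> < 2 ^ k"
  by (simp add: bitlen_def nbits_le_iff nat_less_iff)

lemma bitlen_0 [simp]: "bitlen 0 = 1"
  by (simp add: bitlen_def nbits.simps)

lemma bitlen_1 [simp]: "bitlen 1 = 2"
  by (simp add: bitlen_def nbits.simps)

lemma bitlen_int: "bitlen (int n) \<le> Suc n"
  by (simp add: bitlen_le_iff)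

text \<open>Floor division rounds negative quotients away from zero, but comparing the divisor with
  1 still bounds them by the dividend. Negative divisors reduce to positive ones by flipping both
  signs, and division by 0 gives 0.\<close>

lemma abs_div_le: "\<bar>x div y\<bar> \<le> \<bar>x :: int\<bar>"
proof -
  have pos: "\<bar>u div v\<bar> \<le> \<bar>u\<bar>" if "v > 0" for u v :: int
  proof (cases "u \<ge> 0")
    case True
    then show ?thesis using that zdiv_mono2[of u 1 v] by (simp add: pos_imp_zdiv_nonneg_iff)
  next
    case False
    then have "u div v < 0" using that by (simp add: pos_imp_zdiv_neg_iff)
    then show ?thesis using False that zdiv_mono2_neg[of u 1 v] by simp
  qed
  consider "y = 0" | "y > 0" | "y < 0" by linarith
  then show ?thesis
    using pos[of y x] pos[of "- y" "- x"] by cases auto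
qed

text \<open>With lengths \<open>a + 1\<close> and \<open>b + 1\<close> the operands are below
  \<open>2 ^ a\<close> and \<open>2 ^ b\<close>. A product stays below \<open>2 ^ (a + b)\<close>,
  and the one remaining bit absorbs the carry of a sum or difference.\<close>

lemma bitlen_bop: "bitlen (bop_fun op x y) \<le> bitlen x + bitlen y"
proof -
  obtain a b where a: "bitlen x = Suc a" and b: "bitlen y = Suc b"
    by (auto simp: bitlen_def)
  have x: "\<bar>x\<bar> < 2 ^ a" and y: "\<bar>y\<bar> < 2 ^ b"
    using a b by (auto simp flip: bitlen_le_iff)
  have ge: "(1::int) \<le> 2 ^ a" "(1::int) \<le> 2 ^ b" by auto
  have mul: "(2::int) ^ (a + b) \<ge> 2 ^ a" "(2::int) ^ (a + b) \<ge> 2 ^ b"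
    by (auto intro!: power_increasing)
  have "\<bar>bop_fun op x y\<bar> < 2 ^ (a + b + 1)"
  proof (cases op)
    case Times
    have "\<bar>x\<bar> * \<bar>y\<bar> < 2 ^ a * 2 ^ b"
      using x y by (intro mult_strict_mono) auto
    then have "\<bar>x * y\<bar> < 2 ^ (a + b)" by (simp add: abs_mult power_add)
    then show ?thesis using Times by simp
  next
    case Quot
    have "\<bar>x div y\<bar> < 2 ^ (a + b)" using abs_div_le[of x y] x mul(1) by linarith
    then show ?thesis using Quot by simp
  next
    case Plus
    have "\<bar>x + y\<bar> < 2 ^ (a + b) + 2 ^ (a + b)" using x y mul by linarith
    then show ?thesis using Plus by simp
  next
    case Minus
    have "\<bar>x - y\<bar> < 2 ^ (a + b) + 2 ^ (a + b)" using x y mul by linarith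
    then show ?thesis using Minus by simp
  qed
  then show ?thesis
    using a b by (simp add: bitlen_le_iff[of _ "a + b + 1", simplified])
qed

text \<open>The 2 is the length of the start value 1. Each step adds only the length of one operand,
  so a loop multiplies lengths by the number of iterations.\<close>

lemma bitlen_accum:
  assumes "\<And>i. i < n \<Longrightarrow> bitlen (g i) \<le> b"
  shows "bitlen (accum op g n) \<le> 2 + n * b"
  using assms
proof (induction n)
  case 0
  show ?case by (cases op) auto
next
  case (Suc n)
  have "bitlen (accum op g (Suc n)) \<le> bitlen (accum op g n) + bitlen (g n)"
    by (simp add: bitlen_bop)
  also have "\<dots> \<le> (2 + n * b) + b" using Suc by (intro add_mono) auto
  finally show ?case by simp
qed

text \<open>\<open>L\<close> bounds both the lengths of the variables and the number of iterations.
  Each loop therefore contributes one factor \<open>L\<close>, and the bound is a polynomial whose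
  degree depends on the expression alone.\<close>

primrec bits :: "expr \<Rightarrow> nat \<Rightarrow> nat" where
  "bits (Lit k) L = bitlen k"
| "bits (Vr x) L = L"
| "bits (Op op a b) L = bits a L + bits b L"
| "bits (Big op x a) L = 2 + L * bits a L"

lemma bitlen_eval:
  assumes "N \<le> L" "\<And>x. x \<in> vars e \<Longrightarrow> bitlen (\<rho> x) \<le> L"
  shows "bitlen (eval N e \<rho>) \<le> bits e L"
  using assms(2)
proof (induction e arbitrary: \<rho>)
  case (Op op a b)
  have "bitlen (eval N (Op op a b) \<rho>) \<le> bitlen (eval N a \<rho>) + bitlen (eval N b \<rho>)"
    by (simp add: bitlen_bop)
  also have "\<dots> \<le> bits a L + bits b L"
    using Op by (intro add_mono) auto
  finally show ?case by simp
next
  case (Big op x a)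
  \<comment> \<open>An index \<open>i < N\<close> has \<open>bitlen\<close> at most
    \<open>i + 1 \<le> N \<le> L\<close>, so the same \<open>L\<close> covers the bound
    variable.\<close>
  have "bitlen (eval N a (\<rho>(x := int i))) \<le> bits a L" if "i < N" for i
    using Big.prems that assms(1) bitlen_int[of i] by (intro Big.IH) auto
  then have "bitlen (eval N (Big op x a) \<rho>) \<le> 2 + N * bits a L"
    using bitlen_accum by simp
  also have "\<dots> \<le> 2 + L * bits a L" using assms(1) by simp
  finally show ?case by simp
qed auto

section \<open>Compilation to the random access machine\<close>

text \<open>Records the cost but not the number of steps, so composing fragments only adds costs;
  \<open>exec_run\<close> recovers a step count at the end.\<close>

inductive exec :: "prog \<Rightarrow> config \<Rightarrow> nat \<Rightarrow> config \<Rightarrow> bool" for P where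
  exec_refl: "exec P c 0 c"
| exec_step: "\<not> halted P c \<Longrightarrow> step_instr (P ! fst c) c = (c1, k1) \<Longrightarrow> exec P c1 k2 c2 \<Longrightarrow>
    exec P c (k1 + k2) c2"

lemma exec_trans: "exec P c k c1 \<Longrightarrow> exec P c1 k' c2 \<Longrightarrow> exec P c (k + k') c2"
proof (induction rule: exec.induct)
  case (exec_step c c1 k1 k2 c2)
  then show ?case using exec.exec_step[of P c c1 k1 "k2 + k'"] by (simp add: add.assoc)
qed auto

lemma exec_run: "exec P c k c' \<Longrightarrow> halted P c' \<Longrightarrow> \<exists>n. run P n c = (c', k)"
proof (induction rule: exec.induct)
  case (exec_refl c)
  show ?case by (rule exI[of _ 0]) simp
next
  case (exec_step c c1 k1 k2 c2)
  then obtain n where "run P n c1 = (c2, k2)" by auto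
  then show ?case using exec_step.hyps by (intro exI[of _ "Suc n"]) simp
qed

text \<open>Jump targets are absolute, so a fragment works only at the address it was compiled for;
  correctness is stated inside an arbitrary surrounding program.\<close>

definition placed :: "prog \<Rightarrow> nat \<Rightarrow> prog \<Rightarrow> bool" where
  "placed P p Q \<longleftrightarrow> (\<exists>pre post. P = pre @ Q @ post \<and> length pre = p)"

lemma placed_append: "placed P p (a @ b) \<Longrightarrow> placed P p a \<and> placed P (p + length a) b"
  unfolding placed_def
proof (elim exE conjE, intro conjI)
  fix pre post assume "P = pre @ (a @ b) @ post" "length pre = p"
  then show "\<exists>pre post. P = pre @ a @ post \<and> length pre = p"
    by (intro exI[of _ pre] exI[of _ "b @ post"]) simp
  show "\<exists>pre post. P = pre @ b @ post \<and> length pre = p + length a"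
    using \<open>P = _\<close> \<open>length pre = p\<close> by (intro exI[of _ "pre @ a"] exI[of _ post]) simp
qed

lemma placed_Cons:
  assumes "placed P p (i # is)"
  shows "p < length P \<and> P ! p = i \<and> placed P (Suc p) is"
proof -
  obtain pre post where "P = pre @ (i # is) @ post" "length pre = p"
    using assms by (auto simp: placed_def)
  then show ?thesis using placed_append[of P p "[i]" "is"] assms by auto
qed

lemma exec_placed:
  assumes "placed P p (i # is)" "i \<noteq> Halt" "step_instr i (p, r) = (c1, k1)"
  shows "exec P (p, r) k1 c1"
  using exec_step[of P "(p, r)" c1 k1 0 c1] placed_Cons[OF assms(1)] assms(2,3)
  by (auto simp: halted_def intro: exec_refl)

fun simple :: "instr \<Rightarrow> bool" where
  "simple (Jz _ _) = False"
| "simple Halt = False"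
| "simple _ = True"

text \<open>For jump-free instructions neither the new registers nor the cost depend on the program
  counter, so a dummy 0 serves and the simplifier can run the code symbolically.\<close>

fun straight :: "instr list \<Rightarrow> (nat \<Rightarrow> int) \<Rightarrow> (nat \<Rightarrow> int) \<times> nat" where
  "straight [] r = (r, 0)"
| "straight (i # is) r =
    (let ((_, r1), k1) = step_instr i (0, r); (r2, k2) = straight is r1 in (r2, k1 + k2))"

lemma exec_straight:
  "placed P p is \<Longrightarrow> \<forall>i\<in>set is. simple i \<Longrightarrow>
    exec P (p, r) (snd (straight is r)) (p + length is, fst (straight is r))"
proof (induction "is" arbitrary: p r)
  case Nil
  then show ?case by (simp add: exec_refl)
next
  case (Cons i "is")
  obtain r1 k1 where s: "\<And>q. step_instr i (q, r) = ((Suc q, r1), k1)"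
    using Cons.prems(2) by (cases i) auto
  have "exec P (p, r) k1 (Suc p, r1)"
    using exec_placed[OF Cons.prems(1)] Cons.prems(2) s by (cases i) auto
  moreover have "exec P (Suc p, r1) (snd (straight is r1)) (Suc p + length is, fst (straight is r1))"
    using Cons.IH[of "Suc p" r1] Cons.prems(2) placed_Cons[OF Cons.prems(1)] by simp
  ultimately show ?case using exec_trans s by (fastforce simp: case_prod_beta)
qed

fun bop_instr :: "bop \<Rightarrow> nat \<Rightarrow> nat \<Rightarrow> nat \<Rightarrow> instr" where
  "bop_instr Plus = Add"
| "bop_instr Minus = Sub"
| "bop_instr Times = Mul"
| "bop_instr Quot = Div"

lemma step_bop_instr [simp]:
  "step_instr (bop_instr op i j k) (pc, r) =
    ((Suc pc, r(i := bop_fun op (r j) (r k))), 1 + bitlen (r j) + bitlen (r k))"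
  by (cases op) auto

lemma simple_bop_instr [simp]: "simple (bop_instr op i j k)"
  by (cases op) auto

text \<open>Variable \<open>x\<close> lives in register \<open>x < V\<close>, the loop bound in register \<open>V\<close>, and the result is
  left in register \<open>t > V\<close>. A loop saves its variable in register \<open>t + 1\<close> and restores it at the
  end, so bound variables may be reused freely.\<close>

primrec compile :: "nat \<Rightarrow> expr \<Rightarrow> nat \<Rightarrow> nat \<Rightarrow> instr list" where
  "compile V (Lit k) t p = [Const t k]"
| "compile V (Vr x) t p = [Const t 0, Add t t x]"
| "compile V (Op op a b) t p =
    (let A = compile V a t p in
     let C = compile V b (t + 1) (p + length A) in
     A @ C @ [bop_instr op t t (t + 1)])"
| "compile V (Big op x a) t p =
    (let A = compile V a (t + 3) (p + 7) in
     [Const t (bop_unit op), Const (t + 1) 0, Add (t + 1) (t + 1) x,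
      Const (t + 2) 0, Add (t + 2) (t + 2) V, Const x 0] @
     [Jz (t + 2) (p + 13 + length A)] @
     A @
     [bop_instr op t t (t + 3), Const (t + 3) 1, Add x x (t + 3), Sub (t + 2) (t + 2) (t + 3),
      Const (t + 3) 0] @
     [Jz (t + 3) (p + 6)] @
     [Const x 0, Add x x (t + 1)])"

text \<open>In a loop, \<open>(L + 1) * bits a L\<close> pays in each iteration for reading the
  accumulator, which may have \<open>2 + L * bits a L\<close> bits, and the value of the body. The
  additive constants are generous.\<close>

primrec cost :: "expr \<Rightarrow> nat \<Rightarrow> nat" where
  "cost (Lit k) L = 1 + bitlen k"
| "cost (Vr x) L = 4 + L"
| "cost (Op op a b) L = cost a L + cost b L + 1 + bits a L + bits b L"
| "cost (Big op x a) L = L * (cost a L + (L + 1) * bits a L + 3 * L + 30) + (3 * L + 30)"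

lemma straight_loop_head:
  assumes "x \<noteq> t" "x \<noteq> s" "x \<noteq> u" "V \<noteq> t" "V \<noteq> s" "V \<noteq> u"
  shows "straight [Const t k, Const s 0, Add s s x, Const u 0, Add u u V, Const x 0] r =
    (r(t := k, s := r x, u := r V, x := 0), 11 + bitlen k + bitlen (r x) + bitlen (r V))"
  using assms by simp

lemma straight_loop_tail:
  assumes "x \<noteq> t" "x \<noteq> s" "x \<noteq> u" "t \<noteq> s" "t \<noteq> u" "s \<noteq> u"
  shows "straight [bop_instr op t t u, Const u 1, Add x x u, Sub s s u, Const u 0] r =
    (r(t := bop_fun op (r t) (r u), x := r x + 1, s := r s - 1, u := 0),
     12 + bitlen (r t) + bitlen (r u) + bitlen (r x) + bitlen (r s))"
  using assms by (simp add: fun_upd_twist[of u x] fun_upd_twist[of u s] del: fun_upd_apply) simp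

text \<open>The frame condition covers all registers below \<open>t\<close>, not only the variables:
  it protects the first operand in \<open>t\<close> while the second is computed into
  \<open>t + 1\<close>, and the bookkeeping registers of a loop while its body runs with target
  \<open>t + 3\<close>.\<close>

lemma exec_compile:
  assumes "placed P p (compile V e t p)" "vars e \<subseteq> {..<V}" "V < t" "\<forall>x<V. r x = \<rho> x"
    and "r V = int N" "N \<le> L" "\<forall>x<V. bitlen (\<rho> x) \<le> L"
  shows "\<exists>k r'. exec P (p, r) k (p + length (compile V e t p), r') \<and> k \<le> cost e L \<and>
    r' t = eval N e \<rho> \<and> (\<forall>u<t. r' u = r u)"
  using assms(1-5,7)
proof (induction e arbitrary: p t r \<rho>)
  case (Lit k)
  have "exec P (p, r) (1 + bitlen k) (p + length (compile V (Lit k) t p), r(t := k))"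
    using exec_straight[of P p "[Const t k]" r] Lit.prems(1) by simp
  moreover have "(r(t := k)) t = eval N (Lit k) \<rho>" "\<forall>u<t. (r(t := k)) u = r u" by auto
  ultimately show ?case by (metis cost.simps(1) order_refl)
next
  case (Vr x)
  have x: "x < V" "r x = \<rho> x" "bitlen (\<rho> x) \<le> L" "x \<noteq> t" using Vr.prems by auto
  have "exec P (p, r) (4 + bitlen (\<rho> x)) (p + length (compile V (Vr x) t p), r(t := \<rho> x))"
    using exec_straight[of P p "[Const t 0, Add t t x]" r] Vr.prems(1) x(2,4) by (simp add: eval_nat_numeral)
  moreover have "(r(t := \<rho> x)) t = eval N (Vr x) \<rho>" "\<forall>u<t. (r(t := \<rho> x)) u = r u" by auto
  moreover have "4 + bitlen (\<rho> x) \<le> cost (Vr x) L" using x by simp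
  ultimately show ?case by blast
next
  case (Op op a b)
  define A where "A = compile V a t p"
  define C where "C = compile V b (t + 1) (p + length A)"
  have c: "compile V (Op op a b) t p = A @ C @ [bop_instr op t t (t + 1)]"
    by (simp add: A_def C_def Let_def)
  have pl: "placed P p A" "placed P (p + length A) C"
    "placed P (p + length A + length C) [bop_instr op t t (t + 1)]"
    using placed_append[of P p A] placed_append[of P "p + length A" C] Op.prems(1)
    unfolding c by blast+
  obtain k1 r1 where 1: "exec P (p, r) k1 (p + length A, r1)" "k1 \<le> cost a L"
    "r1 t = eval N a \<rho>" "\<forall>u<t. r1 u = r u"
    using Op.IH(1)[OF pl(1)[unfolded A_def] _ Op.prems(3,4,5,6)] Op.prems(2) unfolding A_def by auto
  obtain k2 r2 where 2: "exec P (p + length A, r1) k2 (p + length A + length C, r2)"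
    "k2 \<le> cost b L" "r2 (t + 1) = eval N b \<rho>" "\<forall>u<t + 1. r2 u = r1 u"
  proof -
    have "vars b \<subseteq> {..<V}" "V < t + 1" "\<forall>x<V. r1 x = \<rho> x" "r1 V = int N"
      using Op.prems(2-5) 1(4) by auto
    then show ?thesis
      using Op.IH(2)[OF pl(2)[unfolded C_def] _ _ _ _ Op.prems(6), of r1] that
      unfolding C_def by blast
  qed
  have 3: "exec P (p + length A + length C, r2) (1 + bitlen (r2 t) + bitlen (r2 (t + 1)))
    (Suc (p + length A + length C), r2(t := bop_fun op (r2 t) (r2 (t + 1))))"
    using exec_straight[OF pl(3)] by simp
  have "bitlen (eval N a \<rho>) \<le> bits a L" "bitlen (eval N b \<rho>) \<le> bits b L"
    using Op.prems assms(6) by (auto intro!: bitlen_eval)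
  then have "k1 + (k2 + (1 + bitlen (r2 t) + bitlen (r2 (t + 1)))) \<le> cost (Op op a b) L"
    using 1 2 by simp
  moreover have "(r2(t := bop_fun op (r2 t) (r2 (t + 1)))) t = eval N (Op op a b) \<rho>"
    "\<forall>u<t. (r2(t := bop_fun op (r2 t) (r2 (t + 1)))) u = r u"
    using 1 2 by auto
  moreover have "p + length (compile V (Op op a b) t p) = Suc (p + length A + length C)"
    unfolding c by simp
  ultimately show ?case
    using exec_trans[OF 1(1) exec_trans[OF 2(1) 3]] by metis
next
  case (Big op x a)
  define A where "A = compile V a (t + 3) (p + 7)"
  \<comment> \<open>Six blocks: set-up \<open>H\<close>, exit test \<open>J\<close> at address
    \<open>p + 6\<close>, body \<open>A\<close>, update \<open>T\<close>, jump back
    \<open>K\<close>, and exit \<open>E\<close> at \<open>p + 13 + length A\<close>. Register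
    \<open>t\<close> accumulates, \<open>t + 1\<close> saves the variable, \<open>t + 2\<close>
    counts down from \<open>N\<close>, and \<open>t + 3\<close> receives the body and is then zeroed
    to make the \<open>Jz\<close> in \<open>K\<close> unconditional. A constant 0 followed by
    \<open>Add\<close> acts as a move.\<close>
  define H where "H = [Const t (bop_unit op), Const (t + 1) 0, Add (t + 1) (t + 1) x,
      Const (t + 2) 0, Add (t + 2) (t + 2) V, Const x 0]"
  define J where "J = [Jz (t + 2) (p + 13 + length A)]"
  define T where "T = [bop_instr op t t (t + 3), Const (t + 3) 1, Add x x (t + 3),
      Sub (t + 2) (t + 2) (t + 3), Const (t + 3) 0]"
  define K where "K = [Jz (t + 3) (p + 6)]"
  define E where "E = [Const x 0, Add x x (t + 1)]"
  have c: "compile V (Big op x a) t p = H @ J @ A @ T @ K @ E"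
    by (simp add: A_def H_def J_def T_def K_def E_def Let_def)
  have len: "length H = 6" "length J = 1" "length T = 5" "length K = 1" "length E = 2"
    by (auto simp: H_def J_def T_def K_def E_def)
  have smp: "\<forall>i\<in>set H. simple i" "\<forall>i\<in>set T. simple i" "\<forall>i\<in>set E. simple i"
    by (auto simp: H_def T_def E_def)
  have pl0: "placed P p H" "placed P (p + 6) (J @ A @ T @ K @ E)"
    using Big.prems(1) placed_append[of P p H] unfolding c len(1)[symmetric] by blast+
  have pl1: "placed P (p + 6) J" "placed P (p + 7) (A @ T @ K @ E)"
    using placed_append[OF pl0(2)] len by (auto simp: eval_nat_numeral)
  have pl2: "placed P (p + 7) A" "placed P (p + 7 + length A) (T @ K @ E)"
    using placed_append[OF pl1(2)] by auto
  have pl3: "placed P (p + 7 + length A) T" "placed P (p + 12 + length A) (K @ E)"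
    using placed_append[OF pl2(2)] len by (auto simp: eval_nat_numeral)
  have pl4: "placed P (p + 12 + length A) K" "placed P (p + 13 + length A) E"
    using placed_append[OF pl3(2)] len by (auto simp: eval_nat_numeral)
  have xV: "x < V" using Big.prems by simp
  define g where "g i = eval N a (\<rho>(x := int i))" for i
  define c1 where "c1 = cost a L + (L + 1) * bits a L + 3 * L + 30"
  have bi: "bitlen (int i) \<le> L" if "i < N" for i
    using that assms(6) bitlen_int[of i] by linarith
  have bN: "bitlen (int (N - i)) \<le> L + 1" for i
    using assms(6) bitlen_int[of "N - i"] by linarith
  have bg: "bitlen (g i) \<le> bits a L" if "i < N" for i
    unfolding g_def using Big.prems bi[OF that] assms(6) by (intro bitlen_eval) auto
  have ba: "bitlen (accum op g i) \<le> 2 + L * bits a L" if "i \<le> N" for i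
  proof -
    have "bitlen (accum op g i) \<le> 2 + i * bits a L"
      using bg that by (intro bitlen_accum) auto
    also have "\<dots> \<le> 2 + L * bits a L" using that assms(6) by simp
    finally show ?thesis .
  qed
  have ne: "x \<noteq> t" "x \<noteq> Suc t" "x \<noteq> Suc (Suc t)" "x \<noteq> t + 3" "V \<noteq> t" "V \<noteq> Suc t"
    "V \<noteq> Suc (Suc t)" "V \<noteq> x"
    using xV Big.prems(3) by auto
  have rx: "r x = \<rho> x" using Big.prems(4) xV by simp
  define r0 where "r0 = r(t := bop_unit op, Suc t := \<rho> x, Suc (Suc t) := int N, x := 0)"
  define k0 where "k0 = 11 + bitlen (bop_unit op) + bitlen (\<rho> x) + bitlen (int N)"
  have "straight H r = (r0, k0)"
    using straight_loop_head[of x t "t + 1" "t + 2" V] ne Big.prems(5) rx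
    unfolding H_def r0_def k0_def by simp
  then have e0: "exec P (p, r) k0 (p + 6, r0)"
    using exec_straight[OF pl0(1) smp(1), of r] len(1) by simp
  have k0: "k0 \<le> 15 + 2 * L"
    using bN[of 0] Big.prems(6) xV unfolding k0_def by (cases op) auto
  have r0: "r0 t = accum op g 0" "r0 (t + 1) = \<rho> x" "r0 (t + 2) = int N" "r0 x = int 0"
    "\<forall>u<t. u \<noteq> x \<longrightarrow> r0 u = r u"
    using ne by (auto simp: r0_def)
  \<comment> \<open>Invariant at the exit test after \<open>i\<close> iterations. The frame
    condition exempts \<open>x\<close>, which holds the index until \<open>E\<close> restores
    it.\<close>
  have loop: "\<exists>k r'. exec P (p + 6, r0) k (p + 6, r') \<and> k \<le> i * c1 \<and> r' t = accum op g i \<and>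
    r' (t + 1) = \<rho> x \<and> r' (t + 2) = int (N - i) \<and> r' x = int i \<and> (\<forall>u<t. u \<noteq> x \<longrightarrow> r' u = r u)"
    if "i \<le> N" for i
    using that
  proof (induction i)
    case 0
    then show ?case using r0 by (intro exI[of _ 0] exI[of _ r0]) (auto intro: exec_refl)
  next
    case (Suc i)
    then obtain k r1 where 1: "exec P (p + 6, r0) k (p + 6, r1)" "k \<le> i * c1"
      "r1 t = accum op g i" "r1 (t + 1) = \<rho> x" "r1 (t + 2) = int (N - i)" "r1 x = int i"
      "\<forall>u<t. u \<noteq> x \<longrightarrow> r1 u = r u"
      by auto
    have iN: "i < N" using Suc.prems by simp
    have 2: "exec P (p + 6, r1) (1 + bitlen (r1 (t + 2))) (p + 7, r1)"
      using exec_placed[OF pl1(1)[unfolded J_def], of r1] 1(5) iN by (simp add: eval_nat_numeral)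
    obtain k3 r3 where 3: "exec P (p + 7, r1) k3 (p + 7 + length A, r3)" "k3 \<le> cost a L"
      "r3 (t + 3) = g i" "\<forall>u<t + 3. r3 u = r1 u"
    proof -
      have "vars a \<subseteq> {..<V}" "V < t + 3" using Big.prems(2,3) by auto
      moreover have "r1 y = (\<rho>(x := int i)) y" "bitlen ((\<rho>(x := int i)) y) \<le> L" if "y < V" for y
        using that 1(6,7) Big.prems(3) Big.prems(4,6)[rule_format, OF that] bi[OF iN] by auto
      moreover have "r1 V = int N" using 1(7) Big.prems(3,5) xV by simp
      ultimately show ?thesis
        using Big.IH[OF pl2(1)[unfolded A_def], of r1 "\<rho>(x := int i)"] that
        unfolding A_def g_def by blast
    qed
    have r3: "r3 t = accum op g i" "r3 (t + 1) = \<rho> x" "r3 (t + 2) = int (N - i)" "r3 x = int i"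
      using 3(4) 1 xV Big.prems(3) by auto
    define r4 where "r4 = r3(t := accum op g (Suc i), x := int (Suc i),
      t + 2 := int (N - Suc i), t + 3 := 0)"
    define k4 where "k4 = 12 + bitlen (accum op g i) + bitlen (g i) + bitlen (int i) + bitlen (int (N - i))"
    have d: "x \<noteq> t" "x \<noteq> t + 2" "x \<noteq> t + 3" "t \<noteq> t + 2" "t \<noteq> t + 3" "t + 2 \<noteq> t + 3"
      and N: "int (N - Suc i) = int (N - i) - 1"
      and i1: "int (Suc i) = int i + 1"
      using ne iN by auto
    have "straight T r3 = (r4, k4)"
      unfolding T_def straight_loop_tail[OF d] r4_def k4_def r3 3(3) N i1 accum.simps ..
    then have 4: "exec P (p + 7 + length A, r3) k4 (p + 12 + length A, r4)"
      using exec_straight[OF pl3(1) smp(2), of r3] len(3) by (simp add: ac_simps)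
    have r4: "r4 t = accum op g (Suc i)" "r4 (t + 1) = \<rho> x" "r4 (t + 2) = int (N - Suc i)"
      "r4 x = int (Suc i)" "r4 (t + 3) = 0" "\<forall>u<t. u \<noteq> x \<longrightarrow> r4 u = r u"
      using r3 3(4) 1(7) ne by (auto simp: r4_def)
    have k4: "k4 \<le> 20 + L * bits a L + bits a L + 2 * L"
      using ba[of i] bg[OF iN] bi[OF iN] bN[of i] iN unfolding k4_def by simp
    have 5: "exec P (p + 12 + length A, r4) 2 (p + 6, r4)"
      using exec_placed[OF pl4(1)[unfolded K_def], of r4] r4(5) by (simp add: numeral_2_eq_2)
    have "k + ((1 + bitlen (r1 (t + 2))) + (k3 + (k4 + 2))) \<le> Suc i * c1"
    proof -
      have "Suc i * c1 = i * c1 + (cost a L + (L * bits a L + bits a L) + 3 * L + 30)"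
        by (simp add: c1_def)
      moreover have "bitlen (r1 (t + 2)) \<le> L + 1" using 1(5) bN[of i] by simp
      ultimately show ?thesis using 1(2) 3(2) k4 by linarith
    qed
    moreover have "exec P (p + 6, r0) (k + ((1 + bitlen (r1 (t + 2))) + (k3 + (k4 + 2)))) (p + 6, r4)"
      by (rule exec_trans[OF 1(1) exec_trans[OF 2 exec_trans[OF 3(1) exec_trans[OF 4 5]]]])
    ultimately show ?case using r4(1-4,6) by (intro exI conjI)
  qed
  obtain k r1 where 1: "exec P (p + 6, r0) k (p + 6, r1)" "k \<le> N * c1"
    "r1 t = accum op g N" "r1 (t + 1) = \<rho> x" "r1 (t + 2) = 0" "r1 x = int N"
    "\<forall>u<t. u \<noteq> x \<longrightarrow> r1 u = r u"
    using loop[of N] by auto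
  have 2: "exec P (p + 6, r1) 2 (p + 13 + length A, r1)"
    using exec_placed[OF pl1(1)[unfolded J_def], of r1] 1(5) by (simp add: numeral_2_eq_2)
  have 3: "exec P (p + 13 + length A, r1) (4 + bitlen (\<rho> x)) (p + 15 + length A, r1(x := \<rho> x))"
  proof -
    have "straight E r1 = (r1(x := \<rho> x), 4 + bitlen (\<rho> x))"
      using 1(4) ne by (simp add: E_def)
    then show ?thesis
      using exec_straight[OF pl4(2) smp(3), of r1] len(5) by (simp add: ac_simps)
  qed
  have "N * c1 \<le> L * c1" using assms(6) by simp
  then have kk: "k0 + (k + (2 + (4 + bitlen (\<rho> x)))) \<le> cost (Big op x a) L"
    using k0 1(2) Big.prems(6)[rule_format, OF xV] unfolding c1_def cost.simps by linarith
  have l: "p + length (compile V (Big op x a) t p) = p + 15 + length A"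
    unfolding c using len by simp
  have rt: "(r1(x := \<rho> x)) t = eval N (Big op x a) \<rho>"
    using 1(3) ne(1) by (simp add: g_def[abs_def])
  have ru: "\<forall>u<t. (r1(x := \<rho> x)) u = r u"
    using 1(7) rx by auto
  have "exec P (p, r) (k0 + (k + (2 + (4 + bitlen (\<rho> x)))))
    (p + length (compile V (Big op x a) t p), r1(x := \<rho> x))"
    unfolding l by (rule exec_trans[OF e0 exec_trans[OF 1(1) exec_trans[OF 2 3]]])
  then show ?case using kk rt ru by (intro exI conjI)
qed

section \<open>Polynomial bounds\<close>

text \<open>The base \<open>L + 1\<close> is at least 1, so raising the exponent always weakens the
  bound, also at \<open>L = 0\<close>.\<close>

definition poly_bounded :: "(nat \<Rightarrow> nat) \<Rightarrow> bool" where
  "poly_bounded f \<longleftrightarrow> (\<exists>c d. \<forall>L. f L \<le> c * (L + 1) ^ d)"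

lemma poly_bounded_const: "poly_bounded (\<lambda>L. k)"
  unfolding poly_bounded_def by (rule exI[of _ k], rule exI[of _ 0]) simp

lemma poly_bounded_id: "poly_bounded (\<lambda>L. L)"
  unfolding poly_bounded_def by (rule exI[of _ 1], rule exI[of _ 1]) simp

lemma poly_bounded_add:
  assumes "poly_bounded f" "poly_bounded g" shows "poly_bounded (\<lambda>L. f L + g L)"
proof -
  obtain c d c' d' where *: "\<And>L. f L \<le> c * (L + 1) ^ d" "\<And>L. g L \<le> c' * (L + 1) ^ d'"
    using assms unfolding poly_bounded_def by blast
  have "f L + g L \<le> (c + c') * (L + 1) ^ (d + d')" for L
  proof -
    have "f L \<le> c * (L + 1) ^ (d + d')"
      by (rule order_trans[OF *(1)], intro mult_left_mono power_increasing) auto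
    moreover have "g L \<le> c' * (L + 1) ^ (d + d')"
      by (rule order_trans[OF *(2)], intro mult_left_mono power_increasing) auto
    ultimately show ?thesis by (simp add: distrib_right)
  qed
  then show ?thesis unfolding poly_bounded_def by blast
qed

lemma poly_bounded_mult:
  assumes "poly_bounded f" "poly_bounded g" shows "poly_bounded (\<lambda>L. f L * g L)"
proof -
  obtain c d c' d' where *: "\<And>L. f L \<le> c * (L + 1) ^ d" "\<And>L. g L \<le> c' * (L + 1) ^ d'"
    using assms unfolding poly_bounded_def by blast
  have "f L * g L \<le> (c * c') * (L + 1) ^ (d + d')" for L
    using mult_le_mono[OF *[of L]] by (simp add: power_add ac_simps)
  then show ?thesis unfolding poly_bounded_def by blast
qed

lemmas poly_bounded_intros =
  poly_bounded_const poly_bounded_id poly_bounded_add poly_bounded_mult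

lemma poly_bounded_bits: "poly_bounded (bits e)"
  by (induction e; unfold bits.simps[abs_def]; intro poly_bounded_intros)

lemma poly_bounded_cost: "poly_bounded (cost e)"
  by (induction e; unfold cost.simps[abs_def]; intro poly_bounded_intros poly_bounded_bits)

text \<open>The program has to compute its own loop bound, at a time when the bound register still
  holds 0; hence an expression without loops.\<close>

primrec loop_bound :: "nat \<Rightarrow> expr" where
  "loop_bound 0 = Lit 1"
| "loop_bound (Suc p) = Op Times (loop_bound p) (Op Plus (Vr 0) (Lit 1))"

lemma eval_loop_bound: "eval N (loop_bound p) \<rho> = (\<rho> 0 + 1) ^ p"
  by (induction p) (auto simp: ac_simps)

lemma vars_loop_bound: "vars (loop_bound p) \<subseteq> {0}"
  by (induction p) auto

text \<open>The program depends only on the two expressions, \<open>p\<close> and \<open>m\<close>.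
  Its time is polynomial in the input size because \<open>N\<close> is, and because
  \<open>cost\<close> is polynomial in any common bound on \<open>N\<close> and the input
  lengths.\<close>

lemma computes_expr_quotient:
  fixes num den :: expr and m p :: nat
  assumes "m > 0"
  shows "\<exists>P c d. \<forall>xs n. length xs = m \<longrightarrow> xs ! 0 = int n \<longrightarrow>
    (let \<rho> = (\<lambda>i. if i < length xs then xs ! i else 0); N = (n + 1) ^ p in
     eval N den \<rho> \<noteq> 0 \<longrightarrow>
     computes_within P xs (c * (n + sum_list (map bitlen (tl xs)) + 1) ^ d)
       (of_int (eval N num \<rho>) / of_int (eval N den \<rho>)))"
proof -
  \<comment> \<open>Register \<open>V\<close> must lie beyond the input, so that it starts at 0, and
    above the output registers 0 and 1, so that writing the numerator to 0 cannot destroy the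
    denominator in \<open>V + 2\<close>.\<close>
  obtain V where V: "vars num \<union> vars den \<subseteq> {..<V}" "m + 2 \<le> V"
  proof -
    have "finite (vars num \<union> vars den)" by simp
    then obtain k where "vars num \<union> vars den \<subseteq> {..<k}"
      by (auto simp: finite_nat_set_iff_bounded)
    then have "vars num \<union> vars den \<subseteq> {..<max k (m + 2)}" by auto
    then show ?thesis using that by (metis max.cobounded2)
  qed
  define C1 where "C1 = compile V (loop_bound p) (V + 1) 0"
  define C2 where "C2 = [Const V 0, Add V V (V + 1)]"
  define q1 where "q1 = length C1 + 2"
  define C3 where "C3 = compile V num (V + 1) q1"
  define q2 where "q2 = q1 + length C3"
  \<comment> \<open>The target \<open>V + 2\<close> keeps the numerator in \<open>V + 1\<close>
    alive.\<close>
  define C4 where "C4 = compile V den (V + 2) q2"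
  define C5 where "C5 = [Const 0 0, Add 0 0 (V + 1), Const 1 0, Add 1 1 (V + 2)]"
  define P where "P = C1 @ C2 @ C3 @ C4 @ C5"
  define f where "f L = cost (loop_bound p) L + cost num L + cost den L +
    bits (loop_bound p) L + bits num L + bits den L + 20" for L
  have "poly_bounded f"
    unfolding f_def by (intro poly_bounded_intros poly_bounded_cost poly_bounded_bits)
  then obtain c d where f: "\<And>L. f L \<le> c * (L + 1) ^ d"
    unfolding poly_bounded_def by blast
  have pl: "placed P 0 C1" "placed P (length C1) C2" "placed P q1 C3" "placed P q2 C4"
    "placed P (q2 + length C4) C5"
  proof -
    have "placed P 0 (C1 @ C2 @ C3 @ C4 @ C5)"
      unfolding placed_def P_def by (intro exI[of _ "[]"]) simp
    note a1 = placed_append[OF this]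
    note a2 = placed_append[OF a1[THEN conjunct2]]
    note a3 = placed_append[OF a2[THEN conjunct2]]
    note a4 = placed_append[OF a3[THEN conjunct2]]
    show "placed P 0 C1" "placed P (length C1) C2" "placed P q1 C3" "placed P q2 C4"
      "placed P (q2 + length C4) C5"
      using a1 a2 a3 a4 by (simp_all add: q1_def q2_def C2_def)
  qed
  have main: "computes_within P xs (c * 2 ^ d * (S + 1) ^ (Suc p * d))
      (of_int (eval N num \<rho>) / of_int (eval N den \<rho>))"
    if xs: "length xs = m" "xs ! 0 = int n" and S: "S = n + sum_list (map bitlen (tl xs))"
      and \<rho>: "\<rho> = (\<lambda>i. if i < length xs then xs ! i else 0)" and N: "N = (n + 1) ^ p"
      and nz: "eval N den \<rho> \<noteq> 0"
    for xs n S \<rho> N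
  proof -
    \<comment> \<open>The extra factor over \<open>(S + 1) ^ p\<close> makes \<open>L\<close>
      dominate the input lengths, at most \<open>S + 1\<close>, as well as the loop bound.\<close>
    define L where "L = (S + 1) ^ Suc p"
    have SL: "S + 1 \<le> L" unfolding L_def
      using self_le_power[of "S + 1" "Suc p"] by simp
    have "(n + 1) ^ p \<le> (S + 1) ^ p" using S by (intro power_mono) auto
    also have "\<dots> \<le> L" unfolding L_def by (intro power_increasing) auto
    finally have NL: "N \<le> L" using N by simp
    have bL: "\<forall>x<V. bitlen (\<rho> x) \<le> L"
    proof (intro allI impI)
      fix x
      consider "x = 0" | "0 < x" "x < length xs" | "x \<ge> length xs" by linarith
      then have "bitlen (\<rho> x) \<le> S + 1"
      proof cases
        case 1
        then show ?thesis using xs S \<rho> bitlen_int[of n] assms by auto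
      next
        case 2
        then have "xs ! x \<in> set (tl xs)" by (cases xs) (auto simp: nth_Cons')
        then have "bitlen (xs ! x) \<le> sum_list (map bitlen (tl xs))"
          by (intro member_le_sum_list) auto
        then show ?thesis using 2 \<rho> S by simp
      qed (use \<rho> in auto)
      then show "bitlen (\<rho> x) \<le> L" using SL by simp
    qed
    have init: "init_config xs = (0, \<rho>)" by (simp add: init_config_def \<rho>)
    \<comment> \<open>The computation of the bound is thus an instance of
      \<open>exec_compile\<close> with \<open>N = 0\<close>.\<close>
    have rV: "\<rho> V = int 0" using V xs \<rho> by auto
    have v1: "vars (loop_bound p) \<subseteq> {..<V}" "vars num \<subseteq> {..<V}" "vars den \<subseteq> {..<V}"
      using vars_loop_bound[of p] V by auto
    have bv: "bitlen (eval 0 (loop_bound p) \<rho>) \<le> bits (loop_bound p) L"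
      "bitlen (eval N num \<rho>) \<le> bits num L" "bitlen (eval N den \<rho>) \<le> bits den L"
      using v1 NL bL by (auto intro!: bitlen_eval)
    have lb: "eval 0 (loop_bound p) \<rho> = int N"
      using xs N \<rho> assms by (simp add: eval_loop_bound add.commute)
    obtain k1 r1 where 1: "exec P (0, \<rho>) k1 (length C1, r1)" "k1 \<le> cost (loop_bound p) L"
      "r1 (V + 1) = int N" "\<forall>u<V + 1. r1 u = \<rho> u"
      using exec_compile[OF pl(1)[unfolded C1_def] v1(1), where r = \<rho> and \<rho> = \<rho> and N = 0 and L = L]
        rV bL unfolding C1_def lb by auto
    have 2: "exec P (length C1, r1) (4 + bitlen (int N)) (q1, r1(V := int N))"
      using exec_straight[OF pl(2), of r1] 1(3) by (simp add: C2_def q1_def eval_nat_numeral)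
    obtain k3 r3 where 3: "exec P (q1, r1(V := int N)) k3 (q2, r3)" "k3 \<le> cost num L"
      "r3 (V + 1) = eval N num \<rho>" "\<forall>u<V + 1. r3 u = (r1(V := int N)) u"
      using exec_compile[OF pl(3)[unfolded C3_def] v1(2),
          where r = "r1(V := int N)" and \<rho> = \<rho> and N = N and L = L] NL bL 1(4)
      unfolding C3_def q2_def by auto
    have "\<forall>x<V. r3 x = \<rho> x" "r3 V = int N" using 1(4) 3(4) by auto
    then obtain k4 r4 where 4: "exec P (q2, r3) k4 (q2 + length C4, r4)" "k4 \<le> cost den L"
      "r4 (V + 2) = eval N den \<rho>" "\<forall>u<V + 2. r4 u = r3 u"
      using exec_compile[OF pl(4)[unfolded C4_def] v1(3),
          where r = r3 and \<rho> = \<rho> and N = N and L = L] NL bL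
      unfolding C4_def by auto
    define r5 where "r5 = r4(0 := r4 (V + 1), 1 := r4 (V + 2))"
    have 5: "exec P (q2 + length C4, r4) (8 + bitlen (r4 (V + 1)) + bitlen (r4 (V + 2)))
      (length P, r5)"
      using exec_straight[OF pl(5), of r4] V
      by (simp add: C5_def P_def q1_def q2_def C2_def r5_def eval_nat_numeral ac_simps)
    define k where "k = k1 + ((4 + bitlen (int N)) + (k3 + (k4 +
      (8 + bitlen (r4 (V + 1)) + bitlen (r4 (V + 2))))))"
    have "exec P (0, \<rho>) k (length P, r5)"
      unfolding k_def
      by (rule exec_trans[OF 1(1) exec_trans[OF 2 exec_trans[OF 3(1) exec_trans[OF 4(1) 5]]]])
    moreover have hl: "halted P (length P, r5)" by (simp add: halted_def)
    ultimately obtain j where j: "run P j (0, \<rho>) = ((length P, r5), k)"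
      using exec_run by blast
    have r5: "r5 0 = eval N num \<rho>" "r5 1 = eval N den \<rho>"
      using 3(3) 4(3,4) by (auto simp: r5_def)
    have "r4 (V + 1) = eval N num \<rho>" "r4 (V + 2) = eval N den \<rho>" using 3(3) 4(3,4) by auto
    then have "k \<le> f L"
      using 1(2) 3(2) 4(2) bv lb unfolding k_def f_def by simp
    also have "\<dots> \<le> c * (L + 1) ^ d" by (rule f)
    also have "\<dots> \<le> c * (2 * L) ^ d"
      using SL by (intro mult_left_mono power_mono) auto
    also have "\<dots> = c * 2 ^ d * (S + 1) ^ (Suc p * d)"
      by (simp only: L_def power_mult_distrib power_mult mult.assoc)
    finally have "k \<le> c * 2 ^ d * (S + 1) ^ (Suc p * d)" .
    then show ?thesis
      unfolding computes_within_def init using j hl nz r5 by (intro exI[of _ j]) simp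
  qed
  show ?thesis
    by (rule exI[of _ P], rule exI[of _ "c * 2 ^ d"], rule exI[of _ "Suc p * d"])
      (unfold Let_def, intro allI impI, rule main[OF _ _ refl refl refl])
qed

section \<open>Functions definable by expressions\<close>

text \<open>The locality clause speaks of the function, not of the variables in the expression, and
  makes variable \<open>v\<close> available as a fresh loop index.\<close>

definition definable :: "nat \<Rightarrow> (nat \<Rightarrow> (nat \<Rightarrow> int) \<Rightarrow> int) \<Rightarrow> bool" where
  "definable v F \<longleftrightarrow> (\<exists>e. \<forall>N \<rho>. eval N e \<rho> = F N \<rho>) \<and>
    (\<forall>N \<rho> \<rho>'. (\<forall>x<v. \<rho> x = \<rho>' x) \<longrightarrow> F N \<rho> = F N \<rho>')"

lemma definable_mono: "definable v F \<Longrightarrow> v \<le> v' \<Longrightarrow> definable v' F"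
  unfolding definable_def by (meson order_less_le_trans)

lemma definable_Suc: "definable v F \<Longrightarrow> definable (Suc v) F"
  by (erule definable_mono) simp

lemma definable_fresh: "definable v F \<Longrightarrow> F N (\<rho>(v := i)) = F N \<rho>"
  unfolding definable_def by (metis fun_upd_apply less_irrefl)

lemma definable_const: "definable v (\<lambda>N \<rho>. k)"
  unfolding definable_def by (auto intro: exI[of _ "Lit k"])

lemma definable_var: "x < v \<Longrightarrow> definable v (\<lambda>N \<rho>. \<rho> x)"
  unfolding definable_def by (auto intro: exI[of _ "Vr x"])

lemma definable_bop:
  assumes "definable v F" "definable v G"
  shows "definable v (\<lambda>N \<rho>. bop_fun op (F N \<rho>) (G N \<rho>))"
proof -
  obtain a b where "\<And>N \<rho>. eval N a \<rho> = F N \<rho>" "\<And>N \<rho>. eval N b \<rho> = G N \<rho>"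
    using assms unfolding definable_def by blast
  then have "\<forall>N \<rho>. eval N (Op op a b) \<rho> = bop_fun op (F N \<rho>) (G N \<rho>)" by simp
  then show ?thesis using assms unfolding definable_def by metis
qed

lemmas definable_add = definable_bop[where op = Plus, unfolded bop_fun.simps]
lemmas definable_diff = definable_bop[where op = Minus, unfolded bop_fun.simps]
lemmas definable_mult = definable_bop[where op = Times, unfolded bop_fun.simps]
lemmas definable_div = definable_bop[where op = Quot, unfolded bop_fun.simps]

text \<open>The index reaches \<open>G\<close> both as an argument and through variable
  \<open>v\<close>; \<open>fresh\<close> says that only the argument matters, so the conclusion need
  not mention an updated environment.\<close>

lemma definable_accum:
  assumes "definable (Suc v) (\<lambda>N \<rho>. G N \<rho> (\<rho> v))"
    and fresh: "\<And>N \<rho> i. G N (\<rho>(v := i)) i = G N \<rho> i"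
  shows "definable v (\<lambda>N \<rho>. accum op (\<lambda>i. G N \<rho> (int i)) N)"
proof -
  obtain e where e: "\<And>N \<rho>. eval N e \<rho> = G N \<rho> (\<rho> v)"
    and loc: "\<And>N \<rho> \<rho>'. (\<forall>x<Suc v. \<rho> x = \<rho>' x) \<Longrightarrow> G N \<rho> (\<rho> v) = G N \<rho>' (\<rho>' v)"
    using assms(1) unfolding definable_def by blast
  have A: "eval N (Big op v e) \<rho> = accum op (\<lambda>i. G N \<rho> (int i)) N" for N \<rho>
    using fresh by (simp add: e)
  have B: "(\<lambda>i. G N \<rho> (int i)) = (\<lambda>i. G N \<rho>' (int i))" if "\<forall>x<v. \<rho> x = \<rho>' x" for N \<rho> \<rho>'
  proof
    fix i
    show "G N \<rho> (int i) = G N \<rho>' (int i)"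
      using loc[of "\<rho>(v := int i)" "\<rho>'(v := int i)" N] that fresh by (simp add: less_Suc_eq)
  qed
  show ?thesis unfolding definable_def
    by (intro conjI exI[of _ "Big op v e"] allI impI A arg_cong[where f = "\<lambda>g. accum op g _"] B) simp
qed

lemmas definable_bounded_sum = definable_accum[where op = Plus, unfolded accum_Plus]
lemmas definable_bounded_prod = definable_accum[where op = Times, unfolded accum_Times]

lemma definable_sum:
  "finite I \<Longrightarrow> (\<And>i. i \<in> I \<Longrightarrow> definable v (F i)) \<Longrightarrow> definable v (\<lambda>N \<rho>. \<Sum>i\<in>I. F i N \<rho>)"
  by (induction I rule: finite_induct) (auto intro: definable_const definable_add)

lemma definable_prod:
  "finite I \<Longrightarrow> (\<And>i. i \<in> I \<Longrightarrow> definable v (F i)) \<Longrightarrow> definable v (\<lambda>N \<rho>. \<Prod>i\<in>I. F i N \<rho>)"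
  by (induction I rule: finite_induct) (auto intro: definable_const definable_mult)

lemma definable_power: "definable v F \<Longrightarrow> definable v (\<lambda>N \<rho>. F N \<rho> ^ k)"
  by (induction k) (auto intro: definable_const definable_mult)

lemma definable_less:
  assumes "definable v F" "definable v G"
  shows "definable v (\<lambda>N \<rho>. of_bool (F N \<rho> < G N \<rho>))"
proof -
  \<comment> \<open>Floor division by a larger positive number yields the sign.\<close>
  have eq: "of_bool (a < b) = 0 - (a - b) div ((a - b) * (a - b) + 1)" for a b :: int
  proof (cases "a < b")
    case True
    define z where "z = b - a"
    have "z > 0" using True by (simp add: z_def)
    then have "z * 1 \<le> z * z" by (intro mult_left_mono) auto
    then have "z \<le> z * z + 1" by linarith
    then have "(- z) div (z * z + 1) = -1"
      using \<open>z > 0\<close> by (intro int_div_pos_eq[of _ _ _ "z * z + 1 - z"]) auto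
    then show ?thesis using True by (simp add: z_def algebra_simps)
  next
    case False
    define z where "z = a - b"
    have "z \<ge> 0" using False by (simp add: z_def)
    then have "z < z * z + 1"
    proof (cases "z = 0")
      case False
      then have "z * 1 \<le> z * z" using \<open>z \<ge> 0\<close> by (intro mult_left_mono) auto
      then show ?thesis by linarith
    qed simp
    then have "z div (z * z + 1) = 0" using \<open>z \<ge> 0\<close> by (simp add: div_pos_pos_trivial)
    then show ?thesis using False by (simp add: z_def)
  qed
  show ?thesis
    unfolding eq by (intro definable_diff definable_div definable_add definable_mult definable_const assms)
qed

lemma definable_if_less:
  assumes "definable v F" "definable v G" "definable v A" "definable v B"
  shows "definable v (\<lambda>N \<rho>. if F N \<rho> < G N \<rho> then A N \<rho> else B N \<rho>)"
proof -
  have eq: "(if c then a else b) = b + of_bool c * (a - b)" for c and a b :: int by simp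
  show ?thesis
    unfolding eq by (intro definable_diff definable_add definable_mult definable_less assms)
qed

lemmas definable_intros = definable_const definable_add definable_diff definable_mult definable_div
  definable_less definable_if_less definable_power

text \<open>Powers and binomial coefficients by loops of length \<open>N\<close>; they are the true ones only as long
  as the exponent (lower index) does not exceed \<open>N\<close>.\<close>

definition loop_power :: "nat \<Rightarrow> int \<Rightarrow> int \<Rightarrow> int" where
  "loop_power N x k = (\<Prod>i<N. if int i < k then x else 1)"

definition loop_binomial :: "nat \<Rightarrow> int \<Rightarrow> int \<Rightarrow> int" where
  "loop_binomial N n k =
    (\<Prod>i<N. if int i < k then n - int i else 1) div (\<Prod>i<N. if int i < k then int i + 1 else 1)"

lemma definable_loop_power:
  assumes "definable v F" "definable v G"
  shows "definable v (\<lambda>N \<rho>. loop_power N (F N \<rho>) (G N \<rho>))"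
  unfolding loop_power_def
  by (rule definable_bounded_prod, intro definable_intros definable_var definable_Suc assms lessI,
      simp only: assms[THEN definable_fresh])

lemma definable_loop_binomial:
  assumes "definable v F" "definable v G"
  shows "definable v (\<lambda>N \<rho>. loop_binomial N (F N \<rho>) (G N \<rho>))"
  unfolding loop_binomial_def
  by (rule definable_div; rule definable_bounded_prod;
      (intro definable_intros definable_var definable_Suc assms lessI)?;
      (simp only: assms[THEN definable_fresh])?)

lemma prod_if_less:
  "k \<le> N \<Longrightarrow> (\<Prod>i<N. if int i < int k then f i else 1) = (\<Prod>i<k. f i :: int)"
proof -
  assume "k \<le> N"
  then have "{..<N} \<inter> {i. i < k} = {..<k}" by auto
  then show ?thesis by (simp add: prod.If_cases)
qed

lemma loop_power: "k \<le> N \<Longrightarrow> loop_power N x (int k) = x ^ k"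
  by (simp add: loop_power_def prod_if_less del: of_nat_less_iff)

text \<open>The numerator is the falling factorial, which is \<open>(n choose k) * fact k\<close>,
  so the division is exact.\<close>

lemma loop_binomial:
  assumes "k \<le> n" "k \<le> N"
  shows "loop_binomial N (int n) (int k) = int (n choose k)"
proof -
  have "(\<Prod>i<k. int n - int i) = int (\<Prod>i<k. n - i)"
    using assms by (simp add: of_nat_diff)
  moreover have "(\<Prod>i<k. int i + 1) = int (fact k)"
    by (simp add: fact_prod_Suc lessThan_atLeast0 add.commute)
  moreover have "(\<Prod>i<k. n - i) = (n choose k) * fact k"
  proof (induction k)
    case (Suc k)
    have "Suc k * (n choose Suc k) = (n - k) * (n choose k)"
      by (simp only: binomial_absorption binomial_absorb_comp)
    then have "(n choose Suc k) * fact (Suc k) = (n choose k) * fact k * (n - k)"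
      by (metis (no_types, opaque_lifting) fact_Suc mult.assoc mult.commute of_nat_id)
    then show ?case using Suc by simp
  qed simp
  ultimately show ?thesis
    by (simp add: loop_binomial_def prod_if_less[OF assms(2)] del: of_nat_less_iff)
qed

text \<open>Here \<open>s\<close> elements carry label \<open>u\<close>: they have
  \<open>s * (s - 1) div 2\<close> pairs among themselves, and each remaining element absorbs its
  pairs with them into its vertex weight. Without labels only the empty set has a labelling. Counts
  are integers because they are values of expressions.\<close>

fun fo2 :: "nat \<Rightarrow> ('u \<Rightarrow> 'u \<Rightarrow> int) \<Rightarrow> 'u list \<Rightarrow> int \<Rightarrow> ('u \<Rightarrow> int) \<Rightarrow> int" where
  "fo2 N Q [] n x = of_bool (n < 1)"
| "fo2 N Q (u # us) n x =
    (\<Sum>s<N. if int s < n + 1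
      then loop_binomial N n (int s) * loop_power N (x u) (int s) *
           loop_power N (Q u u) (int s * (int s - 1) div 2) *
           fo2 N Q us (n - int s) (\<lambda>u'. x u' * loop_power N (Q u' u) (int s))
      else 0)"

text \<open>The label list is fixed, so the recursion unrolls into nested loops; each level takes
  the next fresh variable as its index, which is why \<open>v\<close> is generalised.\<close>

lemma definable_fo2:
  assumes "definable v n" "\<And>u. u \<in> set us \<Longrightarrow> definable v (x u)"
    "\<And>u u'. u \<in> set us \<Longrightarrow> u' \<in> set us \<Longrightarrow> definable v (Q u u')"
  shows "definable v (\<lambda>N \<rho>. fo2 N (\<lambda>u u'. Q u u' N \<rho>) us (n N \<rho>) (\<lambda>u. x u N \<rho>))"
  using assms
proof (induction us arbitrary: v n x)
  case Nil
  then show ?case by (auto intro!: definable_less definable_const)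
next
  case (Cons u us)
  note Q = Cons.prems(3)
  define R where "R N \<rho> i = fo2 N (\<lambda>u u'. Q u u' N \<rho>) us (n N \<rho> - i)
    (\<lambda>u'. x u' N \<rho> * loop_power N (Q u' u N \<rho>) i)" for N \<rho> i
  have R: "definable (Suc v) (\<lambda>N \<rho>. R N \<rho> (\<rho> v))"
    unfolding R_def
    by (rule Cons.IH)
      (auto intro!: definable_diff definable_mult definable_loop_power definable_var Cons.prems
        intro: definable_Suc)
  \<comment> \<open>Definability, hence independence of variable \<open>v\<close>, is known only for
    labels in the list; this shows that \<open>fo2\<close> looks at no others.\<close>
  have fresh_cong: "fo2 N Q' us m y = fo2 N Q'' us m y'"
    if "\<And>u u'. u \<in> set us \<Longrightarrow> u' \<in> set us \<Longrightarrow> Q' u u' = Q'' u u'"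
      "\<And>u. u \<in> set us \<Longrightarrow> y u = y' u" for N Q' Q'' m y y'
    using that
  proof (induction us arbitrary: m y y')
    case (Cons w ws)
    have "fo2 N Q' ws m' (\<lambda>u'. y u' * loop_power N (Q' u' w) i) =
      fo2 N Q'' ws m' (\<lambda>u'. y' u' * loop_power N (Q'' u' w) i)" for m' i
      by (rule Cons.IH) (use Cons.prems in auto)
    moreover have "y w = y' w" "Q' w w = Q'' w w" using Cons.prems by auto
    ultimately show ?case by (simp only: fo2.simps)
  qed simp
  have Rf: "R N (\<rho>(v := i)) i = R N \<rho> i" for N \<rho> i
    unfolding R_def definable_fresh[OF Cons.prems(1)]
    by (rule fresh_cong) (use Cons.prems in \<open>auto simp: definable_fresh\<close>)
  have "definable v (\<lambda>N \<rho>. \<Sum>s<N. if int s < n N \<rho> + 1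
      then loop_binomial N (n N \<rho>) (int s) * loop_power N (x u N \<rho>) (int s) *
        loop_power N (Q u u N \<rho>) (int s * (int s - 1) div 2) * R N \<rho> (int s)
      else 0)"
  proof (rule definable_bounded_sum)
    show "definable (Suc v) (\<lambda>N \<rho>. if \<rho> v < n N \<rho> + 1
      then loop_binomial N (n N \<rho>) (\<rho> v) * loop_power N (x u N \<rho>) (\<rho> v) *
        loop_power N (Q u u N \<rho>) (\<rho> v * (\<rho> v - 1) div 2) * R N \<rho> (\<rho> v)
      else 0)"
      by (intro definable_intros definable_loop_power definable_loop_binomial definable_var R lessI
          definable_Suc Cons.prems) auto
  qed (use Cons.prems in \<open>simp only: Rf definable_fresh[OF Cons.prems(1)]
      definable_fresh[OF Cons.prems(2)[of u]] definable_fresh[OF Cons.prems(3)[of u u]] list.set_intros\<close>)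
  then show ?case unfolding R_def fo2.simps .
qed

section \<open>Sums over worlds and labellings\<close>

lemma sum_Pow_Un:
  assumes "finite A" "finite B" "A \<inter> B = {}"
  shows "(\<Sum>X\<in>Pow (A \<union> B). F X) = (\<Sum>Y\<in>Pow A. \<Sum>Z\<in>Pow B. F (Y \<union> Z))"
proof -
  have "(\<Sum>X\<in>Pow (A \<union> B). F X) = (\<Sum>p\<in>Pow A \<times> Pow B. F (fst p \<union> snd p))"
    using assms(3)
    by (intro sum.reindex_bij_witness[of _ "\<lambda>p. fst p \<union> snd p" "\<lambda>X. (X \<inter> A, X \<inter> B)"])
      (auto simp: Int_Un_distrib2 Int_absorb2 Int_absorb1 intro!: arg_cong[where f = F])
  then show ?thesis by (simp add: sum.cartesian_product case_prod_beta)
qed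

text \<open>A subset of a disjoint union is an independent choice of a subset of each block, so the
  distributive law applies blockwise.\<close>

lemma sum_Pow_UN:
  fixes f :: "'i \<Rightarrow> 'a set \<Rightarrow> 'b :: comm_semiring_1"
  assumes "finite I" "\<And>i. i \<in> I \<Longrightarrow> finite (X i)"
    and "\<And>i j. i \<in> I \<Longrightarrow> j \<in> I \<Longrightarrow> i \<noteq> j \<Longrightarrow> X i \<inter> X j = {}"
  shows "(\<Sum>Y\<in>Pow (\<Union>i\<in>I. X i). \<Prod>i\<in>I. f i (Y \<inter> X i)) = (\<Prod>i\<in>I. \<Sum>Y\<in>Pow (X i). f i Y)"
  using assms
proof (induction I rule: finite_induct)
  case (insert i I)
  have fin: "finite (X i)" "finite (\<Union>j\<in>I. X j)" using insert by auto
  have disj: "X i \<inter> (\<Union>j\<in>I. X j) = {}" using insert.prems(2) insert.hyps(2) by fastforce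
  have 1: "(Y \<union> Z) \<inter> X i = Y" if "Y \<in> Pow (X i)" "Z \<in> Pow (\<Union>j\<in>I. X j)" for Y Z
    using that disj by blast
  have 2: "(Y \<union> Z) \<inter> X j = Z \<inter> X j" if "Y \<in> Pow (X i)" "j \<in> I" for Y Z j
    using that disj by blast
  have "(\<Sum>Y\<in>Pow (\<Union>j\<in>insert i I. X j). \<Prod>j\<in>insert i I. f j (Y \<inter> X j)) =
    (\<Sum>Y\<in>Pow (X i). \<Sum>Z\<in>Pow (\<Union>j\<in>I. X j). \<Prod>j\<in>insert i I. f j ((Y \<union> Z) \<inter> X j))"
    using sum_Pow_Un[OF fin disj] by simp
  also have "\<dots> = (\<Sum>Y\<in>Pow (X i). \<Sum>Z\<in>Pow (\<Union>j\<in>I. X j). f i Y * (\<Prod>j\<in>I. f j (Z \<inter> X j)))"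
    using insert.hyps by (intro sum.cong refl) (simp add: 1 2)
  also have "\<dots> = (\<Sum>Y\<in>Pow (X i). f i Y) * (\<Sum>Z\<in>Pow (\<Union>j\<in>I. X j). \<Prod>j\<in>I. f j (Z \<inter> X j))"
    by (simp add: sum_product)
  also have "\<dots> = (\<Sum>Y\<in>Pow (X i). f i Y) * (\<Prod>j\<in>I. \<Sum>Y\<in>Pow (X j). f j Y)"
    using insert by simp
  finally show ?case using insert.hyps by simp
qed simp

lemma sum_PiE_Times:
  "(\<Sum>g\<in>D \<rightarrow>\<^sub>E A \<times> B. F g) = (\<Sum>c\<in>D \<rightarrow>\<^sub>E A. \<Sum>s\<in>D \<rightarrow>\<^sub>E B. F (\<lambda>a\<in>D. (c a, s a)))"
proof -
  have "(\<Sum>g\<in>D \<rightarrow>\<^sub>E A \<times> B. F g) =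
    (\<Sum>p\<in>(D \<rightarrow>\<^sub>E A) \<times> (D \<rightarrow>\<^sub>E B). F (\<lambda>a\<in>D. (fst p a, snd p a)))"
    by (intro sum.reindex_bij_witness[of _ "\<lambda>p. \<lambda>a\<in>D. (fst p a, snd p a)"
          "\<lambda>g. (\<lambda>a\<in>D. fst (g a), \<lambda>a\<in>D. snd (g a))"])
      (auto simp: fun_eq_iff PiE_iff extensional_def restrict_def mem_Times_iff intro!: arg_cong[where f = F])
  then show ?thesis by (simp add: sum.cartesian_product case_prod_beta)
qed

lemma sum_Pow_card:
  fixes f :: "nat \<Rightarrow> int"
  assumes "finite D"
  shows "(\<Sum>S\<in>Pow D. f (card S)) = (\<Sum>s\<le>card D. int (card D choose s) * f s)"
proof -
  have "(\<Sum>S\<in>Pow D. f (card S)) = (\<Sum>s\<le>card D. \<Sum>S\<in>{S\<in>Pow D. card S = s}. f (card S))"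
    using assms by (intro sum.group[symmetric]) (auto intro: card_mono)
  also have "\<dots> = (\<Sum>s\<le>card D. int (card D choose s) * f s)"
  proof (intro sum.cong refl)
    fix s
    have "{S\<in>Pow D. card S = s} = {S. S \<subseteq> D \<and> card S = s}" by auto
    then show "(\<Sum>S\<in>{S\<in>Pow D. card S = s}. f (card S)) = int (card D choose s) * f s"
      using n_subsets[OF assms, of s] by simp
  qed
  finally show ?thesis .
qed

section \<open>Unordered pairs of elements and the removal of one label\<close>

definition upairs :: "'a set \<Rightarrow> 'a set set" where
  "upairs D = {e. e \<subseteq> D \<and> card e = 2}"

lemma finite_upairs: "finite D \<Longrightarrow> finite (upairs D)"
  by (simp add: upairs_def)

lemma card_upairs: "finite D \<Longrightarrow> card (upairs D) = card D choose 2"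
  by (simp add: upairs_def n_subsets)

lemma upairs_mem: "e \<in> upairs D \<longleftrightarrow> (\<exists>a\<in>D. \<exists>b\<in>D. a \<noteq> b \<and> e = {a, b})"
  unfolding upairs_def by (auto simp: card_2_iff)

lemma upairsI: "a \<in> D \<Longrightarrow> b \<in> D \<Longrightarrow> a \<noteq> b \<Longrightarrow> {a, b} \<in> upairs D"
  by (simp add: upairs_def)

lemma prod_upairs_split:
  fixes f :: "'a set \<Rightarrow> int"
  assumes "finite D" "S \<subseteq> D"
  shows "(\<Prod>e\<in>upairs D. f e) =
    (\<Prod>e\<in>upairs S. f e) * (\<Prod>e\<in>upairs (D - S). f e) * (\<Prod>a\<in>D - S. \<Prod>b\<in>S. f {a, b})"
proof -
  define C where "C = (\<lambda>(a, b). {a, b}) ` ((D - S) \<times> S)"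
  have fin: "finite S" "finite (D - S)" using assms finite_subset by auto
  have inj: "inj_on (\<lambda>(a, b). {a, b}) ((D - S) \<times> S)"
    by (auto simp: inj_on_def doubleton_eq_iff)
  have eq: "upairs D = (upairs S \<union> upairs (D - S)) \<union> C"
  proof (rule Set.set_eqI, rule iffI)
    fix e assume "e \<in> upairs D"
    then obtain a b where "a \<in> D" "b \<in> D" "a \<noteq> b" "e = {a, b}" by (auto simp: upairs_mem)
    then show "e \<in> (upairs S \<union> upairs (D - S)) \<union> C"
      using upairsI[of a S b] upairsI[of a "D - S" b] unfolding C_def
      by (cases "a \<in> S"; cases "b \<in> S") (auto simp: insert_commute intro: rev_image_eqI)
  next
    fix e assume "e \<in> (upairs S \<union> upairs (D - S)) \<union> C"
    then show "e \<in> upairs D"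
      using assms(2) unfolding C_def by (auto simp: upairs_def card_2_iff)
  qed
  have "upairs S \<inter> upairs (D - S) = {}" by (auto simp: upairs_mem doubleton_eq_iff)
  moreover have "(upairs S \<union> upairs (D - S)) \<inter> C = {}"
    unfolding C_def by (auto simp: upairs_mem doubleton_eq_iff)
  ultimately have "(\<Prod>e\<in>upairs D. f e) = (\<Prod>e\<in>upairs S. f e) * (\<Prod>e\<in>upairs (D - S). f e) * (\<Prod>e\<in>C. f e)"
    unfolding eq using fin
    by (simp add: prod.union_disjoint finite_upairs C_def)
  moreover have "(\<Prod>e\<in>C. f e) = (\<Prod>a\<in>D - S. \<Prod>b\<in>S. f {a, b})"
    unfolding C_def prod.reindex[OF inj] by (simp add: prod.cartesian_product case_prod_beta)
  ultimately show ?thesis by simp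
qed

text \<open>Degree factors are directed, whereas atoms belong to unordered pairs; this groups the
  two orientations of each pair.\<close>

lemma prod_offdiag_upairs:
  fixes f :: "'a \<Rightarrow> 'a \<Rightarrow> int"
  assumes "finite D"
  shows "(\<Prod>a\<in>D. \<Prod>b\<in>D - {a}. f a b) =
    (\<Prod>e\<in>upairs D. \<Prod>p\<in>{p \<in> e \<times> e. fst p \<noteq> snd p}. f (fst p) (snd p))"
proof -
  define O' where "O' = Sigma D (\<lambda>a. D - {a})"
  have fin: "finite O'" using assms by (simp add: O'_def)
  have "(\<Prod>a\<in>D. \<Prod>b\<in>D - {a}. f a b) = (\<Prod>p\<in>O'. f (fst p) (snd p))"
    unfolding O'_def using assms by (simp add: prod.Sigma case_prod_beta)
  also have "\<dots> = (\<Prod>e\<in>upairs D. \<Prod>p\<in>{p \<in> O'. {fst p, snd p} = e}. f (fst p) (snd p))"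
    using fin finite_upairs[OF assms]
    by (intro prod.group[symmetric]) (auto simp: O'_def intro!: upairsI)
  also have "\<dots> = (\<Prod>e\<in>upairs D. \<Prod>p\<in>{p \<in> e \<times> e. fst p \<noteq> snd p}. f (fst p) (snd p))"
  proof (rule prod.cong[OF refl])
    fix e assume "e \<in> upairs D"
    then obtain a b where e: "a \<in> D" "b \<in> D" "a \<noteq> b" "e = {a, b}" by (auto simp: upairs_mem)
    have "{p \<in> O'. {fst p, snd p} = e} = {(a, b), (b, a)}"
      using e by (auto simp: O'_def doubleton_eq_iff)
    moreover have "{p \<in> e \<times> e. fst p \<noteq> snd p} = {(a, b), (b, a)}" using e by auto
    ultimately show "(\<Prod>p\<in>{p \<in> O'. {fst p, snd p} = e}. f (fst p) (snd p)) =
      (\<Prod>p\<in>{p \<in> e \<times> e. fst p \<noteq> snd p}. f (fst p) (snd p))" by simp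
  qed
  finally show ?thesis .
qed

lemma sum_PiE_insert_label:
  assumes fin: "finite D" "finite U" and u: "u \<notin> U"
  shows "(\<Sum>g\<in>D \<rightarrow>\<^sub>E insert u U. F g) =
    (\<Sum>S\<in>Pow D. \<Sum>g\<in>(D - S) \<rightarrow>\<^sub>E U. F (\<lambda>a. if a \<in> S then u else g a))"
proof -
  have "(\<Sum>S\<in>Pow D. \<Sum>g\<in>(D - S) \<rightarrow>\<^sub>E U. F (\<lambda>a. if a \<in> S then u else g a)) =
    (\<Sum>p\<in>Sigma (Pow D) (\<lambda>S. (D - S) \<rightarrow>\<^sub>E U). F (\<lambda>a. if a \<in> fst p then u else snd p a))"
    using fin by (subst sum.Sigma) (auto intro!: finite_PiE simp: case_prod_beta)
  also have "\<dots> = (\<Sum>g\<in>D \<rightarrow>\<^sub>E insert u U. F g)"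
  proof (rule sum.reindex_bij_witness[of _ "\<lambda>g. ({a\<in>D. g a = u}, restrict g {a\<in>D. g a \<noteq> u})"
        "\<lambda>p a. if a \<in> fst p then u else snd p a"])
    fix p assume p: "p \<in> Sigma (Pow D) (\<lambda>S. (D - S) \<rightarrow>\<^sub>E U)"
    obtain S g where pS: "p = (S, g)" by (cases p)
    have S: "S \<subseteq> D" and g: "g \<in> (D - S) \<rightarrow>\<^sub>E U" using p pS by auto
    have "g a \<in> U" if "a \<in> D" "a \<notin> S" for a using g that by auto
    then have gu: "g a \<noteq> u" if "a \<in> D" "a \<notin> S" for a using that u by metis
    have 1: "{a\<in>D. (if a \<in> S then u else g a) = u} = S" using S gu by auto
    have 2: "{a\<in>D. (if a \<in> S then u else g a) \<noteq> u} = D - S" using S gu by auto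
    have "restrict (\<lambda>a. if a \<in> S then u else g a) (D - S) = g"
      using g by (auto simp: fun_eq_iff restrict_def PiE_iff extensional_def)
    then show "({a\<in>D. (if a \<in> fst p then u else snd p a) = u},
      restrict (\<lambda>a. if a \<in> fst p then u else snd p a) {a\<in>D. (if a \<in> fst p then u else snd p a) \<noteq> u}) = p"
      unfolding pS fst_conv snd_conv 1 2 by simp
    show "(\<lambda>a. if a \<in> fst p then u else snd p a) \<in> D \<rightarrow>\<^sub>E insert u U"
      using S g by (auto simp: pS PiE_iff extensional_def)
  next
    fix g assume g: "g \<in> D \<rightarrow>\<^sub>E insert u U"
    then show "(\<lambda>a. if a \<in> fst ({a\<in>D. g a = u}, restrict g {a\<in>D. g a \<noteq> u}) then u
        else snd ({a\<in>D. g a = u}, restrict g {a\<in>D. g a \<noteq> u}) a) = g"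
      by (auto simp: fun_eq_iff restrict_def PiE_iff extensional_def)
    show "({a\<in>D. g a = u}, restrict g {a\<in>D. g a \<noteq> u}) \<in> Sigma (Pow D) (\<lambda>S. (D - S) \<rightarrow>\<^sub>E U)"
      using g by (auto simp: PiE_iff extensional_def)
  qed simp
  finally show ?thesis by simp
qed

lemma choose_two_mono: "m \<le> n \<Longrightarrow> m choose 2 \<le> n choose 2"
  unfolding choose_two by (intro div_le_mono mult_le_mono) auto

text \<open>Removing one label at a time: if the label \<open>u\<close> is carried by the set \<open>S\<close>, the pairs meeting
  \<open>S\<close> only change the vertex weights of the remaining labels.\<close>

lemma fo2_eq_sum_labellings:
  fixes Q :: "'u \<Rightarrow> 'u \<Rightarrow> int" and q :: "('a \<Rightarrow> 'u) \<Rightarrow> 'a set \<Rightarrow> int"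
  assumes "finite D" "distinct us" "card D < N" "card D choose 2 \<le> N"
    and q: "\<And>g a b. a \<in> D \<Longrightarrow> b \<in> D \<Longrightarrow> a \<noteq> b \<Longrightarrow> q g {a, b} = Q (g a) (g b)"
  shows "fo2 N Q us (int (card D)) x =
    (\<Sum>g\<in>D \<rightarrow>\<^sub>E set us. (\<Prod>a\<in>D. x (g a)) * (\<Prod>e\<in>upairs D. q g e))"
  using assms
proof (induction us arbitrary: D x)
  case Nil
  show ?case
  proof (cases "D = {}")
    case True
    then have "upairs D = {}" by (auto simp: upairs_mem)
    then show ?thesis using True by simp
  next
    case False
    then have "D \<rightarrow>\<^sub>E ({} :: 'u set) = {}" by (auto simp: PiE_eq_empty_iff)
    then show ?thesis using False Nil(1) by (simp add: card_gt_0_iff Suc_le_eq)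
  qed
next
  case (Cons u us)
  define n where "n = card D"
  define x' where "x' s u' = x u' * Q u' u ^ s" for s u'
  define f where "f s = x u ^ s * Q u u ^ (s choose 2) * fo2 N Q us (int (n - s)) (x' s)" for s
  have u: "u \<notin> set us" "distinct us" using Cons.prems(2) by auto
  have key: "(\<Sum>g\<in>(D - S) \<rightarrow>\<^sub>E set us. (\<Prod>a\<in>D. x (if a \<in> S then u else g a)) *
      (\<Prod>e\<in>upairs D. q (\<lambda>a. if a \<in> S then u else g a) e)) = f (card S)"
    if S: "S \<in> Pow D" for S
  proof -
    have SD: "S \<subseteq> D" "finite S" using S Cons.prems(1) finite_subset by auto
    have cD: "card (D - S) = n - card S" using SD by (simp add: n_def card_Diff_subset)
    have IH: "fo2 N Q us (int (n - card S)) (x' (card S)) =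
      (\<Sum>g\<in>(D - S) \<rightarrow>\<^sub>E set us. (\<Prod>a\<in>D - S. x' (card S) (g a)) * (\<Prod>e\<in>upairs (D - S). q g e))"
      unfolding cD[symmetric]
    proof (rule Cons.IH)
      have "card (D - S) \<le> card D" using Cons.prems(1) by (simp add: card_mono)
      then show "card (D - S) < N" "card (D - S) choose 2 \<le> N"
        using Cons.prems(3,4) choose_two_mono[of "card (D - S)" "card D"] by auto
    qed (use Cons.prems u in auto)
    have "(\<Prod>a\<in>D. x (if a \<in> S then u else g a)) *
      (\<Prod>e\<in>upairs D. q (\<lambda>a. if a \<in> S then u else g a) e) =
      x u ^ card S * Q u u ^ (card S choose 2) *
      ((\<Prod>a\<in>D - S. x' (card S) (g a)) * (\<Prod>e\<in>upairs (D - S). q g e))" for g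
    proof -
      define h where "h a = (if a \<in> S then u else g a)" for a
      have "(\<Prod>a\<in>D. x (h a)) = (\<Prod>a\<in>D - S. x (h a)) * (\<Prod>a\<in>S. x (h a))"
        using SD Cons.prems(1) by (intro prod.subset_diff) auto
      then have 1: "(\<Prod>a\<in>D. x (h a)) = (\<Prod>a\<in>D - S. x (g a)) * x u ^ card S"
        by (simp add: h_def)
      have 2: "(\<Prod>e\<in>upairs S. q h e) = Q u u ^ (card S choose 2)"
      proof -
        have "(\<Prod>e\<in>upairs S. q h e) = (\<Prod>e\<in>upairs S. Q u u)"
          using SD by (intro prod.cong refl) (auto simp: upairs_mem Cons.prems(5) subset_iff h_def)
        then show ?thesis using SD by (simp add: card_upairs)
      qed
      have 3: "(\<Prod>e\<in>upairs (D - S). q h e) = (\<Prod>e\<in>upairs (D - S). q g e)"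
        by (intro prod.cong refl) (auto simp: upairs_mem Cons.prems(5) h_def)
      have 4: "(\<Prod>a\<in>D - S. \<Prod>b\<in>S. q h {a, b}) = (\<Prod>a\<in>D - S. Q (g a) u ^ card S)"
      proof (rule prod.cong[OF refl])
        fix a assume a: "a \<in> D - S"
        have "(\<Prod>b\<in>S. q h {a, b}) = (\<Prod>b\<in>S. Q (g a) u)"
        proof (rule prod.cong[OF refl])
          fix b assume b: "b \<in> S"
          then have "q h {a, b} = Q (h a) (h b)" using a SD by (intro Cons.prems(5)) auto
          then show "q h {a, b} = Q (g a) u" using a b by (simp add: h_def)
        qed
        then show "(\<Prod>b\<in>S. q h {a, b}) = Q (g a) u ^ card S" by simp
      qed
      show ?thesis
        unfolding h_def[symmetric] 1 prod_upairs_split[OF Cons.prems(1) SD(1)] 2 3 4 x'_def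
          prod.distrib by (simp add: ac_simps)
    qed
    then show ?thesis
      unfolding f_def IH by (simp add: sum_distrib_left)
  qed
  have "(\<Sum>g\<in>D \<rightarrow>\<^sub>E set (u # us). (\<Prod>a\<in>D. x (g a)) * (\<Prod>e\<in>upairs D. q g e)) =
    (\<Sum>S\<in>Pow D. f (card S))"
    unfolding list.set sum_PiE_insert_label[OF Cons.prems(1) finite_set u(1)]
    by (intro sum.cong refl key)
  also have "\<dots> = (\<Sum>s\<le>n. int (n choose s) * f s)"
    using sum_Pow_card[OF Cons.prems(1)] by (simp add: n_def)
  \<comment> \<open>Since \<open>s = n\<close> occurs, a loop over \<open>s < N\<close> needs the
    strict inequality \<open>card D < N\<close>.\<close>
  also have "\<dots> = (\<Sum>s\<in>{..<N} \<inter> {s. s \<le> n}. int (n choose s) * f s)"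
    using Cons.prems(3) by (intro sum.cong) (auto simp: n_def)
  also have "\<dots> = (\<Sum>s<N. if s \<le> n then int (n choose s) * f s else 0)"
    by (simp add: sum.inter_restrict)
  also have "\<dots> = fo2 N Q (u # us) (int n) x"
    unfolding fo2.simps
  proof (rule sum.cong[OF refl])
    fix s assume s: "s \<in> {..<N}"
    show "(if s \<le> n then int (n choose s) * f s else 0) =
      (if int s < int n + 1 then loop_binomial N (int n) (int s) * loop_power N (x u) (int s) *
        loop_power N (Q u u) (int s * (int s - 1) div 2) *
        fo2 N Q us (int n - int s) (\<lambda>u'. x u' * loop_power N (Q u' u) (int s)) else 0)"
    proof (cases "s \<le> n")
      case True
      have c2: "int s * (int s - 1) div 2 = int (s choose 2)"
        by (cases s) (auto simp: choose_two zdiv_int algebra_simps)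
      \<comment> \<open>This exponent is why \<open>card D choose 2 \<le> N\<close> is assumed:
        beyond \<open>N\<close> a \<open>loop_power\<close> is no true power.\<close>
      have "s choose 2 \<le> n choose 2" using True by (rule choose_two_mono)
      then have "loop_power N (Q u u) (int s * (int s - 1) div 2) = Q u u ^ (s choose 2)"
        using Cons.prems(4) unfolding c2 n_def by (intro loop_power) simp
      moreover have "loop_power N y (int s) = y ^ s" for y using s by (intro loop_power) simp
      ultimately show ?thesis
        using True s by (simp add: loop_binomial f_def x'_def[abs_def] ac_simps)
    qed simp
  qed
  finally show ?case by (simp add: n_def)
qed

section \<open>Thresholds as power sums modulo a large base\<close>

text \<open>The coefficients of \<open>\<Prod>j<k. (B ^ j - X)\<close> as a polynomial in \<open>X\<close>.\<close>

fun thr_coeff :: "int \<Rightarrow> nat \<Rightarrow> nat \<Rightarrow> int" where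
  "thr_coeff B 0 s = of_bool (s = 0)"
| "thr_coeff B (Suc k) 0 = B ^ k * thr_coeff B k 0"
| "thr_coeff B (Suc k) (Suc s) = B ^ k * thr_coeff B k (Suc s) - thr_coeff B k s"

lemma thr_coeff_eq_0: "k < s \<Longrightarrow> thr_coeff B k s = 0"
  by (induction B k s rule: thr_coeff.induct) auto

lemma sum_thr_coeff: "(\<Sum>s\<le>k. thr_coeff B k s * X ^ s) = (\<Prod>j<k. B ^ j - X)"
proof (induction k)
  case (Suc k)
  have "(\<Sum>s\<le>Suc k. thr_coeff B (Suc k) s * X ^ s) =
    B ^ k * thr_coeff B k 0 + (\<Sum>s\<le>k. (B ^ k * thr_coeff B k (Suc s) - thr_coeff B k s) * X ^ Suc s)"
    by (simp add: sum.atMost_Suc_shift del: sum.atMost_Suc)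
  also have "\<dots> = B ^ k * (thr_coeff B k 0 + (\<Sum>s\<le>k. thr_coeff B k (Suc s) * X ^ Suc s)) -
    X * (\<Sum>s\<le>k. thr_coeff B k s * X ^ s)"
    by (simp add: algebra_simps sum_subtractf sum_distrib_left sum.distrib)
  also have "thr_coeff B k 0 + (\<Sum>s\<le>k. thr_coeff B k (Suc s) * X ^ Suc s) =
    (\<Sum>s\<le>Suc k. thr_coeff B k s * X ^ s)"
    by (simp add: sum.atMost_Suc_shift del: sum.atMost_Suc)
  also have "\<dots> = (\<Sum>s\<le>k. thr_coeff B k s * X ^ s)"
    by (simp add: thr_coeff_eq_0)
  finally show ?case using Suc by (simp add: algebra_simps)
qed simp

text \<open>A congruence modulo \<open>B\<close> after removal of a known power of \<open>B\<close>,
  kept as an equation with explicit cofactor: exponents add, residues multiply.\<close>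

lemma prod_lead_mod:
  fixes B :: int
  assumes "finite I" "\<And>i. i \<in> I \<Longrightarrow> \<exists>z. y i = B ^ m i * (\<chi> i + B * z)"
  shows "\<exists>z. (\<Prod>i\<in>I. y i) = B ^ (\<Sum>i\<in>I. m i) * ((\<Prod>i\<in>I. \<chi> i) + B * z)"
  using assms
proof (induction I rule: finite_induct)
  case empty
  show ?case by (rule exI[of _ 0]) simp
next
  case (insert i I)
  obtain z z' where "(\<Prod>i\<in>I. y i) = B ^ (\<Sum>i\<in>I. m i) * ((\<Prod>i\<in>I. \<chi> i) + B * z)"
    "y i = B ^ m i * (\<chi> i + B * z')"
    using insert by blast
  then have "(\<Prod>j\<in>insert i I. y j) = B ^ (\<Sum>j\<in>insert i I. m j) * ((\<Prod>j\<in>insert i I. \<chi> j) +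
    B * (\<chi> i * z + z' * (\<Prod>j\<in>I. \<chi> j) + B * z' * z))"
    using insert.hyps by (simp add: power_add algebra_simps)
  then show ?case by blast
qed

text \<open>Unlike for products, all terms must share one power of \<open>B\<close>; this forces the
  normalisation in \<open>cnt_coeff\<close>.\<close>

lemma sum_lead_mod:
  fixes B :: int
  assumes "\<And>i. i \<in> I \<Longrightarrow> \<exists>z. y i = B ^ m * (\<chi> i + B * z)"
  shows "\<exists>z. (\<Sum>i\<in>I. c i * y i) = B ^ m * ((\<Sum>i\<in>I. c i * \<chi> i) + B * z)"
proof -
  obtain z where z: "\<And>i. i \<in> I \<Longrightarrow> y i = B ^ m * (\<chi> i + B * z i)" using assms by metis
  have "(\<Sum>i\<in>I. c i * y i) = (\<Sum>i\<in>I. B ^ m * (c i * \<chi> i + B * (c i * z i)))"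
    by (intro sum.cong refl) (simp add: z algebra_simps)
  also have "\<dots> = B ^ m * ((\<Sum>i\<in>I. c i * \<chi> i) + B * (\<Sum>i\<in>I. c i * z i))"
    by (simp add: sum_distrib_left sum.distrib algebra_simps)
  finally show ?thesis by blast
qed

text \<open>If \<open>d < k\<close>, the factor \<open>j = d\<close> is zero. Otherwise factor
  \<open>j\<close> is \<open>B ^ j * (1 - B ^ (d - j))\<close> with \<open>d - j \<ge> 1\<close>,
  and the exponents \<open>j\<close> add up to \<open>k choose 2\<close>.\<close>

lemma prod_thr:
  "\<exists>z. (\<Prod>j<k. B ^ j - B ^ d) = (B :: int) ^ (k choose 2) * (of_bool (k \<le> d) + B * z)"
proof (cases "k \<le> d")
  case True
  have "\<exists>z. B ^ j - B ^ d = B ^ j * (1 + B * z)" if "j \<in> {..<k}" for j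
  proof -
    have "B ^ d = B ^ j * (B * B ^ (d - Suc j))"
      using that True by (simp flip: power_Suc power_add)
    then show ?thesis by (intro exI[of _ "- (B ^ (d - Suc j))"]) (simp add: algebra_simps)
  qed
  then obtain z where "(\<Prod>j<k. B ^ j - B ^ d) = B ^ (\<Sum>j<k. j) * ((\<Prod>j<k. 1) + B * z)"
    using prod_lead_mod[of "{..<k}" "\<lambda>j. B ^ j - B ^ d" B "\<lambda>j. j" "\<lambda>_. 1"] by auto
  moreover have "(\<Sum>j<k. j) = k choose 2"
    by (induction k) (auto simp: numeral_2_eq_2)
  ultimately show ?thesis using True by auto
next
  case False
  then have "(\<Prod>j<k. B ^ j - B ^ d) = 0" by (intro prod_zero) auto
  then show ?thesis using False by (intro exI[of _ 0]) simp
qed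

text \<open>The negated threshold is the constant \<open>B ^ (k choose 2)\<close> minus the
  threshold polynomial, so both polarities carry the same power of \<open>B\<close>.\<close>

definition cnt_coeff :: "int \<Rightarrow> nat \<Rightarrow> bool \<Rightarrow> nat \<Rightarrow> int" where
  "cnt_coeff B k pos s =
    (if pos then thr_coeff B k s else of_bool (s = 0) * B ^ (k choose 2) - thr_coeff B k s)"

lemma sum_cnt_coeff:
  "\<exists>z. (\<Sum>s\<le>k. cnt_coeff B k pos s * (B ^ s) ^ d) =
    B ^ (k choose 2) * (of_bool (pos \<longleftrightarrow> k \<le> d) + B * z)"
proof -
  obtain z where "(\<Prod>j<k. B ^ j - B ^ d) = B ^ (k choose 2) * (of_bool (k \<le> d) + B * z)"
    using prod_thr by blast
  then have z: "(\<Sum>s\<le>k. thr_coeff B k s * (B ^ s) ^ d) = B ^ (k choose 2) * (of_bool (k \<le> d) + B * z)"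
    using sum_thr_coeff[of B k "B ^ d"] by (simp add: power_mult[symmetric] mult.commute)
  show ?thesis
  proof (cases pos)
    case True
    then show ?thesis using z by (auto simp: cnt_coeff_def)
  next
    case False
    have "(\<Sum>s\<le>k. of_bool (s = 0) * B ^ (k choose 2) * (B ^ s) ^ d) = B ^ (k choose 2)"
      by (subst sum.mono_neutral_right[of _ "{0}"]) auto
    then have "(\<Sum>s\<le>k. cnt_coeff B k pos s * (B ^ s) ^ d) =
      B ^ (k choose 2) * (of_bool (pos \<longleftrightarrow> k \<le> d) + B * (- z))"
      using False z by (simp add: cnt_coeff_def left_diff_distrib sum_subtractf algebra_simps)
    then show ?thesis by blast
  qed
qed

lemma definable_thr_coeff: "definable v b \<Longrightarrow> definable v (\<lambda>N \<rho>. thr_coeff (b N \<rho>) k s)"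
proof (induction k arbitrary: s)
  case (Suc k)
  then show ?case by (cases s) (auto intro!: definable_intros)
qed (auto intro: definable_const)

lemma definable_cnt_coeff: "definable v b \<Longrightarrow> definable v (\<lambda>N \<rho>. cnt_coeff (b N \<rho>) k pos s)"
  unfolding cnt_coeff_def by (cases pos; simp only: if_True if_False; intro definable_intros definable_thr_coeff)

section \<open>Local evaluation\<close>

fun other :: "var \<Rightarrow> var" where
  "other VX = VY"
| "other VY = VX"

text \<open>A triple \<open>(k, v, f)\<close> stands for the formula \<open>ExGe k v f\<close>, a property of the value of the
  variable other than \<open>v\<close>; closed subformulas are treated as (constant) properties as well.\<close>

type_synonym cnt = "nat \<times> var \<times> fm"

text \<open>All quantifiers are reduced to lower thresholds, so that a single kind of degree
  condition suffices.\<close>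

fun cnts :: "fm \<Rightarrow> cnt set" where
  "cnts (Not f) = cnts f"
| "cnts (And f g) = cnts f \<union> cnts g"
| "cnts (Or f g) = cnts f \<union> cnts g"
| "cnts (Imp f g) = cnts f \<union> cnts g"
| "cnts (Iff f g) = cnts f \<union> cnts g"
| "cnts (All v f) = insert (1, v, Not f) (cnts f)"
| "cnts (Ex v f) = insert (1, v, f) (cnts f)"
| "cnts (ExGe k v f) = insert (k, v, f) (cnts f)"
| "cnts (ExLe k v f) = insert (Suc k, v, f) (cnts f)"
| "cnts (ExEq k v f) = {(k, v, f), (Suc k, v, f)} \<union> cnts f"
| "cnts _ = {}"

lemma finite_cnts [simp]: "finite (cnts f)"
  by (induction f) auto

lemma cnts_closed: "(k, v, g) \<in> cnts f \<Longrightarrow> cnts g \<subseteq> cnts f"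
  by (induction f) auto

text \<open>Evaluation at one pair of elements, where the truth of quantified subformulas is looked up in
  the colours \<open>c\<close> of the elements.\<close>

fun lev :: "'a world \<Rightarrow> (var \<Rightarrow> 'a) \<Rightarrow> (var \<Rightarrow> cnt set) \<Rightarrow> fm \<Rightarrow> bool" where
  "lev \<omega> \<sigma> c TT = True"
| "lev \<omega> \<sigma> c FF = False"
| "lev \<omega> \<sigma> c (Atom R vs) = ((R, map \<sigma> vs) \<in> \<omega>)"
| "lev \<omega> \<sigma> c (Eq u v) = (\<sigma> u = \<sigma> v)"
| "lev \<omega> \<sigma> c (Not f) = (\<not> lev \<omega> \<sigma> c f)"
| "lev \<omega> \<sigma> c (And f g) = (lev \<omega> \<sigma> c f \<and> lev \<omega> \<sigma> c g)"
| "lev \<omega> \<sigma> c (Or f g) = (lev \<omega> \<sigma> c f \<or> lev \<omega> \<sigma> c g)"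
| "lev \<omega> \<sigma> c (Imp f g) = (lev \<omega> \<sigma> c f \<longrightarrow> lev \<omega> \<sigma> c g)"
| "lev \<omega> \<sigma> c (Iff f g) = (lev \<omega> \<sigma> c f \<longleftrightarrow> lev \<omega> \<sigma> c g)"
| "lev \<omega> \<sigma> c (All v f) = ((1, v, Not f) \<notin> c (other v))"
| "lev \<omega> \<sigma> c (Ex v f) = ((1, v, f) \<in> c (other v))"
| "lev \<omega> \<sigma> c (ExGe k v f) = ((k, v, f) \<in> c (other v))"
| "lev \<omega> \<sigma> c (ExLe k v f) = ((Suc k, v, f) \<notin> c (other v))"
| "lev \<omega> \<sigma> c (ExEq k v f) = ((k, v, f) \<in> c (other v) \<and> (Suc k, v, f) \<notin> c (other v))"

text \<open>Local evaluation reads only equalities and atoms over the assigned elements, never the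
  domain. This allows the transport to \<open>unit\<close> and \<open>bool\<close>.\<close>

lemma lev_relabel:
  assumes "inj \<pi>" "\<And>R vs. (R, map (\<lambda>u. \<pi> (\<beta> u)) vs) \<in> \<omega> \<longleftrightarrow> (R, map \<beta> vs) \<in> \<omega>'"
  shows "lev \<omega> (\<lambda>u. \<pi> (\<beta> u)) c f = lev \<omega>' \<beta> c f"
  using assms by (induction f) (auto simp: inj_eq)

text \<open>\<open>a\<close> is the element under test and \<open>b\<close> a candidate neighbour
  for the quantified variable \<open>v\<close>. It is polymorphic because it also distributes their
  colours.\<close>

definition asg :: "var \<Rightarrow> 'b \<Rightarrow> 'b \<Rightarrow> var \<Rightarrow> 'b" where
  "asg v a b = (\<lambda>u. if u = v then b else a)"

lemma upd_asg: "\<sigma>(v := b) = asg v (\<sigma> (other v)) b"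
proof
  fix u show "(\<sigma>(v := b)) u = asg v (\<sigma> (other v)) b u"
    by (cases u; cases v) (auto simp: asg_def)
qed

lemma asg_comp: "c (asg v a b u) = asg v (c a) (c b) u"
  by (simp add: asg_def)

lemma asg_mem: "a \<in> D \<Longrightarrow> b \<in> D \<Longrightarrow> asg v a b u \<in> D"
  by (simp add: asg_def)

definition sat_cnt :: "'a set \<Rightarrow> 'a world \<Rightarrow> 'a \<Rightarrow> cnt \<Rightarrow> bool" where
  "sat_cnt D \<omega> a = (\<lambda>(k, v, f). k \<le> card {b\<in>D. sat D \<omega> (asg v a b) f})"

text \<open>This is \<delta>, with inner quantifiers looked up in guessed colours, so each candidate
  is judged from one pair of elements. The candidate \<open>b = a\<close> counts too; its share
  later goes into \<open>vfac\<close>.\<close>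

definition degree :: "'a set \<Rightarrow> 'a world \<Rightarrow> ('a \<Rightarrow> cnt set) \<Rightarrow> 'a \<Rightarrow> cnt \<Rightarrow> nat" where
  "degree D \<omega> c a = (\<lambda>(k, v, f). card {b\<in>D. lev \<omega> (asg v a b) (asg v (c a) (c b)) f})"

lemma sat_quantifier:
  assumes "finite D"
  shows "sat D \<omega> \<sigma> (All v f) \<longleftrightarrow> \<not> sat_cnt D \<omega> (\<sigma> (other v)) (1, v, Not f)"
    and "sat D \<omega> \<sigma> (Ex v f) \<longleftrightarrow> sat_cnt D \<omega> (\<sigma> (other v)) (1, v, f)"
    and "sat D \<omega> \<sigma> (ExGe k v f) \<longleftrightarrow> sat_cnt D \<omega> (\<sigma> (other v)) (k, v, f)"
    and "sat D \<omega> \<sigma> (ExLe k v f) \<longleftrightarrow> \<not> sat_cnt D \<omega> (\<sigma> (other v)) (Suc k, v, f)"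
    and "sat D \<omega> \<sigma> (ExEq k v f) \<longleftrightarrow>
      sat_cnt D \<omega> (\<sigma> (other v)) (k, v, f) \<and> \<not> sat_cnt D \<omega> (\<sigma> (other v)) (Suc k, v, f)"
proof -
  have "1 \<le> card {b\<in>D. P b} \<longleftrightarrow> (\<exists>b\<in>D. P b)" for P
    using assms by (auto simp: Suc_le_eq card_gt_0_iff)
  then show "sat D \<omega> \<sigma> (All v f) \<longleftrightarrow> \<not> sat_cnt D \<omega> (\<sigma> (other v)) (1, v, Not f)"
    "sat D \<omega> \<sigma> (Ex v f) \<longleftrightarrow> sat_cnt D \<omega> (\<sigma> (other v)) (1, v, f)"
    by (simp_all add: sat_cnt_def upd_asg)
qed (auto simp: sat_cnt_def upd_asg)

lemma lev_eq_sat: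
  assumes "finite D" "\<And>a t. a \<in> D \<Longrightarrow> t \<in> cnts f \<Longrightarrow> t \<in> c a \<longleftrightarrow> sat_cnt D \<omega> a t" "\<And>u. \<sigma> u \<in> D"
  shows "lev \<omega> \<sigma> (\<lambda>u. c (\<sigma> u)) f = sat D \<omega> \<sigma> f"
  using assms(2) sat_quantifier[OF assms(1)] assms(3)
  by (induction f) (simp_all del: sat.simps(10-14))

lemma degree_eq:
  assumes "finite D" "\<And>a t. a \<in> D \<Longrightarrow> t \<in> cnts f \<Longrightarrow> t \<in> c a \<longleftrightarrow> sat_cnt D \<omega> a t" "a \<in> D"
  shows "k \<le> degree D \<omega> c a (k, v, f) \<longleftrightarrow> sat_cnt D \<omega> a (k, v, f)"
proof -
  have "{b\<in>D. lev \<omega> (asg v a b) (asg v (c a) (c b)) f} = {b\<in>D. sat D \<omega> (asg v a b) f}"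
  proof (rule Collect_cong, rule conj_cong[OF refl])
    fix b assume "b \<in> D"
    have "lev \<omega> (asg v a b) (\<lambda>u. c (asg v a b u)) f = sat D \<omega> (asg v a b) f"
      using assms \<open>b \<in> D\<close> by (intro lev_eq_sat asg_mem) auto
    then show "lev \<omega> (asg v a b) (asg v (c a) (c b)) f = sat D \<omega> (asg v a b) f"
      by (simp add: asg_comp)
  qed
  then show ?thesis by (simp add: degree_def sat_cnt_def)
qed

text \<open>Uniqueness of consistent colours, by induction on subformulas: once the colours are
  right for the thresholds inside a quantifier, degrees are true counts by \<open>degree_eq\<close>,
  so consistency forces the outer threshold to be right as well.\<close>

lemma consistent_colours:
  assumes D: "finite D"
    and c: "\<And>a k v g. a \<in> D \<Longrightarrow> (k, v, g) \<in> cnts \<Phi> \<Longrightarrow>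
      (k, v, g) \<in> c a \<longleftrightarrow> k \<le> degree D \<omega> c a (k, v, g)"
    and "a \<in> D" "t \<in> cnts \<Phi>"
  shows "t \<in> c a \<longleftrightarrow> sat_cnt D \<omega> a t"
proof -
  have "\<forall>a\<in>D. \<forall>t\<in>cnts f. t \<in> c a \<longleftrightarrow> sat_cnt D \<omega> a t" if "cnts f \<subseteq> cnts \<Phi>" for f
    using that
  proof (induction f)
    case (All v f)
    have IH: "\<forall>a\<in>D. \<forall>t\<in>cnts (Not f). t \<in> c a \<longleftrightarrow> sat_cnt D \<omega> a t" using All by simp
    then have "k \<le> degree D \<omega> c a (k, v, Not f) \<longleftrightarrow> sat_cnt D \<omega> a (k, v, Not f)" if "a \<in> D" for a k
      using degree_eq[OF D _ that, of "Not f" c \<omega> k v] by blast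
    then show ?case using IH All.prems c by auto
  next
    case (Ex v f)
    then have IH: "\<forall>a\<in>D. \<forall>t\<in>cnts f. t \<in> c a \<longleftrightarrow> sat_cnt D \<omega> a t" by simp
    then have "k \<le> degree D \<omega> c a (k, v, f) \<longleftrightarrow> sat_cnt D \<omega> a (k, v, f)" if "a \<in> D" for a k
      using degree_eq[OF D _ that, of f c \<omega> k v] by blast
    then show ?case using IH Ex.prems c by auto
  next
    case (ExGe k' v f)
    then have IH: "\<forall>a\<in>D. \<forall>t\<in>cnts f. t \<in> c a \<longleftrightarrow> sat_cnt D \<omega> a t" by simp
    then have "k \<le> degree D \<omega> c a (k, v, f) \<longleftrightarrow> sat_cnt D \<omega> a (k, v, f)" if "a \<in> D" for a k
      using degree_eq[OF D _ that, of f c \<omega> k v] by blast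
    then show ?case using IH ExGe.prems c by auto
  next
    case (ExLe k' v f)
    then have IH: "\<forall>a\<in>D. \<forall>t\<in>cnts f. t \<in> c a \<longleftrightarrow> sat_cnt D \<omega> a t" by simp
    then have "k \<le> degree D \<omega> c a (k, v, f) \<longleftrightarrow> sat_cnt D \<omega> a (k, v, f)" if "a \<in> D" for a k
      using degree_eq[OF D _ that, of f c \<omega> k v] by blast
    then show ?case using IH ExLe.prems c by auto
  next
    case (ExEq k' v f)
    then have IH: "\<forall>a\<in>D. \<forall>t\<in>cnts f. t \<in> c a \<longleftrightarrow> sat_cnt D \<omega> a t" by simp
    then have "k \<le> degree D \<omega> c a (k, v, f) \<longleftrightarrow> sat_cnt D \<omega> a (k, v, f)" if "a \<in> D" for a k
      using degree_eq[OF D _ that, of f c \<omega> k v] by blast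
    then show ?case using IH ExEq.prems c by auto
  qed auto
  then show ?thesis using assms(3,4) by blast
qed

lemma sat_free_vars: "(\<And>u. u \<in> free_vars f \<Longrightarrow> \<sigma> u = \<sigma>' u) \<Longrightarrow> sat D \<omega> \<sigma> f = sat D \<omega> \<sigma>' f"
proof (induction f arbitrary: \<sigma> \<sigma>')
  case (Atom R vs)
  then have "map \<sigma> vs = map \<sigma>' vs" by simp
  then show ?case by (simp only: sat.simps)
next
  case (Not f)
  have "sat D \<omega> \<sigma> f = sat D \<omega> \<sigma>' f" by (rule Not.IH) (use Not.prems in auto)
  then show ?case by simp
next
  case (And f g)
  have "sat D \<omega> \<sigma> f = sat D \<omega> \<sigma>' f" by (rule And.IH) (use And.prems in auto)
  moreover have "sat D \<omega> \<sigma> g = sat D \<omega> \<sigma>' g" by (rule And.IH) (use And.prems in auto)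
  ultimately show ?case by simp
next
  case (Or f g)
  have "sat D \<omega> \<sigma> f = sat D \<omega> \<sigma>' f" by (rule Or.IH) (use Or.prems in auto)
  moreover have "sat D \<omega> \<sigma> g = sat D \<omega> \<sigma>' g" by (rule Or.IH) (use Or.prems in auto)
  ultimately show ?case by simp
next
  case (Imp f g)
  have "sat D \<omega> \<sigma> f = sat D \<omega> \<sigma>' f" by (rule Imp.IH) (use Imp.prems in auto)
  moreover have "sat D \<omega> \<sigma> g = sat D \<omega> \<sigma>' g" by (rule Imp.IH) (use Imp.prems in auto)
  ultimately show ?case by simp
next
  case (Iff f g)
  have "sat D \<omega> \<sigma> f = sat D \<omega> \<sigma>' f" by (rule Iff.IH) (use Iff.prems in auto)
  moreover have "sat D \<omega> \<sigma> g = sat D \<omega> \<sigma>' g" by (rule Iff.IH) (use Iff.prems in auto)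
  ultimately show ?case by simp
next
  case (All v f)
  have "sat D \<omega> (\<sigma>(v := t)) f = sat D \<omega> (\<sigma>'(v := t)) f" for t
    by (rule All.IH) (use All.prems in auto)
  then show ?case by simp
next
  case (Ex v f)
  have "sat D \<omega> (\<sigma>(v := t)) f = sat D \<omega> (\<sigma>'(v := t)) f" for t
    by (rule Ex.IH) (use Ex.prems in auto)
  then show ?case by simp
next
  case (ExGe k v f)
  have "sat D \<omega> (\<sigma>(v := t)) f = sat D \<omega> (\<sigma>'(v := t)) f" for t
    by (rule ExGe.IH) (use ExGe.prems in auto)
  then show ?case by simp
next
  case (ExLe k v f)
  have "sat D \<omega> (\<sigma>(v := t)) f = sat D \<omega> (\<sigma>'(v := t)) f" for t
    by (rule ExLe.IH) (use ExLe.prems in auto)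
  then show ?case by simp
next
  case (ExEq k v f)
  have "sat D \<omega> (\<sigma>(v := t)) f = sat D \<omega> (\<sigma>'(v := t)) f" for t
    by (rule ExEq.IH) (use ExEq.prems in auto)
  then show ?case by simp
qed simp_all

lemma models_eq_sat: "sentence \<Phi> \<Longrightarrow> models D \<omega> \<Phi> \<longleftrightarrow> sat D \<omega> \<sigma> \<Phi>"
  unfolding models_def sentence_def using sat_free_vars[of \<Phi>] by blast

text \<open>Only the true colouring \<open>c0\<close> is consistent, and under it local evaluation
  of the sentence at any element gives its truth value. On the empty domain the right-hand side
  would be 1 for every sentence.\<close>

lemma models_eq_sum_colours:
  assumes D: "finite D" "D \<noteq> {}" and "sentence \<Phi>"
  shows "of_bool (models D \<omega> \<Phi>) = (\<Sum>c\<in>D \<rightarrow>\<^sub>E Pow (cnts \<Phi>). \<Prod>a\<in>D.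
    of_bool (lev \<omega> (\<lambda>_. a) (\<lambda>_. c a) \<Phi>) *
    (\<Prod>t\<in>cnts \<Phi>. of_bool (t \<in> c a \<longleftrightarrow> fst t \<le> degree D \<omega> c a t)) :: int)"
proof -
  define ok where "ok c \<longleftrightarrow> (\<forall>a\<in>D. lev \<omega> (\<lambda>_. a) (\<lambda>_. c a) \<Phi> \<and>
    (\<forall>t\<in>cnts \<Phi>. t \<in> c a \<longleftrightarrow> fst t \<le> degree D \<omega> c a t))" for c
  define c0 where "c0 = (\<lambda>a\<in>D. {t\<in>cnts \<Phi>. sat_cnt D \<omega> a t})"
  have of_bool_prod: "(\<Prod>i\<in>I. of_bool (P i)) = (of_bool (\<forall>i\<in>I. P i) :: int)"
    if "finite I" for I :: "'z set" and P
    using that by (induction I rule: finite_induct) auto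
  have prod: "(\<Prod>a\<in>D. of_bool (lev \<omega> (\<lambda>_. a) (\<lambda>_. c a) \<Phi>) *
    (\<Prod>t\<in>cnts \<Phi>. of_bool (t \<in> c a \<longleftrightarrow> fst t \<le> degree D \<omega> c a t))) = (of_bool (ok c) :: int)" for c
  proof -
    have "(\<Prod>a\<in>D. of_bool (lev \<omega> (\<lambda>_. a) (\<lambda>_. c a) \<Phi>) *
      (\<Prod>t\<in>cnts \<Phi>. of_bool (t \<in> c a \<longleftrightarrow> fst t \<le> degree D \<omega> c a t))) =
      (\<Prod>a\<in>D. of_bool (lev \<omega> (\<lambda>_. a) (\<lambda>_. c a) \<Phi> \<and>
        (\<forall>t\<in>cnts \<Phi>. t \<in> c a \<longleftrightarrow> fst t \<le> degree D \<omega> c a t)) :: int)"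
      by (simp only: of_bool_prod[OF finite_cnts] of_bool_conj)
    then show ?thesis unfolding of_bool_prod[OF D(1)] ok_def .
  qed
  have c0: "t \<in> c0 a \<longleftrightarrow> sat_cnt D \<omega> a t" if "a \<in> D" "t \<in> cnts \<Phi>" for a t
    using that by (simp add: c0_def)
  have ok0: "ok c0 \<longleftrightarrow> models D \<omega> \<Phi>"
  proof -
    have "lev \<omega> (\<lambda>_. a) (\<lambda>_. c0 a) \<Phi> \<longleftrightarrow> models D \<omega> \<Phi>" if "a \<in> D" for a
      using lev_eq_sat[OF D(1), of \<Phi> c0 \<omega> "\<lambda>_. a"] c0 that
        models_eq_sat[OF assms(3), of D \<omega> "\<lambda>_. a"] by blast
    moreover have "t \<in> c0 a \<longleftrightarrow> fst t \<le> degree D \<omega> c0 a t" if a: "a \<in> D" and t: "t \<in> cnts \<Phi>" for a t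
    proof -
      obtain k v g where [simp]: "t = (k, v, g)" by (cases t)
      have "k \<le> degree D \<omega> c0 a (k, v, g) \<longleftrightarrow> sat_cnt D \<omega> a (k, v, g)"
        using c0 cnts_closed[of k v g \<Phi>] t by (intro degree_eq[OF D(1) _ a]) auto
      then show ?thesis using c0[OF a t] by simp
    qed
    ultimately show ?thesis using D(2) unfolding ok_def by blast
  qed
  have uniq: "c = c0" if "c \<in> D \<rightarrow>\<^sub>E Pow (cnts \<Phi>)" "ok c" for c
  proof
    fix a
    show "c a = c0 a"
    proof (cases "a \<in> D")
      case True
      have "t \<in> c a \<longleftrightarrow> sat_cnt D \<omega> a t" if "t \<in> cnts \<Phi>" for t
        using \<open>ok c\<close> consistent_colours[OF D(1) _ True that, of c \<omega>] unfolding ok_def by fastforce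
      moreover have "c a \<subseteq> cnts \<Phi>" using \<open>c \<in> _\<close> True by auto
      ultimately show ?thesis using True by (auto simp: c0_def)
    next
      case False
      then show ?thesis using \<open>c \<in> _\<close> by (auto simp: c0_def PiE_iff extensional_def)
    qed
  qed
  have mem: "c0 \<in> D \<rightarrow>\<^sub>E Pow (cnts \<Phi>)" by (auto simp: c0_def)
  have fin: "finite (D \<rightarrow>\<^sub>E Pow (cnts \<Phi>))" using D(1) by (simp add: finite_PiE)
  have "(\<Sum>c\<in>D \<rightarrow>\<^sub>E Pow (cnts \<Phi>). of_bool (ok c) :: int) = (\<Sum>c\<in>{c0}. of_bool (ok c))"
    using mem fin uniq by (intro sum.mono_neutral_right) auto
  then show ?thesis unfolding prod using ok0 by simp
qed

section \<open>The perturbed count\<close>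

text \<open>An exponent function \<open>s\<close> selects, for each counting subformula \<open>t\<close>, one monomial of the threshold
  polynomial; its value \<open>(B ^ s t) ^ \<delta>\<close> is distributed as a factor \<open>B ^ s t\<close> over the \<open>\<delta>\<close> neighbours.\<close>

definition exps :: "fm \<Rightarrow> (cnt \<Rightarrow> nat) set" where
  "exps \<Phi> = (\<Pi>\<^sub>E t\<in>cnts \<Phi>. {..fst t})"

text \<open>Everything that concerns a single element: the test of the sentence, the coefficients of
  the chosen monomials, and the element as its own neighbour.\<close>

definition vfac :: "fm \<Rightarrow> int \<Rightarrow> 'b world \<Rightarrow> 'b \<Rightarrow> cnt set \<Rightarrow> (cnt \<Rightarrow> nat) \<Rightarrow> int" where
  "vfac \<Phi> B \<omega> a c s = of_bool (lev \<omega> (\<lambda>_. a) (\<lambda>_. c) \<Phi>) *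
    (\<Prod>t\<in>cnts \<Phi>. cnt_coeff B (fst t) (t \<in> c) (s t) *
      (if lev \<omega> (\<lambda>_. a) (\<lambda>_. c) (snd (snd t)) then B ^ s t else 1))"

text \<open>Directed: the share of \<open>b\<close> in the degrees of \<open>a\<close>. From
  \<open>b\<close> only the colour is needed, not its exponents.\<close>

definition efac :: "fm \<Rightarrow> int \<Rightarrow> 'b world \<Rightarrow> 'b \<Rightarrow> 'b \<Rightarrow> cnt set \<Rightarrow> (cnt \<Rightarrow> nat) \<Rightarrow> cnt set \<Rightarrow> int" where
  "efac \<Phi> B \<omega> a b c s c' = (\<Prod>t\<in>cnts \<Phi>.
    if lev \<omega> (asg (fst (snd t)) a b) (asg (fst (snd t)) c c') (snd (snd t)) then B ^ s t else 1)"

lemma finite_exps: "finite (exps \<Phi>)"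
  by (auto simp: exps_def intro!: finite_PiE)

text \<open>The power of \<open>B\<close> common to all colourings: \<open>k choose 2\<close> per
  threshold and element.\<close>

definition scale_exp :: "fm \<Rightarrow> nat \<Rightarrow> nat" where
  "scale_exp \<Phi> n = n * (\<Sum>t\<in>cnts \<Phi>. fst t choose 2)"

lemma asg_same: "asg v a a = (\<lambda>_. a)"
  by (auto simp: asg_def)

lemma power_degree:
  assumes "finite D" "a \<in> D"
  shows "x ^ degree D \<omega> c a t =
    (if lev \<omega> (\<lambda>_. a) (\<lambda>_. c a) (snd (snd t)) then x else 1) *
    (\<Prod>b\<in>D - {a}. if lev \<omega> (asg (fst (snd t)) a b) (asg (fst (snd t)) (c a) (c b)) (snd (snd t))
      then x else (1 :: int))"
proof -
  define P where "P b \<longleftrightarrow> lev \<omega> (asg (fst (snd t)) a b) (asg (fst (snd t)) (c a) (c b)) (snd (snd t))" for b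
  have "x ^ degree D \<omega> c a t = x ^ card {b\<in>D. P b}"
    by (simp add: degree_def P_def case_prod_beta)
  also have "\<dots> = (\<Prod>b\<in>D. if P b then x else 1)"
    using assms(1) by (simp add: prod.If_cases Int_def)
  also have "\<dots> = (if P a then x else 1) * (\<Prod>b\<in>D - {a}. if P b then x else 1)"
    using assms by (simp add: prod.remove)
  finally show ?thesis by (simp add: P_def asg_same)
qed

text \<open>Distributivity twice: over the thresholds at one element, then over the
  elements.\<close>

lemma sum_exps_eq_prod_degrees:
  assumes "finite D"
  shows "(\<Sum>s\<in>D \<rightarrow>\<^sub>E exps \<Phi>. \<Prod>a\<in>D. vfac \<Phi> B \<omega> a (c a) (s a) *
      (\<Prod>b\<in>D - {a}. efac \<Phi> B \<omega> a b (c a) (s a) (c b))) =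
    (\<Prod>a\<in>D. of_bool (lev \<omega> (\<lambda>_. a) (\<lambda>_. c a) \<Phi>) *
      (\<Prod>t\<in>cnts \<Phi>. \<Sum>s\<le>fst t. cnt_coeff B (fst t) (t \<in> c a) s * (B ^ s) ^ degree D \<omega> c a t))"
proof -
  have vertex: "of_bool (lev \<omega> (\<lambda>_. a) (\<lambda>_. c a) \<Phi>) *
      (\<Prod>t\<in>cnts \<Phi>. \<Sum>s\<le>fst t. cnt_coeff B (fst t) (t \<in> c a) s * (B ^ s) ^ degree D \<omega> c a t) =
    (\<Sum>s\<in>exps \<Phi>. vfac \<Phi> B \<omega> a (c a) s * (\<Prod>b\<in>D - {a}. efac \<Phi> B \<omega> a b (c a) s (c b)))"
    if a: "a \<in> D" for a
  proof -
    have "(\<Prod>t\<in>cnts \<Phi>. \<Sum>s\<le>fst t. cnt_coeff B (fst t) (t \<in> c a) s * (B ^ s) ^ degree D \<omega> c a t) =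
      (\<Sum>s\<in>exps \<Phi>. \<Prod>t\<in>cnts \<Phi>. cnt_coeff B (fst t) (t \<in> c a) (s t) * (B ^ s t) ^ degree D \<omega> c a t)"
      unfolding exps_def by (rule prod_sum_PiE) auto
    moreover have "of_bool (lev \<omega> (\<lambda>_. a) (\<lambda>_. c a) \<Phi>) *
        (\<Prod>t\<in>cnts \<Phi>. cnt_coeff B (fst t) (t \<in> c a) (s t) * (B ^ s t) ^ degree D \<omega> c a t) =
      vfac \<Phi> B \<omega> a (c a) s * (\<Prod>b\<in>D - {a}. efac \<Phi> B \<omega> a b (c a) s (c b))" for s
      unfolding power_degree[OF assms a] vfac_def efac_def
      by (subst prod.swap) (simp add: prod.distrib ac_simps)
    ultimately show ?thesis by (simp add: sum_distrib_left)
  qed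
  have "(\<Prod>a\<in>D. of_bool (lev \<omega> (\<lambda>_. a) (\<lambda>_. c a) \<Phi>) *
      (\<Prod>t\<in>cnts \<Phi>. \<Sum>s\<le>fst t. cnt_coeff B (fst t) (t \<in> c a) s * (B ^ s) ^ degree D \<omega> c a t)) =
    (\<Prod>a\<in>D. \<Sum>s\<in>exps \<Phi>. vfac \<Phi> B \<omega> a (c a) s * (\<Prod>b\<in>D - {a}. efac \<Phi> B \<omega> a b (c a) s (c b)))"
    by (intro prod.cong refl vertex)
  also have "\<dots> = (\<Sum>s\<in>D \<rightarrow>\<^sub>E exps \<Phi>. \<Prod>a\<in>D. vfac \<Phi> B \<omega> a (c a) (s a) *
      (\<Prod>b\<in>D - {a}. efac \<Phi> B \<omega> a b (c a) (s a) (c b)))"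
    using assms finite_exps by (rule prod_sum_PiE)
  finally show ?thesis by simp
qed

definition perturbed :: "fm \<Rightarrow> int \<Rightarrow> 'a set \<Rightarrow> 'a world \<Rightarrow> int" where
  "perturbed \<Phi> B D \<omega> = (\<Sum>c\<in>D \<rightarrow>\<^sub>E Pow (cnts \<Phi>). \<Sum>s\<in>D \<rightarrow>\<^sub>E exps \<Phi>. \<Prod>a\<in>D.
    vfac \<Phi> B \<omega> a (c a) (s a) * (\<Prod>b\<in>D - {a}. efac \<Phi> B \<omega> a b (c a) (s a) (c b)))"

text \<open>All colourings carry the same power of \<open>B\<close>, so their 0/1 residues simply
  add, and the sum is the truth value.\<close>

lemma perturbed_lead:
  assumes D: "finite D" "D \<noteq> {}" and "sentence \<Phi>"
  shows "\<exists>z. perturbed \<Phi> B D \<omega> = B ^ scale_exp \<Phi> (card D) * (of_bool (models D \<omega> \<Phi>) + B * z)"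
proof -
  define \<chi> where "\<chi> c = (\<Prod>a\<in>D. of_bool (lev \<omega> (\<lambda>_. a) (\<lambda>_. c a) \<Phi>) *
    (\<Prod>t\<in>cnts \<Phi>. of_bool (t \<in> c a \<longleftrightarrow> fst t \<le> degree D \<omega> c a t)) :: int)" for c
  define Y where "Y c = (\<Prod>a\<in>D. of_bool (lev \<omega> (\<lambda>_. a) (\<lambda>_. c a) \<Phi>) *
      (\<Prod>t\<in>cnts \<Phi>. \<Sum>s\<le>fst t. cnt_coeff B (fst t) (t \<in> c a) s * (B ^ s) ^ degree D \<omega> c a t))" for c
  define m where "m = (\<Sum>t\<in>cnts \<Phi>. fst t choose 2)"
  have "\<exists>z. Y c = B ^ scale_exp \<Phi> (card D) * (\<chi> c + B * z)" for c
  proof -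
    have "\<exists>z. of_bool (lev \<omega> (\<lambda>_. a) (\<lambda>_. c a) \<Phi>) *
      (\<Prod>t\<in>cnts \<Phi>. \<Sum>s\<le>fst t. cnt_coeff B (fst t) (t \<in> c a) s * (B ^ s) ^ degree D \<omega> c a t) =
      B ^ m * (of_bool (lev \<omega> (\<lambda>_. a) (\<lambda>_. c a) \<Phi>) *
        (\<Prod>t\<in>cnts \<Phi>. of_bool (t \<in> c a \<longleftrightarrow> fst t \<le> degree D \<omega> c a t)) + B * z)" for a
    proof -
      have "\<exists>z. (\<Prod>t\<in>cnts \<Phi>. \<Sum>s\<le>fst t. cnt_coeff B (fst t) (t \<in> c a) s *
          (B ^ s) ^ degree D \<omega> c a t) =
        B ^ m * ((\<Prod>t\<in>cnts \<Phi>. of_bool (t \<in> c a \<longleftrightarrow> fst t \<le> degree D \<omega> c a t)) + B * z)"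
        unfolding m_def by (rule prod_lead_mod[OF finite_cnts], rule sum_cnt_coeff)
      then obtain z where "(\<Prod>t\<in>cnts \<Phi>. \<Sum>s\<le>fst t. cnt_coeff B (fst t) (t \<in> c a) s *
          (B ^ s) ^ degree D \<omega> c a t) =
        B ^ m * ((\<Prod>t\<in>cnts \<Phi>. of_bool (t \<in> c a \<longleftrightarrow> fst t \<le> degree D \<omega> c a t)) + B * z)"
        by blast
      then show ?thesis
        by (intro exI[of _ "of_bool (lev \<omega> (\<lambda>_. a) (\<lambda>_. c a) \<Phi>) * z"]) (simp add: algebra_simps)
    qed
    then have "\<exists>z. Y c = B ^ (\<Sum>a\<in>D. m) * (\<chi> c + B * z)"
      unfolding Y_def \<chi>_def by (intro prod_lead_mod[OF D(1)]) auto
    then show ?thesis by (simp add: scale_exp_def m_def)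
  qed
  then obtain z where "(\<Sum>c\<in>D \<rightarrow>\<^sub>E Pow (cnts \<Phi>). 1 * Y c) =
    B ^ scale_exp \<Phi> (card D) * ((\<Sum>c\<in>D \<rightarrow>\<^sub>E Pow (cnts \<Phi>). 1 * \<chi> c) + B * z)"
    using sum_lead_mod[of "D \<rightarrow>\<^sub>E Pow (cnts \<Phi>)" Y B "scale_exp \<Phi> (card D)" \<chi> "\<lambda>_. 1"] by blast
  moreover have "(\<Sum>c\<in>D \<rightarrow>\<^sub>E Pow (cnts \<Phi>). \<chi> c) = of_bool (models D \<omega> \<Phi>)"
    unfolding \<chi>_def using models_eq_sum_colours[OF assms, of \<omega>] by simp
  moreover have "perturbed \<Phi> B D \<omega> = (\<Sum>c\<in>D \<rightarrow>\<^sub>E Pow (cnts \<Phi>). Y c)"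
    unfolding perturbed_def Y_def sum_exps_eq_prod_degrees[OF D(1)] ..
  ultimately show ?thesis by auto
qed

section \<open>Splitting worlds by the support of the atoms\<close>

text \<open>The weight of a world taken atom by atom instead of through \<open>Ncount\<close>; in
  this form it factors over disjoint sets of atoms.\<close>

definition wt :: "('b \<Rightarrow> int) \<Rightarrow> ('b \<Rightarrow> int) \<Rightarrow> 'b set \<Rightarrow> 'b set \<Rightarrow> int" where
  "wt f g A X = (\<Prod>x\<in>A. if x \<in> X then f x else g x)"

lemma wt_image:
  assumes "inj_on h A" "X \<subseteq> A"
  shows "wt f g (h ` A) (h ` X) = wt (\<lambda>x. f (h x)) (\<lambda>x. g (h x)) A X"
  unfolding wt_def prod.reindex[OF assms(1)]
  using inj_on_image_mem_iff[OF assms(1) _ assms(2)] by (intro prod.cong) auto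

lemma wt_Un:
  assumes "finite A" "finite B" "A \<inter> B = {}" "X \<subseteq> A" "Y \<subseteq> B"
  shows "wt f g (A \<union> B) (X \<union> Y) = wt f g A X * wt f g B Y"
proof -
  have "wt f g (A \<union> B) (X \<union> Y) = wt f g A (X \<union> Y) * wt f g B (X \<union> Y)"
    unfolding wt_def using assms by (intro prod.union_disjoint) auto
  also have "wt f g A (X \<union> Y) = wt f g A X"
    unfolding wt_def using assms by (intro prod.cong) auto
  also have "wt f g B (X \<union> Y) = wt f g B Y"
    unfolding wt_def using assms by (intro prod.cong) auto
  finally show ?thesis .
qed

lemma wt_Int: "wt f g A (X \<inter> A) = wt f g A X"
  unfolding wt_def by (intro prod.cong) auto

lemma wt_UN:
  assumes "finite I" "\<And>i. i \<in> I \<Longrightarrow> finite (A i)"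
    and "\<And>i j. i \<in> I \<Longrightarrow> j \<in> I \<Longrightarrow> i \<noteq> j \<Longrightarrow> A i \<inter> A j = {}"
  shows "wt f g (\<Union>i\<in>I. A i) X = (\<Prod>i\<in>I. wt f g (A i) X)"
  unfolding wt_def using assms by (intro prod.UNION_disjoint) auto

text \<open>Unconstrained atoms are chosen independently. Serves both for the atoms the sentence
  cannot see and for the a priori bound.\<close>

lemma sum_wt: "finite A \<Longrightarrow> (\<Sum>X\<in>Pow A. wt f g A X) = (\<Prod>x\<in>A. f x + g x)"
proof (induction A rule: finite_induct)
  case empty
  show ?case by (simp add: wt_def)
next
  case (insert a A)
  have "(\<Sum>X\<in>Pow ({a} \<union> A). wt f g ({a} \<union> A) X) =
    (\<Sum>Y\<in>Pow {a}. \<Sum>Z\<in>Pow A. wt f g ({a} \<union> A) (Y \<union> Z))"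
    using insert by (intro sum_Pow_Un) auto
  also have "\<dots> = (\<Sum>Y\<in>Pow {a}. \<Sum>Z\<in>Pow A. wt f g {a} Y * wt f g A Z)"
    using insert by (intro sum.cong refl wt_Un) auto
  also have "\<dots> = (\<Sum>Y\<in>Pow {a}. wt f g {a} Y) * (\<Prod>x\<in>A. f x + g x)"
    using insert.IH by (simp add: sum_product[symmetric])
  also have "(\<Sum>Y\<in>Pow {a}. wt f g {a} Y) = f a + g a"
    by (simp add: Pow_insert wt_def)
  finally show ?case using insert.hyps by simp
qed

lemma sum_Pow_image:
  assumes "inj_on h A"
  shows "(\<Sum>X\<in>Pow (h ` A). F X) = (\<Sum>X\<in>Pow A. F (h ` X))"
  using sum.reindex[OF inj_on_image_Pow[OF assms], of F] image_Pow_surj[of h A "h ` A"] by simp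

lemma sum_Pow_Times:
  "(\<Sum>X\<in>Pow (D \<times> R). F X) = (\<Sum>\<tau>\<in>D \<rightarrow>\<^sub>E Pow R. F (Sigma D \<tau>))"
proof (rule sum.reindex_bij_witness[of _ "\<lambda>\<tau>. Sigma D \<tau>" "\<lambda>X. \<lambda>a\<in>D. {r. (a, r) \<in> X}"])
  fix X assume X: "X \<in> Pow (D \<times> R)"
  show "Sigma D (\<lambda>a\<in>D. {r. (a, r) \<in> X}) = X" using X by auto
  then show "F (Sigma D (\<lambda>a\<in>D. {r. (a, r) \<in> X})) = F X" by simp
  show "(\<lambda>a\<in>D. {r. (a, r) \<in> X}) \<in> D \<rightarrow>\<^sub>E Pow R" using X by auto
next
  fix \<tau> assume \<tau>: "\<tau> \<in> D \<rightarrow>\<^sub>E Pow R"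
  show "(\<lambda>a\<in>D. {r. (a, r) \<in> Sigma D \<tau>}) = \<tau>"
    using \<tau> by (auto simp: fun_eq_iff PiE_iff extensional_def)
  show "Sigma D \<tau> \<in> Pow (D \<times> R)" using \<tau> by auto
qed

definition nullary :: "nat list \<Rightarrow> nat set" where
  "nullary sig = {R. R < length sig \<and> sig ! R = 0}"

definition nonnull :: "nat list \<Rightarrow> nat set" where
  "nonnull sig = {R. R < length sig \<and> sig ! R > 0}"

definition atoms_on :: "nat list \<Rightarrow> 'b set \<Rightarrow> (nat \<times> 'b list) set" where
  "atoms_on sig e = {(R, ts). R < length sig \<and> length ts = sig ! R \<and> set ts = e}"

text \<open>Atoms out of reach of two variables.\<close>

definition high_atoms :: "nat list \<Rightarrow> 'b set \<Rightarrow> (nat \<times> 'b list) set" where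
  "high_atoms sig D = {\<alpha>\<in>ground_atoms sig D. 3 \<le> card (set (snd \<alpha>))}"

definition nullary_world :: "nat set \<Rightarrow> 'b world" where
  "nullary_world Z = (\<lambda>R. (R, [])) ` Z"

text \<open>\<open>\<tau>\<close> is the 1-type of \<open>a\<close>: the predicates true when every
  argument is \<open>a\<close>.\<close>

definition diag_world :: "nat list \<Rightarrow> nat set \<Rightarrow> 'b \<Rightarrow> 'b world" where
  "diag_world sig \<tau> a = (\<lambda>R. (R, replicate (sig ! R) a)) ` \<tau>"

definition low_world :: "nat list \<Rightarrow> nat set \<Rightarrow> 'b set \<Rightarrow> ('b \<Rightarrow> nat set) \<Rightarrow> 'b world" where
  "low_world sig Z D \<tau> = nullary_world Z \<union> (\<Union>a\<in>D. diag_world sig (\<tau> a) a)"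

lemma finite_nullary [simp]: "finite (nullary sig)" "finite (nonnull sig)"
  by (auto simp: nullary_def nonnull_def)

lemma finite_ground_atoms:
  assumes "finite D" shows "finite (ground_atoms sig D)"
proof -
  have "ground_atoms sig D = (SIGMA R:{..<length sig}. {ts. set ts \<subseteq> D \<and> length ts = sig ! R})"
    by (auto simp: ground_atoms_def)
  then show ?thesis using assms by (auto intro: finite_lists_length_eq)
qed

lemma finite_atoms_on:
  assumes "finite e" shows "finite (atoms_on sig e)"
proof (rule finite_subset)
  show "atoms_on sig e \<subseteq> ground_atoms sig e" by (auto simp: atoms_on_def ground_atoms_def)
qed (rule finite_ground_atoms[OF assms])

lemma set_eq_singletonD: "set ts = {a} \<Longrightarrow> ts \<noteq> [] \<and> ts = replicate (length ts) a"
  by (auto intro: replicate_eqI)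

context
  fixes sig :: "nat list" and D :: "'a set"
  assumes D: "finite D"
begin

lemma ground_atoms_split:
  "ground_atoms sig D = ((nullary_world (nullary sig) \<union>
      (\<lambda>(a, R). (R, replicate (sig ! R) a)) ` (D \<times> nonnull sig)) \<union>
    (\<Union>e\<in>upairs D. atoms_on sig e)) \<union> high_atoms sig D" (is "_ = ?U")
proof (rule Set.set_eqI, rule iffI)
  fix \<alpha> assume \<alpha>: "\<alpha> \<in> ground_atoms sig D"
  obtain R ts where [simp]: "\<alpha> = (R, ts)" by (cases \<alpha>)
  have R: "R < length sig" "length ts = sig ! R" "set ts \<subseteq> D"
    using \<alpha> by (auto simp: ground_atoms_def)
  consider "card (set ts) = 0" | "card (set ts) = 1" | "card (set ts) = 2" | "3 \<le> card (set ts)"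
    by linarith
  then show "\<alpha> \<in> ?U"
  proof cases
    case 1
    then have "ts = []" by simp
    then show ?thesis using R by (auto simp: nullary_world_def nullary_def)
  next
    case 2
    then obtain a where a: "set ts = {a}" by (auto simp: card_1_singleton_iff)
    then have "ts = replicate (sig ! R) a" "ts \<noteq> []" "a \<in> D"
      using R set_eq_singletonD[OF a] by auto
    then have "(R, ts) \<in> (\<lambda>(a, R). (R, replicate (sig ! R) a)) ` (D \<times> nonnull sig)"
      using R by (intro image_eqI[of _ _ "(a, R)"]) (auto simp: nonnull_def)
    then show ?thesis by simp
  next
    case 3
    then show ?thesis using R by (auto simp: atoms_on_def upairs_def)
  next
    case 4
    then show ?thesis using \<alpha> by (simp add: high_atoms_def)
  qed
next
  fix \<alpha> assume "\<alpha> \<in> ?U"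
  then show "\<alpha> \<in> ground_atoms sig D"
    by (auto simp: nullary_world_def nullary_def nonnull_def atoms_on_def upairs_def high_atoms_def
        ground_atoms_def)
qed

lemma inj_diag: "inj_on (\<lambda>(a, R). (R, replicate (sig ! R) a)) (D \<times> nonnull sig)"
  by (auto simp: inj_on_def nonnull_def replicate_eq_replicate)

lemma inj_nullary: "inj_on (\<lambda>R. (R, [])) A"
  by (auto simp: inj_on_def)

lemma image_diag: "(\<lambda>(a, R). (R, replicate (sig ! R) a)) ` Sigma D \<tau> = (\<Union>a\<in>D. diag_world sig (\<tau> a) a)"
  by (auto simp: diag_world_def)

lemma split_disjoint:
  "nullary_world (nullary sig) \<inter> (\<lambda>(a, R). (R, replicate (sig ! R) a)) ` (D \<times> nonnull sig) = {}"
  "(nullary_world (nullary sig) \<union>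
      (\<lambda>(a, R). (R, replicate (sig ! R) a)) ` (D \<times> nonnull sig)) \<inter>
    (\<Union>e\<in>upairs D. atoms_on sig e) = {}"
  "((nullary_world (nullary sig) \<union>
      (\<lambda>(a, R). (R, replicate (sig ! R) a)) ` (D \<times> nonnull sig)) \<union>
    (\<Union>e\<in>upairs D. atoms_on sig e)) \<inter> high_atoms sig D = {}"
  by (auto simp: nullary_world_def nonnull_def atoms_on_def upairs_def high_atoms_def)

lemma split_finite:
  "finite (nullary_world (nullary sig) :: 'a world)"
  "finite ((\<lambda>(a, R). (R, replicate (sig ! R) a)) ` (D \<times> nonnull sig))"
  "finite (\<Union>e\<in>upairs D. atoms_on sig e)"
  "finite (high_atoms sig D)"
  using D finite_ground_atoms[OF D, of sig]
  by (auto simp: nullary_world_def high_atoms_def finite_upairs upairs_def card_2_iff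
      intro!: finite_atoms_on)

lemma sum_worlds_split:
  "(\<Sum>\<omega>\<in>Pow (ground_atoms sig D). F \<omega>) =
    (\<Sum>Z\<in>Pow (nullary sig). \<Sum>\<tau>\<in>D \<rightarrow>\<^sub>E Pow (nonnull sig).
      \<Sum>\<omega>\<^sub>2\<in>Pow (\<Union>e\<in>upairs D. atoms_on sig e). \<Sum>\<omega>\<^sub>3\<in>Pow (high_atoms sig D).
        F (low_world sig Z D \<tau> \<union> \<omega>\<^sub>2 \<union> \<omega>\<^sub>3))"
proof -
  let ?h = "\<lambda>(a, R). (R, replicate (sig ! R) a)"
  define G0 where "G0 = (nullary_world (nullary sig) :: 'a world)"
  define G1 where "G1 = ?h ` (D \<times> nonnull sig)"
  define G2 where "G2 = (\<Union>e\<in>upairs D. atoms_on sig e)"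
  define G3 where "G3 = high_atoms sig D"
  note G = G0_def[symmetric] G1_def[symmetric] G2_def[symmetric] G3_def[symmetric]
  note fin = split_finite[unfolded G] and dis = split_disjoint[unfolded G]
  have "(\<Sum>\<omega>\<in>Pow (((G0 \<union> G1) \<union> G2) \<union> G3). F \<omega>) =
    (\<Sum>A\<in>Pow G0. \<Sum>B\<in>Pow G1. \<Sum>C\<in>Pow G2. \<Sum>E\<in>Pow G3. F (((A \<union> B) \<union> C) \<union> E))"
    using fin by (simp only: sum_Pow_Un[OF _ _ dis(3)] sum_Pow_Un[OF _ _ dis(2)]
        sum_Pow_Un[OF _ _ dis(1)] finite_Un simp_thms)
  also have "\<dots> = (\<Sum>Z\<in>Pow (nullary sig). \<Sum>\<tau>\<in>D \<rightarrow>\<^sub>E Pow (nonnull sig).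
    \<Sum>C\<in>Pow G2. \<Sum>E\<in>Pow G3. F (((nullary_world Z \<union> ?h ` Sigma D \<tau>) \<union> C) \<union> E))"
    unfolding G0_def G1_def nullary_world_def sum_Pow_image[OF inj_nullary]
      sum_Pow_image[OF inj_diag] sum_Pow_Times ..
  finally show ?thesis
    unfolding ground_atoms_split G low_world_def image_diag .
qed

lemma wt_split:
  assumes "Z \<subseteq> nullary sig" "\<tau> \<in> D \<rightarrow>\<^sub>E Pow (nonnull sig)"
    "\<omega>\<^sub>2 \<subseteq> (\<Union>e\<in>upairs D. atoms_on sig e)" "\<omega>\<^sub>3 \<subseteq> high_atoms sig D"
  shows "wt (\<lambda>\<alpha>. w (fst \<alpha>)) (\<lambda>\<alpha>. wb (fst \<alpha>)) (ground_atoms sig D) (low_world sig Z D \<tau> \<union> \<omega>\<^sub>2 \<union> \<omega>\<^sub>3) =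
    wt w wb (nullary sig) Z * (\<Prod>a\<in>D. wt w wb (nonnull sig) (\<tau> a)) *
    (\<Prod>e\<in>upairs D. wt (\<lambda>\<alpha>. w (fst \<alpha>)) (\<lambda>\<alpha>. wb (fst \<alpha>)) (atoms_on sig e) (\<omega>\<^sub>2 \<inter> atoms_on sig e)) *
    wt (\<lambda>\<alpha>. w (fst \<alpha>)) (\<lambda>\<alpha>. wb (fst \<alpha>)) (high_atoms sig D) \<omega>\<^sub>3"
proof -
  let ?f = "\<lambda>\<alpha> :: nat \<times> 'a list. w (fst \<alpha>)" and ?g = "\<lambda>\<alpha> :: nat \<times> 'a list. wb (fst \<alpha>)"
  let ?h = "\<lambda>(a, R). (R, replicate (sig ! R) a)"
  have sub0: "nullary_world Z \<subseteq> (nullary_world (nullary sig) :: 'a world)"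
    using assms(1) by (auto simp: nullary_world_def)
  have subD: "Sigma D \<tau> \<subseteq> D \<times> nonnull sig" using assms(2) by auto
  then have sub1: "?h ` Sigma D \<tau> \<subseteq> ?h ` (D \<times> nonnull sig)" by blast
  have 0: "wt ?f ?g (nullary_world (nullary sig)) (nullary_world Z) = wt w wb (nullary sig) Z"
    unfolding nullary_world_def by (subst wt_image[OF inj_nullary assms(1)]) simp
  have "wt ?f ?g (?h ` (D \<times> nonnull sig)) (?h ` Sigma D \<tau>) =
    wt (\<lambda>x. w (snd x)) (\<lambda>x. wb (snd x)) (D \<times> nonnull sig) (Sigma D \<tau>)"
    by (subst wt_image[OF inj_diag subD]) (simp add: case_prod_beta)
  also have "\<dots> = (\<Prod>a\<in>D. wt w wb (nonnull sig) (\<tau> a))"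
    unfolding wt_def prod.cartesian_product by (intro prod.cong) (auto split: if_splits)
  finally have 1: "wt ?f ?g (?h ` (D \<times> nonnull sig)) (?h ` Sigma D \<tau>) = \<dots>" .
  have 2: "wt ?f ?g (\<Union>e\<in>upairs D. atoms_on sig e) \<omega>\<^sub>2 =
    (\<Prod>e\<in>upairs D. wt ?f ?g (atoms_on sig e) (\<omega>\<^sub>2 \<inter> atoms_on sig e))"
    unfolding wt_Int using D
    by (intro wt_UN) (auto simp: finite_upairs upairs_def card_2_iff atoms_on_def intro!: finite_atoms_on[unfolded atoms_on_def])
  show ?thesis
    unfolding ground_atoms_split low_world_def image_diag[symmetric]
    by (simp only: wt_Un[OF finite_UnI[OF finite_UnI[OF split_finite(1,2)] split_finite(3)]
          split_finite(4) split_disjoint(3) Un_mono[OF Un_mono[OF sub0 sub1] assms(3)] assms(4)]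
        wt_Un[OF finite_UnI[OF split_finite(1,2)] split_finite(3) split_disjoint(2)
          Un_mono[OF sub0 sub1] assms(3)]
        wt_Un[OF split_finite(1,2) split_disjoint(1) sub0 sub1] 0 1 2)
qed

end

text \<open>The parts of a world supported on one or two elements are transported to the domains \<open>unit\<close> and
  \<open>bool\<close>, which makes their weights independent of the elements.\<close>

definition unit_world :: "nat list \<Rightarrow> nat set \<Rightarrow> nat set \<Rightarrow> unit world" where
  "unit_world sig Z \<tau> = nullary_world Z \<union> diag_world sig \<tau> ()"

definition bool_world :: "nat list \<Rightarrow> nat set \<Rightarrow> nat set \<Rightarrow> nat set \<Rightarrow> bool world \<Rightarrow> bool world" where
  "bool_world sig Z \<tau> \<tau>' \<beta> = nullary_world Z \<union> diag_world sig \<tau> False \<union> diag_world sig \<tau>' True \<union> \<beta>"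

text \<open>\<open>False\<close> stands for \<open>a\<close> and \<open>True\<close> for
  \<open>b\<close>; the condition on \<open>set bs\<close> keeps the atoms that mention
  both.\<close>

definition pull :: "'a \<Rightarrow> 'a \<Rightarrow> 'a world \<Rightarrow> bool world" where
  "pull a b \<omega> = {(R, bs). set bs = UNIV \<and> (R, map (\<lambda>x. if x then b else a) bs) \<in> \<omega>}"

lemma bool_set_cases:
  fixes A :: "bool set"
  obtains "A = {}" | "A = {False}" | "A = {True}" | "A = UNIV"
proof -
  have "A \<in> Pow {False, True}" by auto
  then have "A = {} \<or> A = {False} \<or> A = {True} \<or> A = {False, True}"
    by (auto simp: Pow_insert)
  then show thesis using that UNIV_bool by metis
qed

context
  fixes sig :: "nat list" and D :: "'a set" and Z :: "nat set" and \<tau> :: "'a \<Rightarrow> nat set"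
    and \<omega>\<^sub>2 \<omega>\<^sub>3 \<omega> :: "'a world"
  assumes Z: "Z \<subseteq> nullary sig" and \<tau>: "\<And>a. a \<in> D \<Longrightarrow> \<tau> a \<subseteq> nonnull sig"
    and \<omega>2: "\<omega>\<^sub>2 \<subseteq> (\<Union>e\<in>upairs D. atoms_on sig e)" and \<omega>3: "\<And>\<alpha>. \<alpha> \<in> \<omega>\<^sub>3 \<Longrightarrow> 3 \<le> card (set (snd \<alpha>))"
    and \<omega>: "\<omega> = low_world sig Z D \<tau> \<union> \<omega>\<^sub>2 \<union> \<omega>\<^sub>3"
begin

lemma mem_world_Nil: "(R, []) \<in> \<omega> \<longleftrightarrow> R \<in> Z"
proof -
  have "(R, []) \<notin> \<omega>\<^sub>2" using \<omega>2 by (auto simp: atoms_on_def upairs_def)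
  moreover have "(R, []) \<notin> \<omega>\<^sub>3" using \<omega>3[of "(R, [])"] by auto
  moreover have "(R, []) \<notin> diag_world sig (\<tau> a) a" if "a \<in> D" for a
    using \<tau>[OF that] by (auto simp: diag_world_def nonnull_def)
  ultimately show ?thesis by (auto simp: \<omega> low_world_def nullary_world_def)
qed

text \<open>The length \<open>m\<close> is arbitrary because \<open>lev_relabel\<close> asks about
  lists of every length; off the arity both sides are false.\<close>

lemma mem_world_replicate:
  assumes "a \<in> D" "0 < m"
  shows "(R, replicate m a) \<in> \<omega> \<longleftrightarrow> R \<in> \<tau> a \<and> m = sig ! R"
proof -
  have "(R, replicate m a) \<notin> \<omega>\<^sub>2" using \<omega>2 assms by (auto simp: atoms_on_def upairs_def)
  moreover have "(R, replicate m a) \<notin> \<omega>\<^sub>3" using \<omega>3[of "(R, replicate m a)"] assms by auto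
  moreover have "(R, replicate m a) \<in> diag_world sig (\<tau> b) b \<longleftrightarrow> b = a \<and> R \<in> \<tau> a \<and> m = sig ! R"
    for b
    using assms by (auto simp: diag_world_def replicate_eq_replicate)
  ultimately show ?thesis using assms by (auto simp: \<omega> low_world_def nullary_world_def)
qed

lemma mem_world_pair:
  assumes "a \<noteq> b" "set ts = {a, b}"
  shows "(R, ts) \<in> \<omega> \<longleftrightarrow> (R, ts) \<in> \<omega>\<^sub>2"
proof -
  have "(R, ts) \<notin> \<omega>\<^sub>3" using \<omega>3[of "(R, ts)"] assms by auto
  moreover have "(R, ts) \<notin> nullary_world Z" using assms by (auto simp: nullary_world_def)
  moreover have "(R, ts) \<notin> diag_world sig (\<tau> c) c" for c
  proof
    assume "(R, ts) \<in> diag_world sig (\<tau> c) c"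
    then have "set ts \<subseteq> {c}" by (auto simp: diag_world_def)
    then show False using assms by auto
  qed
  ultimately show ?thesis by (auto simp: \<omega> low_world_def)
qed

text \<open>A constant assignment reads only propositional atoms and atoms with all arguments equal
  to \<open>a\<close>, which are determined by \<open>Z\<close> and the 1-type.\<close>

lemma vfac_local:
  assumes "a \<in> D"
  shows "vfac \<Phi> B \<omega> a c s = vfac \<Phi> B (unit_world sig Z (\<tau> a)) () c s"
proof -
  have "(R, map (\<lambda>_. a) vs) \<in> \<omega> \<longleftrightarrow> (R, map (\<lambda>_. ()) vs) \<in> unit_world sig Z (\<tau> a)"
    for R and vs :: "var list"
  proof (cases vs)
    case Nil
    have "(R, []) \<notin> diag_world sig (\<tau> a) ()"
      using \<tau>[OF assms] by (auto simp: diag_world_def nonnull_def)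
    then show ?thesis using Nil mem_world_Nil by (auto simp: unit_world_def nullary_world_def)
  next
    case Cons
    then have "0 < length vs" by simp
    moreover have "(R, replicate (length vs) ()) \<in> unit_world sig Z (\<tau> a) \<longleftrightarrow>
      R \<in> \<tau> a \<and> length vs = sig ! R"
      using Cons by (auto simp: unit_world_def nullary_world_def diag_world_def
          simp del: replicate_Suc)
    ultimately show ?thesis
      using mem_world_replicate[OF assms] by (simp only: map_replicate_const)
  qed
  then have "lev \<omega> (\<lambda>_. a) cc f = lev (unit_world sig Z (\<tau> a)) (\<lambda>_. ()) cc f" for cc f
    using lev_relabel[of "\<lambda>_ :: unit. a" "\<lambda>_. ()" \<omega> "unit_world sig Z (\<tau> a)" cc f]
    by (simp add: inj_def)
  then show ?thesis unfolding vfac_def by simp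
qed

text \<open>Four kinds of argument lists over \<open>{a, b}\<close> occur: empty, constantly
  \<open>a\<close>, constantly \<open>b\<close>, or mentioning both. They are decided by
  \<open>Z\<close>, the two 1-types and \<open>\<omega>\<^sub>2\<close> respectively.\<close>

lemma efac_local:
  assumes "a \<in> D" "b \<in> D" "a \<noteq> b"
  shows "efac \<Phi> B \<omega> a b c s c' = efac \<Phi> B (bool_world sig Z (\<tau> a) (\<tau> b) (pull a b \<omega>\<^sub>2)) False True c s c'"
    and "efac \<Phi> B \<omega> b a c s c' = efac \<Phi> B (bool_world sig Z (\<tau> a) (\<tau> b) (pull a b \<omega>\<^sub>2)) True False c s c'"
proof -
  define \<pi> where "\<pi> = (\<lambda>x. if x then b else a)"
  define \<omega>' where "\<omega>' = bool_world sig Z (\<tau> a) (\<tau> b) (pull a b \<omega>\<^sub>2)"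
  have inj: "inj \<pi>" using assms(3) by (auto simp: inj_def \<pi>_def)
  have nn: "sig ! R > 0" if "R \<in> \<tau> a \<or> R \<in> \<tau> b" for R
    using that \<tau>[OF assms(1)] \<tau>[OF assms(2)] by (auto simp: nonnull_def)
  have mem: "(R, map \<pi> bs) \<in> \<omega> \<longleftrightarrow> (R, bs) \<in> \<omega>'" for R bs
  proof -
    consider "bs = []" | "set bs = {False}" | "set bs = {True}" | "set bs = UNIV"
      using bool_set_cases[of "set bs"] by auto
    then show ?thesis
    proof cases
      case 1
      have "(R, []) \<notin> diag_world sig (\<tau> a) x" "(R, []) \<notin> diag_world sig (\<tau> b) x" for x :: bool
        using nn[of R] by (auto simp: diag_world_def)
      moreover have "(R, []) \<notin> pull a b \<omega>\<^sub>2" by (simp add: pull_def)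
      ultimately have "(R, []) \<in> \<omega>' \<longleftrightarrow> R \<in> Z"
        unfolding \<omega>'_def bool_world_def by (simp add: nullary_world_def image_iff)
      then show ?thesis using 1 mem_world_Nil[of R] by simp
    next
      case 2
      define m where "m = length bs"
      have bs: "bs = replicate m False" "0 < m"
        using set_eq_singletonD[OF 2] by (auto simp: m_def)
      have "(R, replicate m False) \<notin> nullary_world Z" using bs(2) by (auto simp: nullary_world_def)
      moreover have "(R, replicate m False) \<notin> pull a b \<omega>\<^sub>2" using bs(2) by (auto simp: pull_def UNIV_bool)
      moreover have "(R, replicate m False) \<notin> diag_world sig (\<tau> b) True"
        using bs(2) by (auto simp: diag_world_def)
      moreover have "(R, replicate m False) \<in> diag_world sig (\<tau> a) False \<longleftrightarrow> R \<in> \<tau> a \<and> m = sig ! R"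
        by (auto simp: diag_world_def)
      ultimately have "(R, replicate m False) \<in> \<omega>' \<longleftrightarrow> R \<in> \<tau> a \<and> m = sig ! R"
        unfolding \<omega>'_def bool_world_def by simp
      then show ?thesis using mem_world_replicate[OF assms(1) bs(2)] unfolding bs(1)
        by (simp add: \<pi>_def map_replicate)
    next
      case 3
      define m where "m = length bs"
      have bs: "bs = replicate m True" "0 < m"
        using set_eq_singletonD[OF 3] by (auto simp: m_def)
      have "(R, replicate m True) \<notin> nullary_world Z" using bs(2) by (auto simp: nullary_world_def)
      moreover have "(R, replicate m True) \<notin> pull a b \<omega>\<^sub>2" using bs(2) by (auto simp: pull_def UNIV_bool)
      moreover have "(R, replicate m True) \<notin> diag_world sig (\<tau> a) False"
        using bs(2) by (auto simp: diag_world_def)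
      moreover have "(R, replicate m True) \<in> diag_world sig (\<tau> b) True \<longleftrightarrow> R \<in> \<tau> b \<and> m = sig ! R"
        by (auto simp: diag_world_def)
      ultimately have "(R, replicate m True) \<in> \<omega>' \<longleftrightarrow> R \<in> \<tau> b \<and> m = sig ! R"
        unfolding \<omega>'_def bool_world_def by simp
      then show ?thesis using mem_world_replicate[OF assms(2) bs(2)] unfolding bs(1)
        by (simp add: \<pi>_def map_replicate)
    next
      case 4
      have "set (map \<pi> bs) = {a, b}" using 4 by (auto simp: \<pi>_def UNIV_bool)
      moreover have "(R, bs) \<in> \<omega>' \<longleftrightarrow> (R, map \<pi> bs) \<in> \<omega>\<^sub>2"
      proof -
        have "(R, bs) \<notin> diag_world sig X x" for X x
        proof
          assume "(R, bs) \<in> diag_world sig X x"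
          then have "set bs \<subseteq> {x}" by (auto simp: diag_world_def)
          then show False using 4 by (auto simp: UNIV_bool)
        qed
        moreover have "(R, bs) \<notin> nullary_world Z" using 4 by (auto simp: nullary_world_def)
        ultimately show ?thesis using 4 by (auto simp: \<omega>'_def bool_world_def pull_def \<pi>_def)
      qed
      ultimately show ?thesis using mem_world_pair[OF assms(3)] by simp
    qed
  qed
  have lev: "lev \<omega> (\<lambda>u. \<pi> (\<beta> u)) cc f = lev \<omega>' \<beta> cc f" for \<beta> cc f
  proof (rule lev_relabel[OF inj])
    fix R and vs :: "var list"
    show "(R, map (\<lambda>u. \<pi> (\<beta> u)) vs) \<in> \<omega> \<longleftrightarrow> (R, map \<beta> vs) \<in> \<omega>'"
      using mem[of R "map \<beta> vs"] unfolding map_map o_def .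
  qed
  have asg: "asg v a b = (\<lambda>u. \<pi> (asg v False True u))" "asg v b a = (\<lambda>u. \<pi> (asg v True False u))" for v
    by (auto simp: asg_def \<pi>_def)
  show "efac \<Phi> B \<omega> a b c s c' = efac \<Phi> B (bool_world sig Z (\<tau> a) (\<tau> b) (pull a b \<omega>\<^sub>2)) False True c s c'"
    "efac \<Phi> B \<omega> b a c s c' = efac \<Phi> B (bool_world sig Z (\<tau> a) (\<tau> b) (pull a b \<omega>\<^sub>2)) True False c s c'"
    unfolding efac_def asg lev \<omega>'_def[symmetric] by simp_all
qed

end

section \<open>Labels (colour, exponents, 1-type) with their vertex and edge weights\<close>

type_synonym label = "cnt set \<times> (cnt \<Rightarrow> nat) \<times> nat set"

definition labels :: "nat list \<Rightarrow> fm \<Rightarrow> label set" where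
  "labels sig \<Phi> = Pow (cnts \<Phi>) \<times> exps \<Phi> \<times> Pow (nonnull sig)"

text \<open>The intersection yields a legitimate 1-type for every label, so that
  \<open>pair_wt_eq_edge_wt\<close> holds for arbitrary \<open>g\<close>, as
  \<open>fo2_eq_sum_labellings\<close> requires.\<close>

definition type_of :: "nat list \<Rightarrow> label \<Rightarrow> nat set" where
  "type_of sig l = snd (snd l) \<inter> nonnull sig"

definition vertex_wt where
  "vertex_wt sig \<Phi> B w wb Z l = wt w wb (nonnull sig) (type_of sig l) *
    vfac \<Phi> B (unit_world sig Z (type_of sig l)) () (fst l) (fst (snd l))"

definition edge_wt where
  "edge_wt sig \<Phi> B w wb Z l l' =
    (\<Sum>\<beta>\<in>Pow (atoms_on sig UNIV). wt (\<lambda>\<alpha>. w (fst \<alpha>)) (\<lambda>\<alpha>. wb (fst \<alpha>)) (atoms_on sig UNIV) \<beta> *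
      (efac \<Phi> B (bool_world sig Z (type_of sig l) (type_of sig l') \<beta>) False True
        (fst l) (fst (snd l)) (fst l') *
       efac \<Phi> B (bool_world sig Z (type_of sig l) (type_of sig l') \<beta>) True False
        (fst l') (fst (snd l')) (fst l)))"

text \<open>Defined on the unoriented pair; since both orders of its elements give the same value,
  no separate symmetry proof for \<open>edge_wt\<close> arises.\<close>

definition pair_wt :: "nat list \<Rightarrow> fm \<Rightarrow> int \<Rightarrow> (nat \<Rightarrow> int) \<Rightarrow> (nat \<Rightarrow> int) \<Rightarrow> nat set \<Rightarrow>
    ('a \<Rightarrow> label) \<Rightarrow> 'a set \<Rightarrow> int" where
  "pair_wt sig \<Phi> B w wb Z g e =
    (\<Sum>\<beta>\<in>Pow (atoms_on sig e). wt (\<lambda>\<alpha>. w (fst \<alpha>)) (\<lambda>\<alpha>. wb (fst \<alpha>)) (atoms_on sig e) \<beta> *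
      (\<Prod>p\<in>{p \<in> e \<times> e. fst p \<noteq> snd p}.
        efac \<Phi> B (low_world sig Z e (\<lambda>a. type_of sig (g a)) \<union> \<beta>) (fst p) (snd p)
          (fst (g (fst p))) (fst (snd (g (fst p)))) (fst (g (snd p)))))"

lemma atoms_on_pair:
  assumes "a \<noteq> b"
  shows "atoms_on sig {a, b} = (\<lambda>(R, bs). (R, map (\<lambda>x. if x then b else a) bs)) ` atoms_on sig UNIV"
    (is "_ = ?h ` _")
proof (rule Set.set_eqI, rule iffI)
  fix \<alpha> assume \<alpha>: "\<alpha> \<in> atoms_on sig {a, b}"
  obtain R ts where [simp]: "\<alpha> = (R, ts)" by (cases \<alpha>)
  have ts: "R < length sig" "length ts = sig ! R" "set ts = {a, b}"
    using \<alpha> by (auto simp: atoms_on_def)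
  define bs where "bs = map (\<lambda>t. t = b) ts"
  have "map (\<lambda>x. if x then b else a) bs = ts"
    unfolding bs_def map_map using ts(3) by (intro map_idI) auto
  moreover have "set bs = UNIV"
    using ts(3) assms unfolding bs_def UNIV_bool by auto
  ultimately show "\<alpha> \<in> ?h ` atoms_on sig UNIV"
    using ts by (intro image_eqI[of _ _ "(R, bs)"]) (auto simp: atoms_on_def bs_def)
next
  fix \<alpha> assume "\<alpha> \<in> ?h ` atoms_on sig UNIV"
  then obtain R bs where \<alpha>: "\<alpha> = (R, map (\<lambda>x. if x then b else a) bs)" and bs: "(R, bs) \<in> atoms_on sig UNIV"
    by auto
  have "set (map (\<lambda>x. if x then b else a) bs) = {a, b}"
    using bs by (simp add: atoms_on_def UNIV_bool insert_commute)
  then show "\<alpha> \<in> atoms_on sig {a, b}"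
    using bs by (simp add: \<alpha> atoms_on_def)
qed

lemma inj_map_bool:
  assumes "a \<noteq> b"
  shows "inj (\<lambda>(R :: nat, bs). (R, map (\<lambda>x. if x then b else a) bs))"
proof -
  have "inj (\<lambda>x. if x then b else a)" using assms by (auto simp: inj_def)
  then have "inj (map (\<lambda>x. if x then b else a))" by simp
  then show ?thesis by (auto simp: inj_def)
qed

lemma pull_image:
  assumes "a \<noteq> b" "X \<subseteq> atoms_on sig UNIV"
  shows "pull a b ((\<lambda>(R, bs). (R, map (\<lambda>x. if x then b else a) bs)) ` X) = X"
proof -
  have "(R, map (\<lambda>x. if x then b else a) bs) \<in> (\<lambda>(R, bs). (R, map (\<lambda>x. if x then b else a) bs)) ` X \<longleftrightarrow>
    (R, bs) \<in> X" for R bs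
    using inj_image_mem_iff[OF inj_map_bool[OF assms(1)], of "(R, bs)" X] by simp
  then show ?thesis using assms(2) by (auto simp: pull_def atoms_on_def)
qed

lemma upairs_pair: "a \<noteq> b \<Longrightarrow> upairs {a, b} = {{a, b}}"
  by (auto simp: upairs_mem)

lemma pair_wt_eq_edge_wt:
  assumes ab: "a \<noteq> b" and Z: "Z \<subseteq> nullary sig"
  shows "pair_wt sig \<Phi> B w wb Z g {a, b} = edge_wt sig \<Phi> B w wb Z (g a) (g b)"
proof -
  let ?h = "\<lambda>(R :: nat, bs). (R, map (\<lambda>x. if x then b else a) bs)"
  let ?\<tau> = "\<lambda>a. type_of sig (g a)"
  have inj: "inj_on ?h A" for A using inj_map_bool[OF ab] by (rule inj_on_subset) simp
  have od: "{p \<in> {a, b} \<times> {a, b}. fst p \<noteq> snd p} = {(a, b), (b, a)}" using ab by auto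
  have loc: "efac \<Phi> B (low_world sig Z {a, b} ?\<tau> \<union> ?h ` \<beta>) a b c s c' =
      efac \<Phi> B (bool_world sig Z (?\<tau> a) (?\<tau> b) \<beta>) False True c s c'"
    "efac \<Phi> B (low_world sig Z {a, b} ?\<tau> \<union> ?h ` \<beta>) b a c s c' =
      efac \<Phi> B (bool_world sig Z (?\<tau> a) (?\<tau> b) \<beta>) True False c s c'"
    if "\<beta> \<in> Pow (atoms_on sig UNIV)" for \<beta> c s c'
  proof -
    have sub: "?h ` \<beta> \<subseteq> (\<Union>e\<in>upairs {a, b}. atoms_on sig e)"
      unfolding upairs_pair[OF ab] using that by (auto simp: atoms_on_pair[OF ab])
    note L = efac_local[OF Z _ sub, where \<tau> = ?\<tau> and \<omega>\<^sub>3 = "{}" and a = a and b = b]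
    have pl: "pull a b (?h ` \<beta>) = \<beta>" using pull_image[OF ab] that by simp
    show "efac \<Phi> B (low_world sig Z {a, b} ?\<tau> \<union> ?h ` \<beta>) a b c s c' =
        efac \<Phi> B (bool_world sig Z (?\<tau> a) (?\<tau> b) \<beta>) False True c s c'"
      using L(1)[of _ \<Phi> B c s c'] ab unfolding pl by (simp add: type_of_def)
    show "efac \<Phi> B (low_world sig Z {a, b} ?\<tau> \<union> ?h ` \<beta>) b a c s c' =
        efac \<Phi> B (bool_world sig Z (?\<tau> a) (?\<tau> b) \<beta>) True False c s c'"
      using L(2)[of _ \<Phi> B c s c'] ab unfolding pl by (simp add: type_of_def)
  qed
  show ?thesis
    unfolding pair_wt_def edge_wt_def od atoms_on_pair[OF ab] sum_Pow_image[OF inj]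
  proof (rule sum.cong[OF refl])
    fix \<beta> assume \<beta>: "\<beta> \<in> Pow (atoms_on sig (UNIV :: bool set))"
    have "wt (\<lambda>\<alpha>. w (fst \<alpha>)) (\<lambda>\<alpha>. wb (fst \<alpha>)) (?h ` atoms_on sig UNIV) (?h ` \<beta>) =
      wt (\<lambda>\<alpha>. w (fst \<alpha>)) (\<lambda>\<alpha>. wb (fst \<alpha>)) (atoms_on sig UNIV) \<beta>"
      using \<beta> by (subst wt_image[OF inj]) (auto simp: case_prod_beta)
    then show "wt (\<lambda>\<alpha>. w (fst \<alpha>)) (\<lambda>\<alpha>. wb (fst \<alpha>)) (?h ` atoms_on sig UNIV) (?h ` \<beta>) *
      (\<Prod>p\<in>{(a, b), (b, a)}. efac \<Phi> B (low_world sig Z {a, b} ?\<tau> \<union> ?h ` \<beta>) (fst p) (snd p)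
          (fst (g (fst p))) (fst (snd (g (fst p)))) (fst (g (snd p)))) =
      wt (\<lambda>\<alpha>. w (fst \<alpha>)) (\<lambda>\<alpha>. wb (fst \<alpha>)) (atoms_on sig UNIV) \<beta> *
      (efac \<Phi> B (bool_world sig Z (?\<tau> a) (?\<tau> b) \<beta>) False True (fst (g a)) (fst (snd (g a))) (fst (g b)) *
       efac \<Phi> B (bool_world sig Z (?\<tau> a) (?\<tau> b) \<beta>) True False (fst (g b)) (fst (snd (g b))) (fst (g a)))"
      using ab by (simp add: loc[OF \<beta>])
  qed
qed

lemma low_world_cong: "(\<And>a. a \<in> e \<Longrightarrow> \<tau> a = \<tau>' a) \<Longrightarrow> low_world sig Z e \<tau> = low_world sig Z e \<tau>'"
  by (simp add: low_world_def)

lemma prod_factors_local: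
  assumes D: "finite D" and Z: "Z \<subseteq> nullary sig" and \<tau>: "\<tau> \<in> D \<rightarrow>\<^sub>E Pow (nonnull sig)"
    and \<omega>2: "\<omega>\<^sub>2 \<subseteq> (\<Union>e\<in>upairs D. atoms_on sig e)" and \<omega>3: "\<omega>\<^sub>3 \<subseteq> high_atoms sig D"
  shows "(\<Prod>a\<in>D. vfac \<Phi> B (low_world sig Z D \<tau> \<union> \<omega>\<^sub>2 \<union> \<omega>\<^sub>3) a (c a) (s a) *
      (\<Prod>b\<in>D - {a}. efac \<Phi> B (low_world sig Z D \<tau> \<union> \<omega>\<^sub>2 \<union> \<omega>\<^sub>3) a b (c a) (s a) (c b))) =
    (\<Prod>a\<in>D. vfac \<Phi> B (unit_world sig Z (\<tau> a)) () (c a) (s a)) *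
    (\<Prod>e\<in>upairs D. \<Prod>p\<in>{p \<in> e \<times> e. fst p \<noteq> snd p}.
      efac \<Phi> B (low_world sig Z e \<tau> \<union> (\<omega>\<^sub>2 \<inter> atoms_on sig e)) (fst p) (snd p)
        (c (fst p)) (s (fst p)) (c (snd p)))"
proof -
  define \<omega> where "\<omega> = low_world sig Z D \<tau> \<union> \<omega>\<^sub>2 \<union> \<omega>\<^sub>3"
  have t: "\<And>a. a \<in> D \<Longrightarrow> \<tau> a \<subseteq> nonnull sig" using \<tau> by auto
  have h: "\<And>\<alpha>. \<alpha> \<in> \<omega>\<^sub>3 \<Longrightarrow> 3 \<le> card (set (snd \<alpha>))" using \<omega>3 by (auto simp: high_atoms_def)
  have v: "vfac \<Phi> B \<omega> a (c a) (s a) = vfac \<Phi> B (unit_world sig Z (\<tau> a)) () (c a) (s a)" if "a \<in> D" for a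
    using vfac_local[OF Z t \<omega>2 h \<omega>_def that] .
  have e: "efac \<Phi> B \<omega> a b (c a) (s a) (c b) =
    efac \<Phi> B (low_world sig Z {a, b} \<tau> \<union> (\<omega>\<^sub>2 \<inter> atoms_on sig {a, b})) a b (c a) (s a) (c b)"
    if ab: "a \<in> D" "b \<in> D" "a \<noteq> b" for a b
  proof -
    have sub: "\<omega>\<^sub>2 \<inter> atoms_on sig {a, b} \<subseteq> (\<Union>e\<in>upairs {a, b}. atoms_on sig e)"
      unfolding upairs_pair[OF ab(3)] by auto
    have t': "\<And>x. x \<in> {a, b} \<Longrightarrow> \<tau> x \<subseteq> nonnull sig" using t ab by auto
    have pl: "pull a b (\<omega>\<^sub>2 \<inter> atoms_on sig {a, b}) = pull a b \<omega>\<^sub>2"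
    proof -
      have "(R, map (\<lambda>x. if x then b else a) bs) \<in> atoms_on sig {a, b}"
        if "set bs = UNIV" "(R, map (\<lambda>x. if x then b else a) bs) \<in> \<omega>\<^sub>2" for R bs
      proof -
        have "set (map (\<lambda>x. if x then b else a) bs) = {a, b}"
          using that(1) by (simp add: UNIV_bool insert_commute)
        moreover have "R < length sig" "length (map (\<lambda>x. if x then b else a) bs) = sig ! R"
          using that(2) \<omega>2 by (auto simp: atoms_on_def)
        ultimately show ?thesis by (simp only: atoms_on_def mem_Collect_eq prod.case simp_thms)
      qed
      then show ?thesis by (auto simp: pull_def)
    qed
    have "efac \<Phi> B \<omega> a b (c a) (s a) (c b) =
      efac \<Phi> B (bool_world sig Z (\<tau> a) (\<tau> b) (pull a b \<omega>\<^sub>2)) False True (c a) (s a) (c b)"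
      by (rule efac_local(1)[OF Z t \<omega>2 h \<omega>_def ab])
    \<comment> \<open>The same transport read backwards, now with domain \<open>{a, b}\<close> and
      no high atoms.\<close>
    also have "\<dots> = efac \<Phi> B (low_world sig Z {a, b} \<tau> \<union> (\<omega>\<^sub>2 \<inter> atoms_on sig {a, b}) \<union> {}) a b (c a) (s a) (c b)"
      using efac_local(1)[OF Z t' sub _ refl, where \<omega>\<^sub>3 = "{}" and a = a and b = b] ab(3)
      unfolding pl by simp
    finally show ?thesis by simp
  qed
  have "(\<Prod>a\<in>D. vfac \<Phi> B \<omega> a (c a) (s a) * (\<Prod>b\<in>D - {a}. efac \<Phi> B \<omega> a b (c a) (s a) (c b))) =
    (\<Prod>a\<in>D. vfac \<Phi> B (unit_world sig Z (\<tau> a)) () (c a) (s a)) *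
    (\<Prod>a\<in>D. \<Prod>b\<in>D - {a}. efac \<Phi> B (low_world sig Z {a, b} \<tau> \<union> (\<omega>\<^sub>2 \<inter> atoms_on sig {a, b})) a b
      (c a) (s a) (c b))"
    unfolding prod.distrib by (intro arg_cong2[where f = "(*)"] prod.cong refl v e) auto
  also have "(\<Prod>a\<in>D. \<Prod>b\<in>D - {a}. efac \<Phi> B (low_world sig Z {a, b} \<tau> \<union> (\<omega>\<^sub>2 \<inter> atoms_on sig {a, b})) a b
      (c a) (s a) (c b)) =
    (\<Prod>e\<in>upairs D. \<Prod>p\<in>{p \<in> e \<times> e. fst p \<noteq> snd p}.
      efac \<Phi> B (low_world sig Z {fst p, snd p} \<tau> \<union> (\<omega>\<^sub>2 \<inter> atoms_on sig {fst p, snd p})) (fst p) (snd p)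
        (c (fst p)) (s (fst p)) (c (snd p)))"
    by (rule prod_offdiag_upairs[OF D])
  also have "\<dots> = (\<Prod>e\<in>upairs D. \<Prod>p\<in>{p \<in> e \<times> e. fst p \<noteq> snd p}.
      efac \<Phi> B (low_world sig Z e \<tau> \<union> (\<omega>\<^sub>2 \<inter> atoms_on sig e)) (fst p) (snd p)
        (c (fst p)) (s (fst p)) (c (snd p)))"
  proof (intro prod.cong refl)
    fix e p assume "e \<in> upairs D" "p \<in> {p \<in> e \<times> e. fst p \<noteq> snd p}"
    then have "{fst p, snd p} = e" by (auto simp: upairs_mem)
    then show "efac \<Phi> B (low_world sig Z {fst p, snd p} \<tau> \<union> (\<omega>\<^sub>2 \<inter> atoms_on sig {fst p, snd p}))
        (fst p) (snd p) (c (fst p)) (s (fst p)) (c (snd p)) =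
      efac \<Phi> B (low_world sig Z e \<tau> \<union> (\<omega>\<^sub>2 \<inter> atoms_on sig e)) (fst p) (snd p)
        (c (fst p)) (s (fst p)) (c (snd p))" by simp
  qed
  finally show ?thesis unfolding \<omega>_def .
qed

text \<open>With 1-types, colours and exponents fixed, the atoms on each pair vary independently and
  sum up to pair weights, while high atoms touch no factor and are summed freely.\<close>

lemma sum_perturbed_eq:
  assumes D: "finite D"
  shows "(\<Sum>\<omega>\<in>Pow (ground_atoms sig D).
      wt (\<lambda>\<alpha>. w (fst \<alpha>)) (\<lambda>\<alpha>. wb (fst \<alpha>)) (ground_atoms sig D) \<omega> * perturbed \<Phi> B D \<omega>) =
    (\<Prod>\<alpha>\<in>high_atoms sig D. w (fst \<alpha>) + wb (fst \<alpha>)) *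
    (\<Sum>Z\<in>Pow (nullary sig). wt w wb (nullary sig) Z *
      (\<Sum>g\<in>D \<rightarrow>\<^sub>E labels sig \<Phi>. (\<Prod>a\<in>D. vertex_wt sig \<Phi> B w wb Z (g a)) *
        (\<Prod>e\<in>upairs D. pair_wt sig \<Phi> B w wb Z g e)))"
proof -
  let ?w = "\<lambda>\<alpha> :: nat \<times> 'a list. w (fst \<alpha>)" and ?wb = "\<lambda>\<alpha> :: nat \<times> 'a list. wb (fst \<alpha>)"
  define C where "C = D \<rightarrow>\<^sub>E Pow (cnts \<Phi>)"
  define S where "S = D \<rightarrow>\<^sub>E exps \<Phi>"
  define T where "T = D \<rightarrow>\<^sub>E Pow (nonnull sig)"
  define A2 where "A2 = (\<Union>e\<in>upairs D. atoms_on sig e)"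
  define A3 where "A3 = high_atoms sig D"
  define H where "H = (\<Prod>\<alpha>\<in>A3. ?w \<alpha> + ?wb \<alpha>)"
  define K where "K Z \<tau> c s = (\<Prod>a\<in>D. wt w wb (nonnull sig) (\<tau> a) *
    vfac \<Phi> B (unit_world sig Z (\<tau> a)) () (c a) (s a))" for Z \<tau> c s
  define f where "f Z \<tau> c s e \<beta> = wt ?w ?wb (atoms_on sig e) \<beta> *
    (\<Prod>p\<in>{p \<in> e \<times> e. fst p \<noteq> snd p}. efac \<Phi> B (low_world sig Z e \<tau> \<union> \<beta>) (fst p) (snd p)
        (c (fst p)) (s (fst p)) (c (snd p)))" for Z \<tau> c s e \<beta>
  have finA: "finite (upairs D)" "\<And>e. e \<in> upairs D \<Longrightarrow> finite (atoms_on sig e)"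
    using D by (auto simp: finite_upairs upairs_mem intro!: finite_atoms_on)
  have fin3: "finite A3" unfolding A3_def by (rule split_finite[OF D])
  have summand: "wt ?w ?wb (ground_atoms sig D) (low_world sig Z D \<tau> \<union> \<omega>\<^sub>2 \<union> \<omega>\<^sub>3) *
      perturbed \<Phi> B D (low_world sig Z D \<tau> \<union> \<omega>\<^sub>2 \<union> \<omega>\<^sub>3) =
    wt w wb (nullary sig) Z * (\<Sum>c\<in>C. \<Sum>s\<in>S. K Z \<tau> c s * (\<Prod>e\<in>upairs D. f Z \<tau> c s e (\<omega>\<^sub>2 \<inter> atoms_on sig e))) *
    wt ?w ?wb A3 \<omega>\<^sub>3"
    if Z: "Z \<in> Pow (nullary sig)" and \<tau>: "\<tau> \<in> T" and \<omega>2: "\<omega>\<^sub>2 \<in> Pow A2" and \<omega>3: "\<omega>\<^sub>3 \<in> Pow A3"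
    for Z \<tau> \<omega>\<^sub>2 \<omega>\<^sub>3
  proof -
    note hyps = Z[unfolded Pow_iff] \<tau>[unfolded T_def] \<omega>2[unfolded A2_def Pow_iff] \<omega>3[unfolded A3_def Pow_iff]
    define x where "x = wt w wb (nullary sig) Z"
    define y where "y = wt ?w ?wb A3 \<omega>\<^sub>3"
    define P where "P = (\<Prod>a\<in>D. wt w wb (nonnull sig) (\<tau> a))"
    define E where "E = (\<Prod>e\<in>upairs D. wt ?w ?wb (atoms_on sig e) (\<omega>\<^sub>2 \<inter> atoms_on sig e))"
    have 1: "wt ?w ?wb (ground_atoms sig D) (low_world sig Z D \<tau> \<union> \<omega>\<^sub>2 \<union> \<omega>\<^sub>3) = x * P * E * y"
      unfolding x_def y_def P_def E_def A3_def by (rule wt_split[OF D hyps])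
    have 2: "perturbed \<Phi> B D (low_world sig Z D \<tau> \<union> \<omega>\<^sub>2 \<union> \<omega>\<^sub>3) = (\<Sum>c\<in>C. \<Sum>s\<in>S.
      (\<Prod>a\<in>D. vfac \<Phi> B (unit_world sig Z (\<tau> a)) () (c a) (s a)) *
      (\<Prod>e\<in>upairs D. \<Prod>p\<in>{p \<in> e \<times> e. fst p \<noteq> snd p}.
        efac \<Phi> B (low_world sig Z e \<tau> \<union> (\<omega>\<^sub>2 \<inter> atoms_on sig e)) (fst p) (snd p)
          (c (fst p)) (s (fst p)) (c (snd p))))"
      unfolding perturbed_def C_def S_def prod_factors_local[OF D hyps] ..
    have 3: "P * E * ((\<Prod>a\<in>D. vfac \<Phi> B (unit_world sig Z (\<tau> a)) () (c a) (s a)) *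
      (\<Prod>e\<in>upairs D. \<Prod>p\<in>{p \<in> e \<times> e. fst p \<noteq> snd p}.
        efac \<Phi> B (low_world sig Z e \<tau> \<union> (\<omega>\<^sub>2 \<inter> atoms_on sig e)) (fst p) (snd p)
          (c (fst p)) (s (fst p)) (c (snd p)))) =
      K Z \<tau> c s * (\<Prod>e\<in>upairs D. f Z \<tau> c s e (\<omega>\<^sub>2 \<inter> atoms_on sig e))" for c s
      unfolding P_def E_def K_def f_def prod.distrib by (simp only: ac_simps)
    have "x * P * E * y * perturbed \<Phi> B D (low_world sig Z D \<tau> \<union> \<omega>\<^sub>2 \<union> \<omega>\<^sub>3) =
      x * (P * E * perturbed \<Phi> B D (low_world sig Z D \<tau> \<union> \<omega>\<^sub>2 \<union> \<omega>\<^sub>3)) * y"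
      by (simp only: ac_simps)
    then show ?thesis
      unfolding 1 x_def[symmetric] y_def[symmetric] unfolding 2 sum_distrib_left[of "P * E"] 3 .
  qed
  have inner: "(\<Sum>\<omega>\<^sub>2\<in>Pow A2. \<Sum>\<omega>\<^sub>3\<in>Pow A3. wt w wb (nullary sig) Z *
      (\<Sum>c\<in>C. \<Sum>s\<in>S. K Z \<tau> c s * (\<Prod>e\<in>upairs D. f Z \<tau> c s e (\<omega>\<^sub>2 \<inter> atoms_on sig e))) * wt ?w ?wb A3 \<omega>\<^sub>3) =
    H * (wt w wb (nullary sig) Z *
      (\<Sum>c\<in>C. \<Sum>s\<in>S. K Z \<tau> c s * (\<Prod>e\<in>upairs D. \<Sum>\<beta>\<in>Pow (atoms_on sig e). f Z \<tau> c s e \<beta>)))" for Z \<tau>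
  proof -
    have "(\<Sum>\<omega>\<^sub>2\<in>Pow A2. \<Sum>c\<in>C. \<Sum>s\<in>S. K Z \<tau> c s * (\<Prod>e\<in>upairs D. f Z \<tau> c s e (\<omega>\<^sub>2 \<inter> atoms_on sig e))) =
      (\<Sum>c\<in>C. \<Sum>\<omega>\<^sub>2\<in>Pow A2. \<Sum>s\<in>S. K Z \<tau> c s * (\<Prod>e\<in>upairs D. f Z \<tau> c s e (\<omega>\<^sub>2 \<inter> atoms_on sig e)))"
      by (rule sum.swap)
    also have "\<dots> = (\<Sum>c\<in>C. \<Sum>s\<in>S. \<Sum>\<omega>\<^sub>2\<in>Pow A2. K Z \<tau> c s * (\<Prod>e\<in>upairs D. f Z \<tau> c s e (\<omega>\<^sub>2 \<inter> atoms_on sig e)))"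
      by (rule sum.cong[OF refl], rule sum.swap)
    also have "\<dots> = (\<Sum>c\<in>C. \<Sum>s\<in>S. K Z \<tau> c s * (\<Prod>e\<in>upairs D. \<Sum>\<beta>\<in>Pow (atoms_on sig e). f Z \<tau> c s e \<beta>))"
    proof (intro sum.cong refl)
      fix c s
      have "(\<Sum>\<omega>\<^sub>2\<in>Pow A2. \<Prod>e\<in>upairs D. f Z \<tau> c s e (\<omega>\<^sub>2 \<inter> atoms_on sig e)) =
        (\<Prod>e\<in>upairs D. \<Sum>\<beta>\<in>Pow (atoms_on sig e). f Z \<tau> c s e \<beta>)"
        unfolding A2_def by (rule sum_Pow_UN[OF finA]) (auto simp: atoms_on_def)
      then show "(\<Sum>\<omega>\<^sub>2\<in>Pow A2. K Z \<tau> c s * (\<Prod>e\<in>upairs D. f Z \<tau> c s e (\<omega>\<^sub>2 \<inter> atoms_on sig e))) =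
        K Z \<tau> c s * (\<Prod>e\<in>upairs D. \<Sum>\<beta>\<in>Pow (atoms_on sig e). f Z \<tau> c s e \<beta>)"
        unfolding sum_distrib_left[symmetric] by simp
    qed
    finally have e: "(\<Sum>\<omega>\<^sub>2\<in>Pow A2. \<Sum>c\<in>C. \<Sum>s\<in>S. K Z \<tau> c s * (\<Prod>e\<in>upairs D. f Z \<tau> c s e (\<omega>\<^sub>2 \<inter> atoms_on sig e))) = \<dots>" .
    have h: "(\<Sum>\<omega>\<^sub>3\<in>Pow A3. wt ?w ?wb A3 \<omega>\<^sub>3) = H" unfolding H_def by (rule sum_wt[OF fin3])
    show ?thesis
      unfolding sum_distrib_left[symmetric] h sum_distrib_right[symmetric] e by (simp only: ac_simps)
  qed
  \<comment> \<open>Three independent functions on \<open>D\<close> are bundled into one function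
    into triples.\<close>
  have relabel: "(\<Sum>\<tau>\<in>T. \<Sum>c\<in>C. \<Sum>s\<in>S. K Z \<tau> c s * (\<Prod>e\<in>upairs D. \<Sum>\<beta>\<in>Pow (atoms_on sig e). f Z \<tau> c s e \<beta>)) =
    (\<Sum>g\<in>D \<rightarrow>\<^sub>E labels sig \<Phi>. (\<Prod>a\<in>D. vertex_wt sig \<Phi> B w wb Z (g a)) *
        (\<Prod>e\<in>upairs D. pair_wt sig \<Phi> B w wb Z g e))" for Z
  proof -
    have eq: "(\<Prod>a\<in>D. vertex_wt sig \<Phi> B w wb Z (g a)) * (\<Prod>e\<in>upairs D. pair_wt sig \<Phi> B w wb Z g e) =
      K Z \<tau> c s * (\<Prod>e\<in>upairs D. \<Sum>\<beta>\<in>Pow (atoms_on sig e). f Z \<tau> c s e \<beta>)"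
      if g: "g = (\<lambda>a\<in>D. (c a, (\<lambda>a\<in>D. (s a, \<tau> a)) a))" and \<tau>: "\<tau> \<in> T" for g c s \<tau>
    proof -
      have ga: "g a = (c a, s a, \<tau> a)" "type_of sig (g a) = \<tau> a" if "a \<in> D" for a
        using that \<tau> by (auto simp: g T_def type_of_def)
      have "vertex_wt sig \<Phi> B w wb Z (g a) = wt w wb (nonnull sig) (\<tau> a) *
        vfac \<Phi> B (unit_world sig Z (\<tau> a)) () (c a) (s a)" if "a \<in> D" for a
        using ga[OF that] by (simp add: vertex_wt_def)
      moreover have "pair_wt sig \<Phi> B w wb Z g e = (\<Sum>\<beta>\<in>Pow (atoms_on sig e). f Z \<tau> c s e \<beta>)"
        if e: "e \<in> upairs D" for e
      proof -
        have sub: "e \<subseteq> D" using e by (auto simp: upairs_def)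
        have lw: "low_world sig Z e (\<lambda>a. type_of sig (g a)) = low_world sig Z e \<tau>"
          using sub ga by (intro low_world_cong) auto
        show ?thesis
          unfolding pair_wt_def f_def lw
        proof (intro sum.cong refl arg_cong2[where f = "(*)"] prod.cong)
          fix \<beta> p assume "p \<in> {p \<in> e \<times> e. fst p \<noteq> snd p}"
          then have "fst p \<in> D" "snd p \<in> D" using sub by auto
          then show "efac \<Phi> B (low_world sig Z e \<tau> \<union> \<beta>) (fst p) (snd p)
              (fst (g (fst p))) (fst (snd (g (fst p)))) (fst (g (snd p))) =
            efac \<Phi> B (low_world sig Z e \<tau> \<union> \<beta>) (fst p) (snd p) (c (fst p)) (s (fst p)) (c (snd p))"
            by (simp add: ga)
        qed
      qed
      ultimately show ?thesis unfolding K_def by simp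
    qed
    have "(\<Sum>g\<in>D \<rightarrow>\<^sub>E labels sig \<Phi>. (\<Prod>a\<in>D. vertex_wt sig \<Phi> B w wb Z (g a)) *
        (\<Prod>e\<in>upairs D. pair_wt sig \<Phi> B w wb Z g e)) =
      (\<Sum>c\<in>C. \<Sum>s\<in>S. \<Sum>\<tau>\<in>T. K Z \<tau> c s * (\<Prod>e\<in>upairs D. \<Sum>\<beta>\<in>Pow (atoms_on sig e). f Z \<tau> c s e \<beta>))"
      unfolding labels_def sum_PiE_Times C_def[symmetric] S_def[symmetric] T_def[symmetric]
      by (intro sum.cong refl eq)
    also have "\<dots> = (\<Sum>c\<in>C. \<Sum>\<tau>\<in>T. \<Sum>s\<in>S. K Z \<tau> c s * (\<Prod>e\<in>upairs D. \<Sum>\<beta>\<in>Pow (atoms_on sig e). f Z \<tau> c s e \<beta>))"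
      by (rule sum.cong[OF refl], rule sum.swap)
    also have "\<dots> = (\<Sum>\<tau>\<in>T. \<Sum>c\<in>C. \<Sum>s\<in>S. K Z \<tau> c s * (\<Prod>e\<in>upairs D. \<Sum>\<beta>\<in>Pow (atoms_on sig e). f Z \<tau> c s e \<beta>))"
      by (rule sum.swap)
    finally show ?thesis by simp
  qed
  have "(\<Sum>\<omega>\<in>Pow (ground_atoms sig D). wt ?w ?wb (ground_atoms sig D) \<omega> * perturbed \<Phi> B D \<omega>) =
    (\<Sum>Z\<in>Pow (nullary sig). \<Sum>\<tau>\<in>T. \<Sum>\<omega>\<^sub>2\<in>Pow A2. \<Sum>\<omega>\<^sub>3\<in>Pow A3. wt w wb (nullary sig) Z *
      (\<Sum>c\<in>C. \<Sum>s\<in>S. K Z \<tau> c s * (\<Prod>e\<in>upairs D. f Z \<tau> c s e (\<omega>\<^sub>2 \<inter> atoms_on sig e))) * wt ?w ?wb A3 \<omega>\<^sub>3)"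
    unfolding sum_worlds_split[OF D] T_def[symmetric] A2_def[symmetric] A3_def[symmetric]
    by (intro sum.cong refl summand)
  also have "\<dots> = H * (\<Sum>Z\<in>Pow (nullary sig). wt w wb (nullary sig) Z *
    (\<Sum>\<tau>\<in>T. \<Sum>c\<in>C. \<Sum>s\<in>S. K Z \<tau> c s * (\<Prod>e\<in>upairs D. \<Sum>\<beta>\<in>Pow (atoms_on sig e). f Z \<tau> c s e \<beta>)))"
    unfolding inner unfolding sum_distrib_left[symmetric] ..
  finally show ?thesis unfolding relabel H_def A3_def .
qed

section \<open>The integer count and its extraction\<close>

definition icount :: "nat list \<Rightarrow> fm \<Rightarrow> (nat \<Rightarrow> int) \<Rightarrow> (nat \<Rightarrow> int) \<Rightarrow> 'a set \<Rightarrow> int" where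
  "icount sig \<Phi> w wb D = (\<Sum>\<omega>\<in>Pow (ground_atoms sig D).
    wt (\<lambda>\<alpha>. w (fst \<alpha>)) (\<lambda>\<alpha>. wb (fst \<alpha>)) (ground_atoms sig D) \<omega> * of_bool (models D \<omega> \<Phi>))"

text \<open>Squares dominate absolute values of integers and are directly definable.\<close>

definition ibound :: "nat list \<Rightarrow> (nat \<Rightarrow> int) \<Rightarrow> (nat \<Rightarrow> int) \<Rightarrow> nat \<Rightarrow> int" where
  "ibound sig w wb n = (\<Prod>R<length sig. (w R ^ 2 + wb R ^ 2 + 1) ^ (n ^ (sig ! R)))"

lemma prod_ground_atoms:
  assumes "finite D"
  shows "(\<Prod>\<alpha>\<in>ground_atoms sig D. f \<alpha>) =
    (\<Prod>R<length sig. \<Prod>ts\<in>{ts. set ts \<subseteq> D \<and> length ts = sig ! R}. f (R, ts))"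
proof -
  have "ground_atoms sig D = (SIGMA R:{..<length sig}. {ts. set ts \<subseteq> D \<and> length ts = sig ! R})"
    by (auto simp: ground_atoms_def)
  then show ?thesis
    using assms by (simp add: prod.Sigma finite_lists_length_eq)
qed

lemma abs_wt: "\<bar>wt f g A X\<bar> = wt (\<lambda>x. \<bar>f x\<bar>) (\<lambda>x. \<bar>g x\<bar>) A X"
  unfolding wt_def by (induction A rule: infinite_finite_induct) (auto simp: abs_mult)

lemma abs_icount_le:
  assumes D: "finite D"
  shows "\<bar>icount sig \<Phi> w wb D\<bar> \<le> ibound sig w wb (card D)"
proof -
  let ?G = "ground_atoms sig D"
  have "\<bar>icount sig \<Phi> w wb D\<bar> \<le> (\<Sum>\<omega>\<in>Pow ?G.
    \<bar>wt (\<lambda>\<alpha>. w (fst \<alpha>)) (\<lambda>\<alpha>. wb (fst \<alpha>)) ?G \<omega> * of_bool (models D \<omega> \<Phi>)\<bar>)"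
    unfolding icount_def by (rule sum_abs)
  also have "\<dots> \<le> (\<Sum>\<omega>\<in>Pow ?G. wt (\<lambda>\<alpha>. \<bar>w (fst \<alpha>)\<bar>) (\<lambda>\<alpha>. \<bar>wb (fst \<alpha>)\<bar>) ?G \<omega>)"
  proof (rule sum_mono)
    fix \<omega>
    show "\<bar>wt (\<lambda>\<alpha>. w (fst \<alpha>)) (\<lambda>\<alpha>. wb (fst \<alpha>)) ?G \<omega> * of_bool (models D \<omega> \<Phi>)\<bar> \<le>
      wt (\<lambda>\<alpha>. \<bar>w (fst \<alpha>)\<bar>) (\<lambda>\<alpha>. \<bar>wb (fst \<alpha>)\<bar>) ?G \<omega>"
      unfolding abs_wt[symmetric] abs_mult by simp
  qed
  also have "\<dots> = (\<Prod>\<alpha>\<in>?G. \<bar>w (fst \<alpha>)\<bar> + \<bar>wb (fst \<alpha>)\<bar>)"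
    by (rule sum_wt[OF finite_ground_atoms[OF D]])
  also have "\<dots> \<le> (\<Prod>\<alpha>\<in>?G. w (fst \<alpha>) ^ 2 + wb (fst \<alpha>) ^ 2 + 1)"
  proof (rule prod_mono, rule conjI)
    have sq: "\<bar>x\<bar> \<le> x ^ 2" for x :: int
    proof (cases "x = 0")
      case False
      then have "\<bar>x\<bar> * 1 \<le> \<bar>x\<bar> * \<bar>x\<bar>" by (intro mult_left_mono) auto
      then show ?thesis by (simp add: power2_eq_square)
    qed simp
    fix \<alpha>
    show "\<bar>w (fst \<alpha>)\<bar> + \<bar>wb (fst \<alpha>)\<bar> \<le> w (fst \<alpha>) ^ 2 + wb (fst \<alpha>) ^ 2 + 1"
      using sq[of "w (fst \<alpha>)"] sq[of "wb (fst \<alpha>)"] by linarith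
  qed simp
  also have "\<dots> = ibound sig w wb (card D)"
    unfolding prod_ground_atoms[OF D] ibound_def using D by (simp add: card_lists_length_eq)
  finally show ?thesis .
qed

text \<open>All tuples minus those with at most two distinct entries; the number of tuples per pair
  is a constant depending only on \<open>m\<close>.\<close>

definition high_count :: "nat \<Rightarrow> nat \<Rightarrow> nat" where
  "high_count m n = n ^ m - (of_bool (m = 0) + of_bool (m > 0) * n +
    (n choose 2) * card {bs :: bool list. length bs = m \<and> set bs = UNIV})"

text \<open>The second claim makes the natural subtraction in \<open>high_count\<close> exact, so
  that it can be carried out in the integers.\<close>

lemma card_high:
  assumes D: "finite D"
  shows "card {ts. set ts \<subseteq> D \<and> length ts = m \<and> 3 \<le> card (set ts)} = high_count m (card D)"
    and "of_bool (m = 0) + of_bool (m > 0) * card D +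
      (card D choose 2) * card {bs :: bool list. length bs = m \<and> set bs = UNIV} \<le> card D ^ m"
proof -
  define A where "A = {ts. set ts \<subseteq> D \<and> length ts = m}"
  define A0 where "A0 = {ts. ts = ([] :: 'a list) \<and> m = 0}"
  define A1 where "A1 = (\<lambda>a. replicate m a) ` {a \<in> D. m > 0}"
  define A2 where "A2 = (\<Union>e\<in>upairs D. {ts. length ts = m \<and> set ts = e})"
  define A3 where "A3 = {ts. set ts \<subseteq> D \<and> length ts = m \<and> 3 \<le> card (set ts)}"
  have finA: "finite A" unfolding A_def using D by (rule finite_lists_length_eq)
  have sub: "A0 \<union> A1 \<union> A2 \<subseteq> A" "A3 \<subseteq> A"
    by (auto simp: A_def A0_def A1_def A2_def A3_def upairs_def)
  have cover: "A = (A0 \<union> A1 \<union> A2) \<union> A3"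
  proof (rule Set.set_eqI, rule iffI)
    fix ts assume ts: "ts \<in> A"
    consider "card (set ts) = 0" | "card (set ts) = 1" | "card (set ts) = 2" | "3 \<le> card (set ts)"
      by linarith
    then show "ts \<in> (A0 \<union> A1 \<union> A2) \<union> A3"
    proof cases
      case 1
      then show ?thesis using ts by (simp add: A_def A0_def)
    next
      case 2
      then obtain a where a: "set ts = {a}" by (auto simp: card_1_singleton_iff)
      then have "ts = replicate m a" "m > 0" "a \<in> D"
        using set_eq_singletonD[OF a] ts by (auto simp: A_def)
      then show ?thesis by (auto simp: A1_def)
    next
      case 3
      then show ?thesis using ts by (auto simp: A_def A2_def upairs_def)
    next
      case 4
      then show ?thesis using ts by (auto simp: A_def A3_def)
    qed
  qed (use sub in auto)
  have fin: "finite A0" "finite A1" "finite A2" "finite A3"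
    using sub finA finite_subset by (metis Un_subset_iff)+
  have k: "ts \<in> A0 \<Longrightarrow> card (set ts) = 0" "ts \<in> A1 \<Longrightarrow> card (set ts) = 1"
    "ts \<in> A2 \<Longrightarrow> card (set ts) = 2" "ts \<in> A3 \<Longrightarrow> card (set ts) \<ge> 3" for ts
    by (auto simp: A0_def A1_def A2_def A3_def upairs_def)
  have d1: "A0 \<inter> A1 = {}" using k(1,2) by fastforce
  have d2: "(A0 \<union> A1) \<inter> A2 = {}" using k(1-3) by fastforce
  have d3: "(A0 \<union> A1 \<union> A2) \<inter> A3 = {}" using k by fastforce
  have c0: "card A0 = of_bool (m = 0)" by (auto simp: A0_def)
  have c1: "card A1 = of_bool (m > 0) * card D"
  proof -
    have "card A1 = card {a \<in> D. m > 0}"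
      unfolding A1_def by (rule card_image) (auto simp: inj_on_def replicate_eq_replicate)
    then show ?thesis by (cases "m > 0") auto
  qed
  have c2: "card A2 = (card D choose 2) * card {bs :: bool list. length bs = m \<and> set bs = UNIV}"
  proof -
    have pair: "card {ts. length ts = m \<and> set ts = e} = card {bs :: bool list. length bs = m \<and> set bs = UNIV}"
      if "e \<in> upairs D" for e
    proof -
      obtain a b where e: "a \<noteq> b" "e = {a, b}" using \<open>e \<in> upairs D\<close> by (auto simp: upairs_mem)
      \<comment> \<open>A signature with one predicate of arity \<open>m\<close> turns tuples into
        atoms, so that \<open>atoms_on_pair\<close> applies.\<close>
      have im: "snd ` atoms_on [m] {a, b} = {ts. length ts = m \<and> set ts = e}"
        by (auto simp: atoms_on_def e image_def)
      have im': "snd ` atoms_on [m] UNIV = {bs :: bool list. length bs = m \<and> set bs = UNIV}"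
        by (auto simp: atoms_on_def image_def)
      have i: "inj_on snd (atoms_on [m] E)" for E :: "'z set" by (auto simp: inj_on_def atoms_on_def)
      have "card (atoms_on [m] {a, b}) = card (atoms_on [m] (UNIV :: bool set))"
        unfolding atoms_on_pair[OF e(1)]
        by (rule card_image, rule inj_on_subset[OF inj_map_bool[OF e(1)]]) simp
      then show ?thesis using card_image[OF i] im im' by metis
    qed
    have "card A2 = (\<Sum>e\<in>upairs D. card {ts. length ts = m \<and> set ts = e})"
      unfolding A2_def
    proof (rule card_UN_disjoint)
      show "\<forall>e\<in>upairs D. finite {ts. length ts = m \<and> set ts = e}"
      proof
        fix e assume "e \<in> upairs D"
        then have "{ts. length ts = m \<and> set ts = e} \<subseteq> A" by (auto simp: A_def upairs_def)
        then show "finite {ts. length ts = m \<and> set ts = e}" using finA finite_subset by blast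
      qed
    qed (use finite_upairs[OF D] in auto)
    then show ?thesis using pair card_upairs[OF D] by simp
  qed
  have "card A = card A0 + card A1 + card A2 + card A3"
    unfolding cover using fin d1 d2 d3 by (simp add: card_Un_disjoint)
  moreover have "card A = card D ^ m" unfolding A_def using D by (rule card_lists_length_eq)
  ultimately show "card {ts. set ts \<subseteq> D \<and> length ts = m \<and> 3 \<le> card (set ts)} = high_count m (card D)"
    and "of_bool (m = 0) + of_bool (m > 0) * card D +
      (card D choose 2) * card {bs :: bool list. length bs = m \<and> set bs = UNIV} \<le> card D ^ m"
    unfolding high_count_def A3_def[symmetric] c0 c1 c2 by linarith+
qed

lemma prod_high_atoms:
  fixes f :: "nat \<Rightarrow> int" and D :: "'a set"
  assumes D: "finite D"
  shows "(\<Prod>\<alpha>\<in>high_atoms sig D. f (fst \<alpha>)) = (\<Prod>R<length sig. f R ^ high_count (sig ! R) (card D))"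
proof -
  have "high_atoms sig D = (SIGMA R:{..<length sig}.
    {ts. set ts \<subseteq> D \<and> length ts = sig ! R \<and> 3 \<le> card (set ts)})"
    by (auto simp: high_atoms_def ground_atoms_def)
  moreover have "finite {ts. set ts \<subseteq> D \<and> length ts = m \<and> 3 \<le> card (set ts)}" for m
    using finite_lists_length_eq[OF D, of m] by (rule rev_finite_subset) auto
  moreover have "(\<Prod>\<alpha>\<in>Sigma {..<length sig} T. f (fst \<alpha>)) = (\<Prod>R<length sig. \<Prod>ts\<in>T R. f R)"
    if "\<And>R. finite (T R)" for T :: "nat \<Rightarrow> 'a list set"
    using that prod.Sigma[of "{..<length sig}" T "\<lambda>R ts. f R"] by (simp add: case_prod_beta)
  ultimately show ?thesis
    using card_high(1)[OF D] by simp
qed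

text \<open>Modulo \<open>2 * b + 1\<close> the numbers from \<open>-b\<close> to \<open>b\<close>
  are distinct; shifting by \<open>b\<close> makes them ordinary remainders. The remainder is
  spelled out with \<open>div\<close>, the only form available to expressions.\<close>

lemma icount_extract:
  fixes V Z b M z :: int
  assumes "\<bar>Z\<bar> \<le> b" "M > 0" "V = M * (Z + (2 * b + 1) * z)"
  shows "Z = (V div M + b) - (2 * b + 1) * ((V div M + b) div (2 * b + 1)) - b"
proof -
  have "V div M = Z + (2 * b + 1) * z" using assms by simp
  then have "(V div M + b) mod (2 * b + 1) = (Z + b + (2 * b + 1) * z) mod (2 * b + 1)"
    by (simp add: algebra_simps)
  also have "\<dots> = (Z + b) mod (2 * b + 1)" by (rule mod_mult_self2)
  also have "\<dots> = Z + b" using assms(1) by (intro mod_pos_pos_trivial) auto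
  finally show ?thesis by (simp add: minus_mult_div_eq_mod)
qed

lemma icount_eq_fo2:
  assumes D: "finite D" "D \<noteq> {}" and \<Phi>: "sentence \<Phi>"
    and us: "set us = labels sig \<Phi>" "distinct us"
    and N: "card D < N" "card D choose 2 \<le> N"
    and b: "b = ibound sig w wb (card D)" and B: "B = 2 * b + 1"
    and M: "M = B ^ scale_exp \<Phi> (card D)"
    and V: "V = (\<Prod>R<length sig. (w R + wb R) ^ high_count (sig ! R) (card D)) *
      (\<Sum>Z\<in>Pow (nullary sig). wt w wb (nullary sig) Z *
        fo2 N (edge_wt sig \<Phi> B w wb Z) us (int (card D)) (vertex_wt sig \<Phi> B w wb Z))"
  shows "icount sig \<Phi> w wb D = (V div M + b) - (2 * b + 1) * ((V div M + b) div (2 * b + 1)) - b"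
proof -
  have fo2: "fo2 N (edge_wt sig \<Phi> B w wb Z) us (int (card D)) (vertex_wt sig \<Phi> B w wb Z) =
    (\<Sum>g\<in>D \<rightarrow>\<^sub>E labels sig \<Phi>. (\<Prod>a\<in>D. vertex_wt sig \<Phi> B w wb Z (g a)) *
        (\<Prod>e\<in>upairs D. pair_wt sig \<Phi> B w wb Z g e))" if "Z \<in> Pow (nullary sig)" for Z
    unfolding us(1)[symmetric]
    using that by (intro fo2_eq_sum_labellings[OF D(1) us(2) N] pair_wt_eq_edge_wt) auto
  have "V = (\<Sum>\<omega>\<in>Pow (ground_atoms sig D).
      wt (\<lambda>\<alpha>. w (fst \<alpha>)) (\<lambda>\<alpha>. wb (fst \<alpha>)) (ground_atoms sig D) \<omega> * perturbed \<Phi> B D \<omega>)"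
    unfolding sum_perturbed_eq[OF D(1)] V prod_high_atoms[OF D(1), of "\<lambda>R. w R + wb R"]
    using fo2 by simp
  moreover have "\<exists>z. (\<Sum>\<omega>\<in>Pow (ground_atoms sig D).
      wt (\<lambda>\<alpha>. w (fst \<alpha>)) (\<lambda>\<alpha>. wb (fst \<alpha>)) (ground_atoms sig D) \<omega> * perturbed \<Phi> B D \<omega>) =
    B ^ scale_exp \<Phi> (card D) * (icount sig \<Phi> w wb D + B * z)"
    unfolding icount_def using perturbed_lead[OF D \<Phi>] by (intro sum_lead_mod)
  ultimately obtain z where z: "V = M * (icount sig \<Phi> w wb D + (2 * b + 1) * z)"
    unfolding M B by metis
  have "\<bar>icount sig \<Phi> w wb D\<bar> \<le> b" unfolding b by (rule abs_icount_le[OF D(1)])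
  \<comment> \<open>The bound on an absolute value gives \<open>b \<ge> 0\<close>, hence
    \<open>B \<ge> 1\<close>.\<close>
  moreover from this have "M > 0" unfolding M B by (intro zero_less_power) linarith
  ultimately show ?thesis using z by (rule icount_extract)
qed

text \<open>Every atom, true or false, is multiplied by both denominators of its predicate, so the
  common denominator is the same for all worlds.\<close>

lemma prod_quotients:
  fixes w wb :: "nat \<Rightarrow> rat"
  assumes D: "finite D" and \<omega>: "\<omega> \<subseteq> ground_atoms sig D"
    and a: "\<And>R. w R = of_int (a R) / of_int (b R)" "\<And>R. b R \<noteq> 0"
    and c: "\<And>R. wb R = of_int (c R) / of_int (d R)" "\<And>R. d R \<noteq> 0"
  shows "(\<Prod>R<length sig. w R ^ Ncount R \<omega> * wb R ^ (card D ^ (sig ! R) - Ncount R \<omega>)) =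
    of_int (wt (\<lambda>\<alpha>. a (fst \<alpha>) * d (fst \<alpha>)) (\<lambda>\<alpha>. c (fst \<alpha>) * b (fst \<alpha>)) (ground_atoms sig D) \<omega>) /
    of_int (\<Prod>R<length sig. (b R * d R) ^ (card D ^ (sig ! R)))"
proof -
  have "(\<Prod>ts\<in>{ts. set ts \<subseteq> D \<and> length ts = sig ! R}.
      if (R, ts) \<in> \<omega> then a R * d R else c R * b R) =
    (a R * d R) ^ Ncount R \<omega> * (c R * b R) ^ (card D ^ (sig ! R) - Ncount R \<omega>) \<and>
    Ncount R \<omega> \<le> card D ^ (sig ! R)"
    if R: "R < length sig" for R
  proof -
    define T where "T = {ts. set ts \<subseteq> D \<and> length ts = sig ! R}"
    have finT: "finite T" unfolding T_def by (rule finite_lists_length_eq[OF D])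
    have cT: "card T = card D ^ (sig ! R)" unfolding T_def by (rule card_lists_length_eq[OF D])
    have sub: "{ts. (R, ts) \<in> \<omega>} \<subseteq> T" using \<omega> by (auto simp: ground_atoms_def T_def)
    then have "T \<inter> {ts. (R, ts) \<in> \<omega>} = {ts. (R, ts) \<in> \<omega>}" "T \<inter> - {ts. (R, ts) \<in> \<omega>} = T - {ts. (R, ts) \<in> \<omega>}"
      by auto
    moreover have "card (T - {ts. (R, ts) \<in> \<omega>}) = card D ^ (sig ! R) - Ncount R \<omega>"
      using card_Diff_subset[OF finite_subset[OF sub finT] sub] cT by (simp add: Ncount_def)
    ultimately show ?thesis
      using card_mono[OF finT sub] cT
      unfolding T_def[symmetric] prod.If_cases[OF finT] by (simp add: Ncount_def)
  qed
  note R = this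
  have le: "\<And>R. R < length sig \<Longrightarrow> Ncount R \<omega> \<le> card D ^ (sig ! R)" using R by blast
  have "wt (\<lambda>\<alpha>. a (fst \<alpha>) * d (fst \<alpha>)) (\<lambda>\<alpha>. c (fst \<alpha>) * b (fst \<alpha>)) (ground_atoms sig D) \<omega> =
      (\<Prod>R<length sig. (a R * d R) ^ Ncount R \<omega> * (c R * b R) ^ (card D ^ (sig ! R) - Ncount R \<omega>))"
    unfolding wt_def prod_ground_atoms[OF D] fst_conv
    by (rule prod.cong[OF refl]) (use R in blast)
  then have 1: "of_int (wt (\<lambda>\<alpha>. a (fst \<alpha>) * d (fst \<alpha>)) (\<lambda>\<alpha>. c (fst \<alpha>) * b (fst \<alpha>)) (ground_atoms sig D) \<omega>) =
    (\<Prod>R<length sig. (of_int (a R * d R) ^ Ncount R \<omega> * of_int (c R * b R) ^ (card D ^ (sig ! R) - Ncount R \<omega>) :: rat))"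
    by simp
  have tm: "w R ^ k * wb R ^ (m - k) =
    of_int (a R * d R) ^ k * of_int (c R * b R) ^ (m - k) / of_int (b R * d R) ^ m"
    if "k \<le> m" for R k m
  proof -
    have m: "x ^ m = x ^ k * x ^ (m - k)" for x :: rat using that by (simp flip: power_add)
    have "(of_int (b R) :: rat) \<noteq> 0" "(of_int (d R) :: rat) \<noteq> 0" using a(2) c(2) by auto
    then show ?thesis
      unfolding m a(1) c(1) by (simp add: power_mult_distrib power_divide field_simps)
  qed
  show ?thesis
    unfolding 1 of_int_prod of_int_power prod_dividef[symmetric]
    by (intro prod.cong refl tm le) simp
qed

lemma WFOMC_eq_icount:
  fixes D :: "'a set" and w wb :: "nat \<Rightarrow> rat"
  assumes D: "finite D"
    and a: "\<And>R. w R = of_int (a R) / of_int (b R)" "\<And>R. b R \<noteq> 0"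
    and c: "\<And>R. wb R = of_int (c R) / of_int (d R)" "\<And>R. d R \<noteq> 0"
  shows "WFOMC sig \<Phi> w wb D = of_int (icount sig \<Phi> (\<lambda>R. a R * d R) (\<lambda>R. c R * b R) D) /
    of_int (\<Prod>R<length sig. (b R * d R) ^ (card D ^ (sig ! R)))"
proof -
  have "WFOMC sig \<Phi> w wb D = (\<Sum>\<omega>\<in>{\<omega>\<in>Pow (ground_atoms sig D). models D \<omega> \<Phi>}.
    of_int (wt (\<lambda>\<alpha>. a (fst \<alpha>) * d (fst \<alpha>)) (\<lambda>\<alpha>. c (fst \<alpha>) * b (fst \<alpha>)) (ground_atoms sig D) \<omega>) /
    of_int (\<Prod>R<length sig. (b R * d R) ^ (card D ^ (sig ! R))))"
    unfolding WFOMC_def worlds_def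
    by (intro sum.cong refl prod_quotients[OF D _ a c]) auto
  also have "\<dots> = (\<Sum>\<omega>\<in>{\<omega>\<in>Pow (ground_atoms sig D). models D \<omega> \<Phi>}.
    of_int (wt (\<lambda>\<alpha>. a (fst \<alpha>) * d (fst \<alpha>)) (\<lambda>\<alpha>. c (fst \<alpha>) * b (fst \<alpha>)) (ground_atoms sig D) \<omega>)) /
    of_int (\<Prod>R<length sig. (b R * d R) ^ (card D ^ (sig ! R)))"
    by (rule sum_divide_distrib[symmetric])
  also have "(\<Sum>\<omega>\<in>{\<omega>\<in>Pow (ground_atoms sig D). models D \<omega> \<Phi>}.
    of_int (wt (\<lambda>\<alpha>. a (fst \<alpha>) * d (fst \<alpha>)) (\<lambda>\<alpha>. c (fst \<alpha>) * b (fst \<alpha>)) (ground_atoms sig D) \<omega>)) =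
    (of_int (icount sig \<Phi> (\<lambda>R. a R * d R) (\<lambda>R. c R * b R) D) :: rat)"
  proof -
    have "(\<Sum>\<omega>\<in>{\<omega>\<in>Pow (ground_atoms sig D). models D \<omega> \<Phi>}.
      of_int (wt (\<lambda>\<alpha>. a (fst \<alpha>) * d (fst \<alpha>)) (\<lambda>\<alpha>. c (fst \<alpha>) * b (fst \<alpha>)) (ground_atoms sig D) \<omega>)) =
      (\<Sum>\<omega>\<in>Pow (ground_atoms sig D). if models D \<omega> \<Phi> then (of_int
        (wt (\<lambda>\<alpha>. a (fst \<alpha>) * d (fst \<alpha>)) (\<lambda>\<alpha>. c (fst \<alpha>) * b (fst \<alpha>)) (ground_atoms sig D) \<omega>) :: rat) else 0)"
      by (rule sum.inter_filter) (simp add: finite_ground_atoms[OF D])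
    then show ?thesis
      unfolding icount_def of_int_sum by (simp only:) (intro sum.cong, auto)
  qed
  finally show ?thesis .
qed

section \<open>Definability of the count\<close>

lemma definable_if: "definable v F \<Longrightarrow> definable v G \<Longrightarrow> definable v (\<lambda>N \<rho>. if P then F N \<rho> else G N \<rho>)"
  by (cases P) auto

lemma definable_wt:
  assumes "finite A" "\<And>x. x \<in> A \<Longrightarrow> definable v (f x)" "\<And>x. x \<in> A \<Longrightarrow> definable v (g x)"
  shows "definable v (\<lambda>N \<rho>. wt (\<lambda>x. f x N \<rho>) (\<lambda>x. g x N \<rho>) A X)"
  unfolding wt_def by (intro definable_prod definable_if assms)

lemma definable_vfac: "definable v b \<Longrightarrow> definable v (\<lambda>N \<rho>. vfac \<Phi> (b N \<rho>) \<omega> a c s)"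
  unfolding vfac_def
  by (intro definable_mult definable_prod definable_if definable_const definable_power
      definable_cnt_coeff finite_cnts)

lemma definable_efac: "definable v b \<Longrightarrow> definable v (\<lambda>N \<rho>. efac \<Phi> (b N \<rho>) \<omega> a a' c s c')"
  unfolding efac_def
  by (intro definable_prod definable_if definable_const definable_power finite_cnts)

lemma definable_vertex_wt:
  assumes "definable v b" "\<And>R. R < length sig \<Longrightarrow> definable v (w R)"
    "\<And>R. R < length sig \<Longrightarrow> definable v (wb R)"
  shows "definable v (\<lambda>N \<rho>. vertex_wt sig \<Phi> (b N \<rho>) (\<lambda>R. w R N \<rho>) (\<lambda>R. wb R N \<rho>) Z l)"
  unfolding vertex_wt_def
  by (intro definable_mult definable_wt definable_vfac assms) (auto simp: nonnull_def)

lemma definable_edge_wt: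
  assumes "definable v b" "\<And>R. R < length sig \<Longrightarrow> definable v (w R)"
    "\<And>R. R < length sig \<Longrightarrow> definable v (wb R)"
  shows "definable v (\<lambda>N \<rho>. edge_wt sig \<Phi> (b N \<rho>) (\<lambda>R. w R N \<rho>) (\<lambda>R. wb R N \<rho>) Z l l')"
  unfolding edge_wt_def
  by (intro definable_sum definable_mult definable_wt definable_efac assms)
    (auto simp: finite_atoms_on, auto simp: atoms_on_def)

text \<open>The domain is fixed here, so the sum over worlds is written out in full; this serves the
  empty domain.\<close>

lemma definable_icount:
  fixes D :: "'a set"
  assumes D: "finite D" and "\<And>R. R < length sig \<Longrightarrow> definable v (w R)"
    "\<And>R. R < length sig \<Longrightarrow> definable v (wb R)"
  shows "definable v (\<lambda>N \<rho>. icount sig \<Phi> (\<lambda>R. w R N \<rho>) (\<lambda>R. wb R N \<rho>) D)"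
  unfolding icount_def
  by (intro definable_sum definable_mult definable_wt definable_const assms)
    (auto simp: finite_ground_atoms[OF D], auto simp: ground_atoms_def)

lemma icount_cong:
  assumes "\<And>R. R < length sig \<Longrightarrow> w R = w' R" "\<And>R. R < length sig \<Longrightarrow> wb R = wb' R"
  shows "icount sig \<Phi> w wb D = icount sig \<Phi> w' wb' D"
  unfolding icount_def wt_def
  by (intro sum.cong refl arg_cong2[where f = "(*)"] prod.cong) (auto simp: ground_atoms_def assms)

lemma icount_definable:
  fixes sig :: "nat list" and \<Phi> :: fm and W WB :: "nat \<Rightarrow> nat \<Rightarrow> (nat \<Rightarrow> int) \<Rightarrow> int"
  assumes \<Phi>: "sentence \<Phi>" and v: "0 < v"
    and W: "\<And>R. R < length sig \<Longrightarrow> definable v (W R)"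
    and WB: "\<And>R. R < length sig \<Longrightarrow> definable v (WB R)"
  shows "\<exists>F. definable v F \<and> (\<forall>(D :: 'a set) N \<rho>. finite D \<longrightarrow> \<rho> 0 = int (card D) \<longrightarrow>
    card D < N \<longrightarrow> card D choose 2 \<le> N \<longrightarrow> (\<forall>R<length sig. card D ^ (sig ! R) \<le> N) \<longrightarrow>
    F N \<rho> = icount sig \<Phi> (\<lambda>R. W R N \<rho>) (\<lambda>R. WB R N \<rho>) D)"
proof -
  have "finite (labels sig \<Phi>)" by (simp add: labels_def finite_exps)
  then obtain us where us: "set us = labels sig \<Phi>" "distinct us"
    using finite_distinct_list by blast
  \<comment> \<open>Depends on the arity alone and enters the expression as a literal.\<close>
  define \<kappa> where "\<kappa> m = int (card {bs :: bool list. length bs = m \<and> set bs = UNIV})" for m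
  define k where "k = (\<Sum>t\<in>cnts \<Phi>. fst t choose 2)"
  define bnd where "bnd N \<rho> = (\<Prod>R<length sig. loop_power N (W R N \<rho> ^ 2 + WB R N \<rho> ^ 2 + 1) (\<rho> 0 ^ (sig ! R)))" for N \<rho>
  define B where "B N \<rho> = 2 * bnd N \<rho> + 1" for N \<rho>
  \<comment> \<open>The fixed factor \<open>k\<close> of \<open>scale_exp\<close> goes into the
    base, so that the loop exponent is \<open>card D\<close> and stays below
    \<open>N\<close>.\<close>
  define M where "M N \<rho> = loop_power N (B N \<rho> ^ k) (\<rho> 0)" for N \<rho>
  define hc where "hc m \<rho> = \<rho> 0 ^ m - (of_bool (m = 0) + of_bool (m > 0) * \<rho> 0 + (\<rho> 0 * (\<rho> 0 - 1) div 2) * \<kappa> m)"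
    for m :: nat and \<rho> :: "nat \<Rightarrow> int"
  define V where "V N \<rho> = (\<Prod>R<length sig. loop_power N (W R N \<rho> + WB R N \<rho>) (hc (sig ! R) \<rho>)) *
    (\<Sum>Z\<in>Pow (nullary sig). wt (\<lambda>R. W R N \<rho>) (\<lambda>R. WB R N \<rho>) (nullary sig) Z *
      fo2 N (\<lambda>u u'. edge_wt sig \<Phi> (B N \<rho>) (\<lambda>R. W R N \<rho>) (\<lambda>R. WB R N \<rho>) Z u u') us (\<rho> 0)
        (\<lambda>u. vertex_wt sig \<Phi> (B N \<rho>) (\<lambda>R. W R N \<rho>) (\<lambda>R. WB R N \<rho>) Z u))" for N \<rho>
  \<comment> \<open>The extraction is justified only for nonempty domains, through
    \<open>models_eq_sum_colours\<close>.\<close>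
  define F where "F N \<rho> = (if \<rho> 0 < 1
    then icount sig \<Phi> (\<lambda>R. W R N \<rho>) (\<lambda>R. WB R N \<rho>) ({} :: 'a set)
    else (V N \<rho> div M N \<rho> + bnd N \<rho>) -
      (2 * bnd N \<rho> + 1) * ((V N \<rho> div M N \<rho> + bnd N \<rho>) div (2 * bnd N \<rho> + 1)) - bnd N \<rho>)" for N \<rho>
  have n: "definable v (\<lambda>N \<rho>. \<rho> 0)" using v by (rule definable_var)
  have dbnd: "definable v bnd"
    unfolding bnd_def by (intro definable_prod definable_loop_power definable_intros n W WB) auto
  have dB: "definable v B" unfolding B_def by (intro definable_intros dbnd)
  have dM: "definable v M" unfolding M_def by (intro definable_loop_power definable_intros n dB)
  have dV: "definable v V"
    unfolding V_def hc_def
    by (intro definable_mult definable_sum definable_prod definable_loop_power definable_intros n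
        definable_wt definable_fo2 definable_edge_wt definable_vertex_wt dB W WB)
      (auto simp: nullary_def)
  have dF: "definable v F"
    unfolding F_def by (intro definable_intros definable_icount n dV dM dbnd W WB) auto
  have "F N \<rho> = icount sig \<Phi> (\<lambda>R. W R N \<rho>) (\<lambda>R. WB R N \<rho>) D"
    if D: "finite D" and \<rho>: "\<rho> 0 = int (card D)" and N: "card D < N" "card D choose 2 \<le> N"
      and ar: "\<And>R. R < length sig \<Longrightarrow> card D ^ (sig ! R) \<le> N" for D :: "'a set" and N \<rho>
  proof (cases "D = {}")
    case True
    then show ?thesis using \<rho> by (simp add: F_def)
  next
    case False
    then have pos: "\<not> \<rho> 0 < 1" using \<rho> D by (simp add: Suc_le_eq card_gt_0_iff)
    let ?W = "\<lambda>R. W R N \<rho>" and ?WB = "\<lambda>R. WB R N \<rho>"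
    have b: "bnd N \<rho> = ibound sig ?W ?WB (card D)"
      unfolding bnd_def ibound_def \<rho>
    proof (rule prod.cong[OF refl])
      fix R assume "R \<in> {..<length sig}"
      then show "loop_power N (W R N \<rho> ^ 2 + WB R N \<rho> ^ 2 + 1) (int (card D) ^ (sig ! R)) =
        (W R N \<rho> ^ 2 + WB R N \<rho> ^ 2 + 1) ^ card D ^ (sig ! R)"
        using loop_power[OF ar[of R]] by simp
    qed
    have M: "M N \<rho> = B N \<rho> ^ scale_exp \<Phi> (card D)"
      unfolding M_def \<rho> using N(1)
      by (simp add: loop_power scale_exp_def k_def power_mult[symmetric] mult.commute)
    have hc: "hc (sig ! R) \<rho> = int (high_count (sig ! R) (card D))" for R
    proof -
      have "int (card D) * (int (card D) - 1) div 2 = int (card D choose 2)"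
        by (cases "card D") (auto simp: choose_two zdiv_int algebra_simps)
      then show ?thesis
        unfolding hc_def high_count_def \<rho> \<kappa>_def of_nat_diff[OF card_high(2)[OF D, of "sig ! R"]] by simp
    qed
    have "high_count (sig ! R) (card D) \<le> N" if "R < length sig" for R
      using ar[OF that] unfolding high_count_def by linarith
    then have "V N \<rho> = (\<Prod>R<length sig. (?W R + ?WB R) ^ high_count (sig ! R) (card D)) *
      (\<Sum>Z\<in>Pow (nullary sig). wt ?W ?WB (nullary sig) Z *
        fo2 N (edge_wt sig \<Phi> (B N \<rho>) ?W ?WB Z) us (int (card D)) (vertex_wt sig \<Phi> (B N \<rho>) ?W ?WB Z))"
      unfolding V_def hc \<rho> by (simp add: loop_power)
    then have "icount sig \<Phi> ?W ?WB D = (V N \<rho> div M N \<rho> + bnd N \<rho>) -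
      (2 * bnd N \<rho> + 1) * ((V N \<rho> div M N \<rho> + bnd N \<rho>) div (2 * bnd N \<rho> + 1)) - bnd N \<rho>"
      by (intro icount_eq_fo2[OF D False \<Phi> us N b _ M]) (simp_all add: B_def)
    then show ?thesis unfolding F_def using pos by simp
  qed
  then show ?thesis using dF by blast
qed

section \<open>Reading the encoded input\<close>

lemma nth_concat_quadruples:
  assumes "R < m"
  shows "concat (map (\<lambda>R. [f R, g R, h R, k R]) [0..<m]) ! (4 * R) = f R"
    "concat (map (\<lambda>R. [f R, g R, h R, k R]) [0..<m]) ! (4 * R + 1) = g R"
    "concat (map (\<lambda>R. [f R, g R, h R, k R]) [0..<m]) ! (4 * R + 2) = h R"
    "concat (map (\<lambda>R. [f R, g R, h R, k R]) [0..<m]) ! (4 * R + 3) = k R"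
proof -
  define C where "C m = concat (map (\<lambda>R. [f R, g R, h R, k R]) [0..<m])" for m
  have len: "length (C m) = 4 * m" for m by (induction m) (auto simp: C_def)
  have CS: "C (Suc m) = C m @ [f m, g m, h m, k m]" for m by (simp add: C_def)
  have "C m ! (4 * R) = f R \<and> C m ! (4 * R + 1) = g R \<and> C m ! (4 * R + 2) = h R \<and> C m ! (4 * R + 3) = k R"
    using assms
  proof (induction m)
    case (Suc m)
    show ?case
    proof (cases "R = m")
      case True
      then show ?thesis by (simp add: CS nth_append len numeral_3_eq_3 numeral_2_eq_2)
    next
      case False
      then have "R < m" using Suc.prems by simp
      then show ?thesis using Suc.IH by (simp add: CS nth_append len)
    qed
  qed simp
  then show "concat (map (\<lambda>R. [f R, g R, h R, k R]) [0..<m]) ! (4 * R) = f R"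
    "concat (map (\<lambda>R. [f R, g R, h R, k R]) [0..<m]) ! (4 * R + 1) = g R"
    "concat (map (\<lambda>R. [f R, g R, h R, k R]) [0..<m]) ! (4 * R + 2) = h R"
    "concat (map (\<lambda>R. [f R, g R, h R, k R]) [0..<m]) ! (4 * R + 3) = k R"
    unfolding C_def by auto
qed

lemma length_enc: "length (enc sig n w wb) = 1 + 4 * length sig"
  by (simp add: enc_def length_concat o_def sum_list_triv)

lemma nth_enc:
  assumes "R < length sig"
  shows "enc sig n w wb ! 0 = int n"
    "enc sig n w wb ! (1 + 4 * R) = fst (quotient_of (w R))"
    "enc sig n w wb ! (2 + 4 * R) = snd (quotient_of (w R))"
    "enc sig n w wb ! (3 + 4 * R) = fst (quotient_of (wb R))"
    "enc sig n w wb ! (4 + 4 * R) = snd (quotient_of (wb R))"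
  using nth_concat_quadruples[OF assms, where f = "\<lambda>R. fst (quotient_of (w R))" and
      g = "\<lambda>R. snd (quotient_of (w R))" and h = "\<lambda>R. fst (quotient_of (wb R))" and
      k = "\<lambda>R. snd (quotient_of (wb R))"]
  unfolding enc_def by (simp_all add: nth_Cons' add.commute)

theorem theorem4:
  fixes sig :: "nat list" and \<Phi> :: fm
  assumes "wf_fm sig \<Phi>" and "sentence \<Phi>"
  shows "\<exists>(P::prog) (c::nat) (d::nat). \<forall>(D::'a set) w wb. finite D \<longrightarrow>
           computes_within P (enc sig (card D) w wb)
             (c * (enc_size sig (card D) w wb + 1) ^ d)
             (WFOMC sig \<Phi> w wb D)"
proof -
  define v where "v = 1 + 4 * length sig"
  \<comment> \<open>Large enough for \<open>(n + 1) ^ p\<close> to exceed \<open>n\<close> and to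
    bound \<open>n choose 2\<close> and every \<open>n ^ (sig ! R)\<close>.\<close>
  define p where "p = 2 + sum_list sig"
  \<comment> \<open>Numerator of one weight times denominator of the other, the integer weights of
    \<open>WFOMC_eq_icount\<close>, at their positions in the input.\<close>
  define W where "W R N \<rho> = \<rho> (1 + 4 * R) * \<rho> (4 + 4 * R)" for R N :: nat and \<rho> :: "nat \<Rightarrow> int"
  define WB where "WB R N \<rho> = \<rho> (3 + 4 * R) * \<rho> (2 + 4 * R)" for R N :: nat and \<rho> :: "nat \<Rightarrow> int"
  have dW: "definable v (W R)" "definable v (WB R)" if "R < length sig" for R
    using that unfolding W_def WB_def v_def by (auto intro!: definable_mult definable_var)
  have v0: "0 < v" by (simp add: v_def)
  have "\<exists>F. definable v F \<and> (\<forall>(D :: 'a set) N \<rho>. finite D \<longrightarrow> \<rho> 0 = int (card D) \<longrightarrow>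
    card D < N \<longrightarrow> card D choose 2 \<le> N \<longrightarrow> (\<forall>R<length sig. card D ^ (sig ! R) \<le> N) \<longrightarrow>
    F N \<rho> = icount sig \<Phi> (\<lambda>R. W R N \<rho>) (\<lambda>R. WB R N \<rho>) D)"
    using assms(2) v0 dW by (rule icount_definable)
  then obtain F where dF: "definable v F" and F: "\<forall>(D :: 'a set) N \<rho>. finite D \<longrightarrow> \<rho> 0 = int (card D) \<longrightarrow>
    card D < N \<longrightarrow> card D choose 2 \<le> N \<longrightarrow> (\<forall>R<length sig. card D ^ (sig ! R) \<le> N) \<longrightarrow>
    F N \<rho> = icount sig \<Phi> (\<lambda>R. W R N \<rho>) (\<lambda>R. WB R N \<rho>) D"
    by blast
  define G where "G N \<rho> = (\<Prod>R<length sig. loop_power N (\<rho> (2 + 4 * R) * \<rho> (4 + 4 * R)) (\<rho> 0 ^ (sig ! R)))"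
    for N and \<rho> :: "nat \<Rightarrow> int"
  have dG: "definable v G"
    unfolding G_def v_def
    by (intro definable_prod definable_loop_power definable_mult definable_power definable_var) auto
  obtain num den where num: "\<And>N \<rho>. eval N num \<rho> = F N \<rho>" and den: "\<And>N \<rho>. eval N den \<rho> = G N \<rho>"
    using dF dG unfolding definable_def by blast
  obtain P c d where P: "\<forall>xs n. length xs = v \<longrightarrow> xs ! 0 = int n \<longrightarrow>
    (let \<rho> = (\<lambda>i. if i < length xs then xs ! i else 0); N = (n + 1) ^ p in
     eval N den \<rho> \<noteq> 0 \<longrightarrow>
     computes_within P xs (c * (n + sum_list (map bitlen (tl xs)) + 1) ^ d)
       (of_int (eval N num \<rho>) / of_int (eval N den \<rho>)))"
    using computes_expr_quotient[OF v0, where p = p and num = num and den = den] by blast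
  have "computes_within P (enc sig (card D) w wb) (c * (enc_size sig (card D) w wb + 1) ^ d)
      (WFOMC sig \<Phi> w wb D)" if D: "finite D" for D :: "'a set" and w wb
  proof -
    define xs where "xs = enc sig (card D) w wb"
    define \<rho> where "\<rho> = (\<lambda>i. if i < length xs then xs ! i else 0)"
    define n where "n = card D"
    define N where "N = (n + 1) ^ p"
    define a where "a R = fst (quotient_of (w R))" for R
    define b where "b R = snd (quotient_of (w R))" for R
    define a' where "a' R = fst (quotient_of (wb R))" for R
    define b' where "b' R = snd (quotient_of (wb R))" for R
    have len: "length xs = v" by (simp add: xs_def length_enc v_def)
    have xs0: "xs ! 0 = int n" by (simp add: xs_def enc_def n_def)
    then have \<rho>0: "\<rho> 0 = int n" using len v0 by (simp add: \<rho>_def)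
    have \<rho>R: "\<rho> (1 + 4 * R) = a R" "\<rho> (2 + 4 * R) = b R" "\<rho> (3 + 4 * R) = a' R" "\<rho> (4 + 4 * R) = b' R"
      if "R < length sig" for R
      using nth_enc[OF that, of "card D" w wb] that len
      by (simp_all add: \<rho>_def v_def xs_def a_def b_def a'_def b'_def)
    have q: "w R = of_int (a R) / of_int (b R)" "b R \<noteq> 0"
      "wb R = of_int (a' R) / of_int (b' R)" "b' R \<noteq> 0" for R
      using quotient_of_div[of "w R"] quotient_of_div[of "wb R"]
        quotient_of_denom_pos'[of "w R"] quotient_of_denom_pos'[of "wb R"]
      by (auto simp: a_def b_def a'_def b'_def prod_eq_iff)
    have ar: "n ^ m \<le> N" if "m \<le> p" for m
    proof -
      have "n ^ m \<le> (n + 1) ^ m" by (intro power_mono) auto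
      also have "\<dots> \<le> N" unfolding N_def using that by (intro power_increasing) auto
      finally show ?thesis .
    qed
    have sp: "sig ! R \<le> p" if "R < length sig" for R
      using elem_le_sum_list[OF that] by (simp add: p_def)
    have "n < (n + 1) ^ 1" by simp
    also have "\<dots> \<le> N" unfolding N_def by (intro power_increasing) (auto simp: p_def)
    finally have nN: "n < N" .
    have "n choose 2 \<le> n ^ 2"
      by (simp add: choose_two power2_eq_square div_le_dividend order_trans[OF div_le_dividend])
    also have "\<dots> \<le> N" by (rule ar) (simp add: p_def)
    finally have n2N: "n choose 2 \<le> N" .
    have num': "eval N num \<rho> = icount sig \<Phi> (\<lambda>R. a R * b' R) (\<lambda>R. a' R * b R) D"
    proof -
      have "F N \<rho> = icount sig \<Phi> (\<lambda>R. W R N \<rho>) (\<lambda>R. WB R N \<rho>) D"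
        using \<rho>0 nN n2N ar sp unfolding n_def by (intro F[rule_format, OF D]) auto
      also have "\<dots> = icount sig \<Phi> (\<lambda>R. a R * b' R) (\<lambda>R. a' R * b R) D"
        by (intro icount_cong) (simp_all only: W_def WB_def \<rho>R)
      finally show ?thesis by (simp add: num)
    qed
    have den': "eval N den \<rho> = (\<Prod>R<length sig. (b R * b' R) ^ (card D ^ (sig ! R)))"
      unfolding den G_def
    proof (rule prod.cong[OF refl])
      fix R assume R: "R \<in> {..<length sig}"
      then have "loop_power N (b R * b' R) (int (n ^ (sig ! R))) = (b R * b' R) ^ (n ^ (sig ! R))"
        by (intro loop_power ar sp) auto
      then show "loop_power N (\<rho> (2 + 4 * R) * \<rho> (4 + 4 * R)) (\<rho> 0 ^ (sig ! R)) =
        (b R * b' R) ^ (card D ^ (sig ! R))"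
        using R by (simp only: \<rho>0 \<rho>R n_def of_nat_power lessThan_iff)
    qed
    have nz: "eval N den \<rho> \<noteq> 0" unfolding den' using q by simp
    have "WFOMC sig \<Phi> w wb D = of_int (eval N num \<rho>) / of_int (eval N den \<rho>)"
      unfolding num' den' by (rule WFOMC_eq_icount[OF D q])
    moreover have "computes_within P xs (c * (n + sum_list (map bitlen (tl xs)) + 1) ^ d)
      (of_int (eval N num \<rho>) / of_int (eval N den \<rho>))"
      using P[rule_format, OF len xs0] nz unfolding Let_def \<rho>_def[symmetric] N_def[symmetric] by blast
    ultimately show ?thesis by (simp add: enc_size_def xs_def n_def)
  qed
  then show ?thesis by blast
qed

end
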